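(* Let $0<b<1$ and let $C_{-b}$ be the Chebyshev's method of $p_{-b}(z)=(z^2-1)(z^2+b)$. Let $b_1$ be the largest positive extraneous fixed point of $C_{-b}$ and let $ib_3$, with $b_3>0$, be the extraneous fixed point of $C_{-b}$ lying on the positive imaginary axis. If the Fatou set of $C_{-b}$ consists only of the basins of attraction of the superattracting fixed points of $C_{-b}$, and $b_1\neq b_3$, then $\Sigma p_{-b}=\Sigma C_{-b}$.
   Context: For a polynomial $p$, the Chebyshev's method of $p$ is the rational map $C_p(z)=z-\left[1+\frac12 L_p(z)\right]\frac{p(z)}{p'(z)}$ with $L_p(z)=\frac{p(z)p''(z)}{(p'(z))^2}$, regarded as a self-map of the Riemann sphere $\widehat{\mathbb C}$. Write $C_{-b}:=C_{p_{-b}}$. The superattracting fixed points of $C_{-b}$ are the roots $\pm1,\pm i\sqrt b$ of $p_{-b}$. The basin of attraction of such a fixed point $\zeta$ is the set of all $z$ with $C_{-b}^n(z)\to\zeta$ as $n\to\infty$. An extraneous fixed point of $C_{-b}$ is a finite fixed point that is not a root of $p_{-b}$; for $0<b<1$ there are six of them, $\pm b_1,\pm b_2$ real and $\pm ib_3$ purely imaginary, with $0<b_2<\sqrt{(1-b)/2}<b_1<1$ and $0<b_3<\sqrt b$. For a rational map $R$ (in particular for a polynomial) with Julia set $\mathcal J(R)$, the symmetry group is $\Sigma R=\{\sigma:\sigma\text{ is a holomorphic Euclidean isometry of }\mathbb C\text{ and }\sigma(\mathcal J(R))=\mathcal J(R)\}$, where holomorphic Euclidean isometries are the maps $z\mapsto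 \alpha z+\beta$ with $|\alpha|=1$. *)

theory Defs
  imports
    "HOL-Analysis.Analysis"
    "HOL-Computational_Algebra.Computational_Algebra"
    "HOL-Computational_Algebra.Field_as_Ring"
begin

section \<open>The Riemann sphere\<close>

text \<open>The value of \<open>coord\<close> at infinity is a dummy.\<close>

datatype rsphere = Pt (coord: complex) | Infty
where "coord Infty = 0"

text \<open>
  Inverse stereographic projection onto the unit sphere of \<open>\<complex> \<times> \<real>\<close>. The metric it induces
  is the chordal metric; see \<open>dist_Pt_Pt\<close> and \<open>dist_Pt_Infty\<close> below.
\<close>

fun stereo :: "rsphere \<Rightarrow> complex \<times> real" where
  "stereo (Pt z) = (complex_of_real (2 / (1 + (cmod z)\<^sup>2)) * z, ((cmod z)\<^sup>2 - 1) / ((cmod z)\<^sup>2 + 1))"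
| "stereo Infty = (0, 1)"

lemma inj_stereo: "inj stereo"
proof (rule injI)
  fix x y :: rsphere
  assume eq: "stereo x = stereo y"
  have pos: "1 + (cmod z)\<^sup>2 > 0" for z
    by (simp add: add_pos_nonneg)
  have ne: "snd (stereo (Pt z)) \<noteq> 1" for z
    using pos[of z] by (simp add: field_simps)
  have recover: "z = complex_of_real (1 / (1 - snd (stereo (Pt z)))) * fst (stereo (Pt z))" for z
  proof -
    define t where "t = 2 / (1 + (cmod z)\<^sup>2)"
    have "t \<noteq> 0"
      using pos[of z] by (simp add: t_def)
    moreover have "1 - snd (stereo (Pt z)) = t"
      using pos[of z] by (simp add: t_def field_simps)
    moreover have "fst (stereo (Pt z)) = complex_of_real t * z"
      by (simp add: t_def)
    ultimately show ?thesis
      by simp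
  qed
  show "x = y"
  proof (cases x)
    case x: (Pt z)
    show ?thesis
    proof (cases y)
      case (Pt w)
      then show ?thesis
        using eq x recover[of z] recover[of w] by metis
    next
      case Infty
      then show ?thesis
        using eq x ne[of z] by simp
    qed
  next
    case x: Infty
    show ?thesis
    proof (cases y)
      case (Pt w)
      then show ?thesis
        using eq x ne[of w] by (metis snd_conv stereo.simps(2))
    next
      case Infty
      then show ?thesis
        using x by simp
    qed
  qed
qed

instantiation rsphere :: metric_space
begin

definition dist_rsphere :: "rsphere \<Rightarrow> rsphere \<Rightarrow> real" where
  "dist_rsphere x y = dist (stereo x) (stereo y)"

definition uniformity_rsphere :: "(rsphere \<times> rsphere) filter" where
  "uniformity_rsphere = (INF e\<in>{0<..}. principal {(x, y). dist x y < e})"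

definition open_rsphere :: "rsphere set \<Rightarrow> bool" where
  "open_rsphere U \<longleftrightarrow> (\<forall>x\<in>U. \<forall>\<^sub>F (x', y) in uniformity. x' = x \<longrightarrow> y \<in> U)"

instance
proof
  show "dist x y = 0 \<longleftrightarrow> x = y" for x y :: rsphere
    using inj_stereo by (auto simp: dist_rsphere_def inj_eq)
  show "dist x y \<le> dist x z + dist y z" for x y z :: rsphere
    unfolding dist_rsphere_def by (rule dist_triangle2)
qed (simp_all add: uniformity_rsphere_def open_rsphere_def)

end

lemma dist_stereo_aux:
  fixes a b c d :: real
  defines "A \<equiv> 1 + (a\<^sup>2 + b\<^sup>2)" and "B \<equiv> 1 + (c\<^sup>2 + d\<^sup>2)"
  shows "(2 / A * a - 2 / B * c)\<^sup>2 + (2 / A * b - 2 / B * d)\<^sup>2 + ((1 - 2 / A) - (1 - 2 / B))\<^sup>2 =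
    4 * ((a - c)\<^sup>2 + (b - d)\<^sup>2) / (A * B)"
proof -
  have pos: "A > 0" "B > 0"
    unfolding A_def B_def by (simp_all add: add_pos_nonneg)
  define x where "x = 1 / A"
  define y where "y = 1 / B"
  have x: "x * A = 1" and y: "y * B = 1"
    using pos by (simp_all add: x_def y_def)
  have "(2 * x * a - 2 * y * c)\<^sup>2 + (2 * x * b - 2 * y * d)\<^sup>2 + ((1 - 2 * x) - (1 - 2 * y))\<^sup>2 =
      4 * (x * (x * A) + y * (y * B) - 2 * x * y * (a * c + b * d + 1))"
    unfolding A_def B_def by algebra
  also have "\<dots> = 4 * (x * (y * B) + y * (x * A) - 2 * x * y * (a * c + b * d + 1))"
    by (simp only: x y)
  also have "\<dots> = 4 * ((a - c)\<^sup>2 + (b - d)\<^sup>2) * (x * y)"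
    unfolding A_def B_def by algebra
  finally show ?thesis
    by (simp add: x_def y_def)
qed

lemma dist_Pt_Pt:
  "dist (Pt z) (Pt w) = 2 * cmod (z - w) / (sqrt (1 + (cmod z)\<^sup>2) * sqrt (1 + (cmod w)\<^sup>2))"
proof -
  have s: "((cmod z)\<^sup>2 - 1) / ((cmod z)\<^sup>2 + 1) = 1 - 2 / (1 + (cmod z)\<^sup>2)" for z
  proof -
    have "1 + (cmod z)\<^sup>2 > 0"
      by (simp add: add_pos_nonneg)
    then show ?thesis
      by (simp add: field_simps)
  qed
  have "dist (Pt z) (Pt w) = sqrt (4 * ((Re z - Re w)\<^sup>2 + (Im z - Im w)\<^sup>2) /
      ((1 + (cmod z)\<^sup>2) * (1 + (cmod w)\<^sup>2)))"
    unfolding dist_rsphere_def stereo.simps s dist_Pair_Pair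
    by (simp only: dist_norm cmod_power2 minus_complex.simps Re_complex_of_real
        Im_complex_of_real times_complex.sel mult_zero_left diff_zero add_0_right
        real_norm_def power2_abs real_sqrt_pow2 dist_stereo_aux[symmetric])
  also have "\<dots> = sqrt ((2 * cmod (z - w))\<^sup>2 / ((1 + (cmod z)\<^sup>2) * (1 + (cmod w)\<^sup>2)))"
    by (simp add: power_mult_distrib cmod_power2)
  also have "\<dots> = 2 * cmod (z - w) / (sqrt (1 + (cmod z)\<^sup>2) * sqrt (1 + (cmod w)\<^sup>2))"
    by (simp only: real_sqrt_divide real_sqrt_mult real_sqrt_abs) simp
  finally show ?thesis .
qed

lemma dist_Pt_Infty: "dist (Pt z) Infty = 2 / sqrt (1 + (cmod z)\<^sup>2)"
proof -
  define r where "r = (cmod z)\<^sup>2"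
  have pos: "1 + r > 0"
    unfolding r_def by (simp add: add_pos_nonneg)
  have c: "cmod (complex_of_real (2 / (1 + r)) * z - 0) = 2 / (1 + r) * cmod z"
    using pos by (simp only: diff_zero norm_mult norm_of_real) simp
  have "dist (Pt z) Infty = sqrt ((2 / (1 + r))\<^sup>2 * r + ((r - 1) / (r + 1) - 1)\<^sup>2)"
    unfolding dist_rsphere_def stereo.simps dist_Pair_Pair r_def[symmetric]
    by (simp only: dist_norm c power_mult_distrib r_def[symmetric] real_norm_def power2_abs)
  also have "(2 / (1 + r))\<^sup>2 * r + ((r - 1) / (r + 1) - 1)\<^sup>2 = 2\<^sup>2 / (1 + r)"
  proof -
    have "(r - 1) / (r + 1) - 1 = - (2 / (1 + r))"
      using pos by (simp add: field_simps)
    then have "((r - 1) / (r + 1) - 1)\<^sup>2 = (2 / (1 + r))\<^sup>2"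
      by (simp only: power2_minus)
    then have "(2 / (1 + r))\<^sup>2 * r + ((r - 1) / (r + 1) - 1)\<^sup>2 = (2 / (1 + r))\<^sup>2 * (1 + r)"
      by (simp only: distrib_left mult_1_right add.commute)
    also have "\<dots> = 2\<^sup>2 / (1 + r)"
      using pos by (simp add: power2_eq_square divide_simps)
    finally show ?thesis .
  qed
  also have "sqrt \<dots> = 2 / sqrt (1 + r)"
    by (simp add: real_sqrt_divide)
  finally show ?thesis
    by (simp add: r_def)
qed

text \<open>The change of coordinate \<open>z \<mapsto> 1 / z\<close>, the chart at infinity.\<close>

fun sphere_inv :: "rsphere \<Rightarrow> rsphere" where
  "sphere_inv (Pt z) = (if z = 0 then Infty else Pt (1 / z))"
| "sphere_inv Infty = Pt 0"


section \<open>Rational functions as self-maps of the sphere\<close>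

text \<open>
  \<open>quot_of_fract\<close> returns coprime numerator and denominator, so they have no common zero.
  The value at infinity is the limit of \<open>P / Q\<close>: since \<open>coeff P (degree Q) = 0\<close> for \<open>degree P < degree Q\<close>,
  the last branch covers that case too.
\<close>

fun rat_map :: "complex poly fract \<Rightarrow> rsphere \<Rightarrow> rsphere" where
  "rat_map f (Pt z) = (let (P, Q) = quot_of_fract f in
     if poly Q z = 0 then Infty else Pt (poly P z / poly Q z))"
| "rat_map f Infty = (let (P, Q) = quot_of_fract f in
     if degree P > degree Q then Infty else Pt (coeff P (degree Q) / lead_coeff Q))"

definition poly_map :: "complex poly \<Rightarrow> rsphere \<Rightarrow> rsphere" where
  "poly_map p = rat_map (to_fract p)"


section \<open>Dynamics on the sphere\<close>

definition normal_on :: "(rsphere \<Rightarrow> rsphere) set \<Rightarrow> rsphere set \<Rightarrow> bool" where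
  "normal_on F U \<longleftrightarrow>
     (\<forall>f :: nat \<Rightarrow> rsphere \<Rightarrow> rsphere. range f \<subseteq> F \<longrightarrow>
        (\<exists>(r :: nat \<Rightarrow> nat) g. strict_mono r \<and>
           (\<forall>K. compact K \<and> K \<subseteq> U \<longrightarrow> uniform_limit K (\<lambda>n. f (r n)) g sequentially)))"

definition Fatou :: "(rsphere \<Rightarrow> rsphere) \<Rightarrow> rsphere set" where
  "Fatou R = {z. \<exists>U. open U \<and> z \<in> U \<and> normal_on (range (\<lambda>n. R ^^ n)) U}"

definition Julia :: "(rsphere \<Rightarrow> rsphere) \<Rightarrow> rsphere set" where
  "Julia R = - Fatou R"

definition basin :: "(rsphere \<Rightarrow> rsphere) \<Rightarrow> rsphere \<Rightarrow> rsphere set" where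
  "basin R \<zeta> = {z. (\<lambda>n. (R ^^ n) z) \<longlonglongrightarrow> \<zeta>}"

text \<open>Fixed points of multiplier 0, computed in the chart \<open>1 / z\<close> at infinity.\<close>

definition superattracting_fixpoint :: "(rsphere \<Rightarrow> rsphere) \<Rightarrow> rsphere \<Rightarrow> bool" where
  "superattracting_fixpoint R \<zeta> \<longleftrightarrow> R \<zeta> = \<zeta> \<and>
     (case \<zeta> of
        Pt z \<Rightarrow> ((\<lambda>w. coord (R (Pt w))) has_field_derivative 0) (at z)
      | Infty \<Rightarrow> ((\<lambda>w. coord (sphere_inv (R (sphere_inv (Pt w))))) has_field_derivative 0) (at 0))"

text \<open>
  The Julia set may contain infinity, so a plane isometry acts on it through its continuous
  extension to the sphere, which fixes infinity.
\<close>

fun sphere_ext :: "(complex \<Rightarrow> complex) \<Rightarrow> rsphere \<Rightarrow> rsphere" where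
  "sphere_ext \<sigma> (Pt z) = Pt (\<sigma> z)"
| "sphere_ext \<sigma> Infty = Infty"

definition holomorphic_isometry :: "(complex \<Rightarrow> complex) \<Rightarrow> bool" where
  "holomorphic_isometry \<sigma> \<longleftrightarrow> (\<exists>\<alpha> \<beta>. cmod \<alpha> = 1 \<and> \<sigma> = (\<lambda>z. \<alpha> * z + \<beta>))"

definition symmetry_group :: "(rsphere \<Rightarrow> rsphere) \<Rightarrow> (complex \<Rightarrow> complex) set" where
  "symmetry_group R = {\<sigma>. holomorphic_isometry \<sigma> \<and> sphere_ext \<sigma> ` Julia R = Julia R}"


section \<open>Chebyshev's method\<close>

definition chebyshev_L :: "complex poly \<Rightarrow> complex poly fract" where
  "chebyshev_L p = to_fract p * to_fract (pderiv (pderiv p)) / (to_fract (pderiv p))\<^sup>2"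

definition chebyshev_fract :: "complex poly \<Rightarrow> complex poly fract" where
  "chebyshev_fract p =
     to_fract [:0, 1:] - (1 + 1 / 2 * chebyshev_L p) * (to_fract p / to_fract (pderiv p))"

definition chebyshev_map :: "complex poly \<Rightarrow> rsphere \<Rightarrow> rsphere" where
  "chebyshev_map p = rat_map (chebyshev_fract p)"

definition extraneous_fixpoint :: "complex poly \<Rightarrow> complex \<Rightarrow> bool" where
  "extraneous_fixpoint p z \<longleftrightarrow> chebyshev_map p (Pt z) = Pt z \<and> poly p z \<noteq> 0"

definition p_neg :: "real \<Rightarrow> complex poly" where
  "p_neg b = [:-1, 0, 1:] * [:of_real b, 0, 1:]"

lemma poly_p_neg: "poly (p_neg b) z = (z\<^sup>2 - 1) * (z\<^sup>2 + of_real b)"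
  by (simp add: p_neg_def power2_eq_square algebra_simps)

end

theory Submission
  imports Defs "HOL-Complex_Analysis.Complex_Analysis"
begin

text \<open>
  Both groups equal \<open>{id, -id}\<close>.

  For the polynomial \<open>p\<close>, let \<open>K\<close> be the filled Julia set and \<open>w\<close> a point of \<open>K\<close> of maximal modulus
  \<open>r\<close>. If the isometry \<open>\<sigma>(z) = \<alpha> z + \<beta>\<close> preserves the Julia set, the maximum principle gives
  \<open>\<bar>p \<circ> \<sigma>\<bar> \<le> r\<close> on \<open>K\<close>. The monic polynomial \<open>q = (p \<circ> \<sigma>) / \<alpha>\<^sup>4\<close> has mean \<open>w + \<kappa>\<close> over
  the fibre of \<open>p\<close> over \<open>w\<close>, and similarly for \<open>-w\<close>; extremality forces \<open>\<kappa> = 0\<close> and \<open>q = p\<close> on both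
  fibres, hence everywhere.

  For Chebyshev's method, the Fatou set contains the far parts of both coordinate axes, while 0 lies in
  the Julia set. It is invariant under \<open>z \<mapsto> -z\<close> and complex conjugation, so a symmetry with
  \<open>\<beta> \<noteq> 0\<close> would yield a symmetry by a real or imaginary translation, which moves 0 onto an axis and
  far out. For a rotation with \<open>\<alpha>\<^sup>2 \<noteq> 1\<close>, comparing the method with its conjugate by the rotation
  near the repelling fixed point at infinity shows that the Julia set is asymptotically invariant under real
  translations in the coordinate \<open>z\<^sup>2\<close>, in both directions. These push any far point into a sector
  around an axis, which lies in the Fatou set. So a neighbourhood of infinity minus infinity would lie in the
  Fatou set, contradicting that large circles are connected and meet two different basins.
\<close>

section \<open>Chebyshev's method of an even quartic\<close>

text \<open>\<open>cheb s m\<close> is Chebyshev's method of \<open>z\<^sup>4 - s z\<^sup>2 - m\<close>.\<close>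

definition cheb :: "'a::field \<Rightarrow> 'a \<Rightarrow> 'a \<Rightarrow> 'a" where
  "cheb s m z = z - (1 + (z^4 - s * z^2 - m) * (12 * z^2 - 2 * s) / (2 * (4 * z^3 - 2 * s * z)^2)) *
     ((z^4 - s * z^2 - m) / (4 * z^3 - 2 * s * z))"

text \<open>The quotient \<open>cheb s m z / z\<close> in the variable \<open>v = 1 / z^2\<close>, a
  chart in which infinity becomes \<open>v = 0\<close>. Its value 21/32 there makes infinity a
  repelling fixed point of multiplier 32/21.\<close>

definition cheb_inf :: "'a::field \<Rightarrow> 'a \<Rightarrow> 'a \<Rightarrow> 'a" where
  "cheb_inf s m v = 1 - (1 + (1 - s * v - m * v^2) * (12 - 2 * s * v) / (2 * (4 - 2 * s * v)^2)) *
     ((1 - s * v - m * v^2) / (4 - 2 * s * v))"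

lemma cheb_eq_cheb_inf:
  assumes "z \<noteq> 0"
  shows "cheb s m z = z * cheb_inf s m (1 / z^2)"
proof -
  define v where "v = 1 / z^2"
  have 1: "z^4 - s * z^2 - m = z^4 * (1 - s * v - m * v^2)"
    using assms by (simp add: v_def field_simps power2_eq_square eval_nat_numeral)
  have 2: "12 * z^2 - 2 * s = z^2 * (12 - 2 * s * v)"
    using assms by (simp add: v_def field_simps)
  have 3: "4 * z^3 - 2 * s * z = z^3 * (4 - 2 * s * v)"
    using assms by (simp add: v_def field_simps eval_nat_numeral)
  have 4: "z^4 * A * (z^2 * B) / (2 * (z^3 * D)^2) = A * B / (2 * D^2)" for A B D
  proof -
    have "z^4 * A * (z^2 * B) = z^6 * (A * B)" "2 * (z^3 * D)^2 = z^6 * (2 * D^2)"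
      by (simp_all add: eval_nat_numeral algebra_simps)
    then show ?thesis
      by (simp only:) (simp add: assms)
  qed
  have 5: "z^4 * A / (z^3 * D) = z * (A / D)" for A D
  proof -
    have "z^4 * A = z^3 * (z * A)"
      by (simp add: eval_nat_numeral algebra_simps)
    then show ?thesis by (simp only:) (simp add: assms)
  qed
  show ?thesis
    unfolding cheb_def cheb_inf_def v_def[symmetric] 1 2 3 4 5
    by (simp add: right_diff_distrib mult.left_commute)
qed

lemma cheb_minus: "cheb s m (- z) = - cheb s m (z :: 'a :: field)"
proof -
  have "4 * (- z)^3 - 2 * s * (- z) = - (4 * z^3 - 2 * s * z)"
    by (simp add: eval_nat_numeral algebra_simps)
  then show ?thesis
    by (simp only: cheb_def) (simp add: divide_minus_right del: minus_diff_eq)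
qed

lemma cheb_of_real:
  "cheb (of_real s) (of_real m) (of_real x) = (of_real (cheb s m x) :: 'a :: real_field)"
  by (simp add: cheb_def)

lemma cheb_cnj: "cheb (of_real s) (of_real m) (cnj z) = cnj (cheb (of_real s) (of_real m) z)"
  by (simp add: cheb_def)

text \<open>A quarter turn replaces \<open>s\<close> by \<open>- s\<close>, so the imaginary axis
  can be treated by the results for the real axis.\<close>

lemma cheb_ii: "cheb s m (\<i> * z) = \<i> * cheb (- s) m z"
proof -
  have i: "\<i>^4 = 1" "\<i>^3 = - \<i>"
    by (simp_all add: power4_eq_xxxx power3_eq_cube)
  have e: "(\<i> * z)^4 = z^4" "(\<i> * z)^2 = - (z^2)" "(\<i> * z)^3 = - \<i> * z^3"
    by (simp_all add: power_mult_distrib i)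
  have 1: "(\<i> * z)^4 - s * (\<i> * z)^2 - m = z^4 - (- s) * z^2 - m"
    by (simp add: e)
  have 2: "12 * (\<i> * z)^2 - 2 * s = - (12 * z^2 - 2 * (- s))"
    by (simp add: e algebra_simps)
  have 3: "4 * (\<i> * z)^3 - 2 * s * (\<i> * z) = - \<i> * (4 * z^3 - 2 * (- s) * z)"
    unfolding e by (simp add: algebra_simps)
  have 4: "A * (- B) / (2 * (- \<i> * D)^2) = A * B / (2 * D^2)" for A B D :: complex
    by (simp add: power_mult_distrib)
  have 5: "A / (- \<i> * D) = \<i> * (A / D)" for A D :: complex
    by (cases "D = 0") (auto simp: field_simps)
  have 6: "\<i> * z - A * (\<i> * B) = \<i> * (z - A * B)" for A B
    by (simp add: algebra_simps)
  show ?thesis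
    unfolding cheb_def 1 2 3 4 5 6 ..
qed

section \<open>Expansion of the method at infinity\<close>

lemma cheb_inf_0: "cheb_inf s m 0 = (21 / 32 :: complex)"
  by (simp add: cheb_inf_def)

text \<open>This is the coefficient of \<open>1 / z\<close> in the expansion of
  \<open>cheb s m z\<close> at infinity.\<close>

lemma DERIV_cheb_inf_0: "(cheb_inf s m has_field_derivative 3 * s / 16) (at (0 :: complex))"
  unfolding cheb_inf_def [abs_def]
  by (rule derivative_eq_intros refl | simp)+

lemma holomorphic_cheb_inf:
  assumes "\<And>v. v \<in> A \<Longrightarrow> 4 - 2 * s * v \<noteq> 0"
  shows "cheb_inf s m holomorphic_on A"
  unfolding cheb_inf_def [abs_def]
  using assms by (intro holomorphic_intros) auto

text \<open>The remainder \<^term>\<open>cheb s m z - 21 / 32 * z\<close> has the form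
  \<open>z * (\<Phi> (1 / z\<^sup>2) - \<Phi> 0)\<close> with \<open>\<Phi>\<close> holomorphic at 0.\<close>

lemma cheb_remainder:
  fixes s m :: complex
  obtains K E' where "K > 0"
    "\<And>z. cmod z \<ge> cmod s + 1 \<Longrightarrow> cmod (cheb s m z - 21 / 32 * z) \<le> K / cmod z"
    "\<And>z. cmod z \<ge> cmod s + 1 \<Longrightarrow>
       ((\<lambda>z. cheb s m z - 21 / 32 * z) has_field_derivative E' z) (at z)"
    "\<And>z. cmod z \<ge> cmod s + 1 \<Longrightarrow> cmod (E' z) \<le> K / (cmod z)\<^sup>2"
proof -
  \<comment> \<open>For \<open>cmod z \<ge> cmod s + 1\<close> the point \<open>1 / z^2\<close> lies
    in the closed disc of radius \<open>\<rho>\<close>. The disc of radius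
    \<open>3 / 2 * \<rho>\<close> still avoids the zero of \<open>4 - 2 * s * v\<close>, which
    bounds the derivative on the smaller closed disc.\<close>
  define \<rho> where "\<rho> = 1 / (cmod s + 1)"
  have \<rho>: "\<rho> > 0" by (simp add: \<rho>_def add_nonneg_pos)
  define \<Phi> where "\<Phi> = cheb_inf s m"
  have hol: "\<Phi> holomorphic_on ball 0 (3 / 2 * \<rho>)"
    unfolding \<Phi>_def
  proof (rule holomorphic_cheb_inf)
    fix v :: complex assume "v \<in> ball 0 (3 / 2 * \<rho>)"
    then have "cmod v < 3 / 2 * \<rho>" by simp
    then have "cmod s * cmod v \<le> cmod s * (3 / 2 * \<rho>)"
      by (intro mult_left_mono) auto
    also have "\<dots> \<le> 3 / 2"
      by (simp add: \<rho>_def divide_simps add_nonneg_pos)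
    finally have "cmod (2 * s * v) < cmod 4" by (simp add: norm_mult)
    then show "4 - 2 * s * v \<noteq> 0"
      by (metis eq_iff_diff_eq_0 less_irrefl)
  qed
  have "deriv \<Phi> holomorphic_on ball 0 (3 / 2 * \<rho>)"
    using hol by (rule holomorphic_deriv) simp
  then have "continuous_on (cball 0 \<rho>) (deriv \<Phi>)"
    using \<rho> by (intro continuous_on_subset[OF holomorphic_on_imp_continuous_on]) auto
  then have "compact (deriv \<Phi> ` cball 0 \<rho>)"
    by (intro compact_continuous_image) auto
  then obtain M where M: "M > 0" "\<And>v. cmod v \<le> \<rho> \<Longrightarrow> cmod (deriv \<Phi> v) \<le> M"
    unfolding bounded_pos[THEN iffD1, OF compact_imp_bounded] using compact_imp_bounded
    by (metis bounded_pos image_eqI mem_cball_0)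
  have der: "(\<Phi> has_field_derivative deriv \<Phi> v) (at v)" if "cmod v \<le> \<rho>" for v
    using hol that \<rho> by (intro holomorphic_derivI[OF hol]) auto
  have lip: "cmod (\<Phi> v - 21 / 32) \<le> M * cmod v" if "cmod v \<le> \<rho>" for v
  proof -
    have "cmod (\<Phi> v - \<Phi> 0) \<le> M * cmod (v - 0)"
    proof (rule field_differentiable_bound)
      show "convex (cball (0 :: complex) \<rho>)" by simp
      show "(\<Phi> has_field_derivative deriv \<Phi> w) (at w within cball 0 \<rho>)" if "w \<in> cball 0 \<rho>" for w
        using der that by (auto intro: has_field_derivative_at_within)
    qed (use M that \<rho> in auto)
    then show ?thesis by (simp add: \<Phi>_def cheb_inf_0)
  qed
  define E' where "E' z = \<Phi> (1 / z^2) - 21 / 32 - 2 / z^2 * deriv \<Phi> (1 / z^2)" for z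
  have small: "cmod (1 / z^2) \<le> \<rho>" "z \<noteq> 0" "cmod z > 0" if "cmod z \<ge> cmod s + 1" for z
  proof -
    have "cmod z \<ge> 1" using that by (smt (verit) norm_ge_zero)
    then have "(cmod z)\<^sup>2 \<ge> cmod z" by (simp add: self_le_power)
    then have "(cmod z)\<^sup>2 \<ge> cmod s + 1" using that by linarith
    then show "cmod (1 / z^2) \<le> \<rho>"
      unfolding \<rho>_def by (simp add: norm_divide norm_power frac_le add_nonneg_pos)
    show "cmod z > 0" using \<open>cmod z \<ge> 1\<close> by linarith
    then show "z \<noteq> 0" by auto
  qed
  have E: "cheb s m z - 21 / 32 * z = z * (\<Phi> (1 / z^2) - 21 / 32)" if "z \<noteq> 0" for z
    using that by (simp add: cheb_eq_cheb_inf \<Phi>_def algebra_simps)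
  show thesis
  \<comment> \<open>In the bound on \<open>E'\<close>, the difference of values contributes
    \<open>M / (cmod z)^2\<close> and the chain rule term twice as much.\<close>
  proof (rule that[of "3 * M" E'])
    fix z :: complex assume z: "cmod z \<ge> cmod s + 1"
    note sm = small[OF z]
    have n: "cmod (1 / z^2) = 1 / (cmod z)\<^sup>2" by (simp add: norm_divide norm_power)
    have l: "cmod (\<Phi> (1 / z^2) - 21 / 32) \<le> M / (cmod z)\<^sup>2"
      using lip[OF sm(1)] unfolding n by simp
    have "cmod (cheb s m z - 21 / 32 * z) \<le> cmod z * (M / (cmod z)\<^sup>2)"
      unfolding E[OF sm(2)] norm_mult using l by (intro mult_left_mono) auto
    also have "\<dots> = M / cmod z" using sm(2) by (simp add: power2_eq_square)
    also have "\<dots> \<le> 3 * M / cmod z" using M sm by (intro divide_right_mono) auto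
    finally show "cmod (cheb s m z - 21 / 32 * z) \<le> 3 * M / cmod z" .
    have "cmod (E' z) \<le> cmod (\<Phi> (1 / z^2) - 21 / 32) + cmod (2 / z^2 * deriv \<Phi> (1 / z^2))"
      unfolding E'_def by (rule norm_triangle_ineq4)
    also have "cmod (2 / z^2 * deriv \<Phi> (1 / z^2)) \<le> 2 / (cmod z)\<^sup>2 * M"
      unfolding norm_mult using M(2)[OF sm(1)]
      by (intro mult_mono) (auto simp: norm_divide norm_power)
    finally show "cmod (E' z) \<le> 3 * M / (cmod z)\<^sup>2" using l by simp
    have "((\<lambda>z. z * (\<Phi> (1 / z^2) - 21 / 32)) has_field_derivative E' z) (at z)"
    proof -
      have "((\<lambda>z. 1 / z^2) has_field_derivative - 2 / z^3) (at z)"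
        using sm(2) by (auto intro!: derivative_eq_intros simp: field_simps eval_nat_numeral)
      from DERIV_chain2[OF der[OF sm(1)] this] show ?thesis
        using sm(2) unfolding E'_def
        by (auto intro!: derivative_eq_intros simp: field_simps eval_nat_numeral)
    qed
    moreover have "\<forall>\<^sub>F w in nhds z. cheb s m w - 21 / 32 * w = w * (\<Phi> (1 / w^2) - 21 / 32)"
      using t1_space_nhds[OF sm(2)] by eventually_elim (rule E)
    ultimately show "((\<lambda>z. cheb s m z - 21 / 32 * z) has_field_derivative E' z) (at z)"
      by (subst DERIV_cong_ev[OF refl _ refl])
  qed (use M in simp)
qed

lemma filterlim_inverse_square_at_infinity:
  "filterlim (\<lambda>z :: complex. 1 / z^2) (at 0) at_infinity"
proof -
  have "filterlim (\<lambda>z :: complex. inverse (z^2)) (at 0) at_infinity"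
    unfolding filterlim_inverse_at_iff by (rule filterlim_power_at_infinity) simp
  then show ?thesis by (simp add: inverse_eq_divide)
qed

text \<open>At \<open>v = 1 / z^2\<close> the expression is the difference quotient of
  \<open>cheb_inf\<close> at 0, so its limit is the derivative there.\<close>

lemma cheb_expansion:
  "((\<lambda>z. z * (cheb s m z - 21 / 32 * z)) \<longlongrightarrow> 3 * s / 16) (at_infinity :: complex filter)"
proof -
  have "((\<lambda>v. (cheb_inf s m v - cheb_inf s m 0) / (v - 0)) \<longlongrightarrow> 3 * s / 16) (at 0)"
    using DERIV_cheb_inf_0[of s m] by (simp add: has_field_derivative_iff)
  from filterlim_compose[OF this filterlim_inverse_square_at_infinity]
  have "((\<lambda>z. z^2 * (cheb_inf s m (1 / z^2) - 21 / 32)) \<longlongrightarrow> 3 * s / 16) at_infinity"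
    by (simp add: cheb_inf_0 mult.commute)
  moreover have "\<forall>\<^sub>F z in at_infinity.
      z^2 * (cheb_inf s m (1 / z^2) - 21 / 32) = z * (cheb s m z - 21 / 32 * z)"
    using eventually_not_equal_at_infinity[of 0]
    by eventually_elim (simp add: cheb_eq_cheb_inf algebra_simps power2_eq_square)
  ultimately show ?thesis by (rule Lim_transform_eventually)
qed

section \<open>The derivative of the method\<close>

text \<open>All terms without the factor \<open>(Q z)^2\<close> cancel. This factor makes simple
  roots of \<open>Q\<close> critical fixed points, and it is a square on the real line.\<close>

lemma DERIV_chebyshev_step:
  fixes Q Q1 Q2 :: "'a :: real_normed_field \<Rightarrow> 'a"
  assumes d: "(Q has_field_derivative Q1 z) (at z)" "(Q1 has_field_derivative Q2 z) (at z)"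
    "(Q2 has_field_derivative D) (at z)" and n: "Q1 z \<noteq> 0"
  shows "((\<lambda>z. z - (1 + Q z * Q2 z / (2 * (Q1 z)^2)) * (Q z / Q1 z)) has_field_derivative
    (Q z)^2 * (3 * (Q2 z)^2 - Q1 z * D) / (2 * (Q1 z)^4)) (at z)"
  using n
  apply (auto intro!: derivative_eq_intros d)
  apply (simp add: divide_simps)
  apply algebra
  done

lemma DERIV_cheb:
  fixes s m z :: "'a :: real_normed_field"
  assumes "4 * z^3 - 2 * s * z \<noteq> 0"
  shows "(cheb s m has_field_derivative (z^4 - s * z^2 - m)^2 *
    (3 * (12 * z^2 - 2 * s)^2 - (4 * z^3 - 2 * s * z) * (24 * z)) / (2 * (4 * z^3 - 2 * s * z)^4)) (at z)"
  unfolding cheb_def [abs_def]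
  by (rule DERIV_chebyshev_step) (use assms in \<open>auto intro!: derivative_eq_intros\<close>)

lemma cheb_root:
  assumes "z^4 - s * z^2 - m = 0"
  shows "cheb s m z = z"
  using assms by (simp add: cheb_def)

section \<open>Real iteration to the right of the positive root\<close>

context
  fixes r t s m :: real
  assumes rt: "r > 0" "t > 0" and s: "s = r^2 - t" and m: "m = r^2 * t"
begin

text \<open>The quartic factors as \<open>(x^2 - r^2) * (x^2 + t)\<close>. It is used with
  \<open>r = 1\<close>, \<open>t = b\<close> on the real axis and with \<open>r = sqrt b\<close>,
  \<open>t = 1\<close> on the imaginary axis.\<close>

lemma quartic_signs:
  assumes "x \<ge> r"
  shows "4 * x^3 - 2 * s * x > 0" "12 * x^2 - 2 * s > 0"
    "x > r \<Longrightarrow> x^4 - s * x^2 - m > 0"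
proof -
  have x: "x > 0" "x^2 \<ge> r^2" using assms rt by (auto intro: power_mono)
  have "4 * x^3 - 2 * s * x = 2 * x * (2 * (x^2 - r^2) + r^2 + t)"
    by (simp add: s power2_eq_square power3_eq_cube algebra_simps)
  also have "\<dots> > 0" using x rt by (intro mult_pos_pos add_nonneg_pos add_nonneg_nonneg) auto
  finally show "4 * x^3 - 2 * s * x > 0" .
  show "12 * x^2 - 2 * s > 0"
    using x rt s zero_le_power2[of x] by linarith
  assume "x > r"
  then have "x^2 > r^2" using rt by (intro power_strict_mono) auto
  moreover have "x^4 - s * x^2 - m = (x^2 - r^2) * (x^2 + t)"
    by (simp add: s m power2_eq_square power4_eq_xxxx algebra_simps)
  ultimately show "x^4 - s * x^2 - m > 0" using rt by (simp add: add_nonneg_pos)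
qed

lemma cheb_root_r: "cheb s m r = r"
  by (rule cheb_root) (simp add: s m power2_eq_square power4_eq_xxxx algebra_simps)

text \<open>The quartic and its first two derivatives are positive at \<open>x\<close>, so the
  correction subtracted from \<open>x\<close> is positive.\<close>

lemma cheb_less:
  assumes "x > r"
  shows "cheb s m x < x"
  using quartic_signs[of x] assms unfolding cheb_def
  by (simp add: zero_less_mult_iff zero_less_divide_iff add_pos_nonneg)

text \<open>The numerator of the derivative is a multiple of a sum of squares, so the map is
  nondecreasing on the ray, whose endpoint \<open>r\<close> is fixed.\<close>

lemma cheb_ge:
  assumes "x \<ge> r"
  shows "cheb s m x \<ge> r"
proof -
  have "cheb s m r \<le> cheb s m x"
  proof (rule DERIV_nonneg_imp_nondecreasing[OF assms], intro exI conjI)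
    fix y assume y: "r \<le> y" "y \<le> x"
    show "(cheb s m has_real_derivative (y^4 - s * y^2 - m)^2 *
        (3 * (12 * y^2 - 2 * s)^2 - (4 * y^3 - 2 * s * y) * (24 * y)) / (2 * (4 * y^3 - 2 * s * y)^4)) (at y)"
      by (rule DERIV_cheb) (use quartic_signs[OF y(1)] in simp)
    have "3 * (12 * y^2 - 2 * s)^2 - (4 * y^3 - 2 * s * y) * (24 * y) = 12 * ((s - 4 * y^2)^2 + 12 * y^4)"
      by (simp add: power2_eq_square power3_eq_cube power4_eq_xxxx algebra_simps)
    then show "0 \<le> (y^4 - s * y^2 - m)^2 *
        (3 * (12 * y^2 - 2 * s)^2 - (4 * y^3 - 2 * s * y) * (24 * y)) / (2 * (4 * y^3 - 2 * s * y)^4)"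
      using quartic_signs(1)[OF y(1)] by simp
  qed
  then show ?thesis by (simp add: cheb_root_r)
qed

lemma cheb_le:
  assumes "x \<ge> r"
  shows "cheb s m x \<le> x"
  using cheb_less[of x] cheb_root_r assms by (cases "x = r") auto

text \<open>The orbit decreases and stays above \<open>r\<close>. Its limit is a fixed point on the
  ray, and beyond \<open>r\<close> there is none.\<close>

lemma cheb_funpow_tendsto:
  assumes "x \<ge> r"
  shows "(\<lambda>n. (cheb s m ^^ n) x) \<longlonglongrightarrow> r"
proof -
  define X where "X n = (cheb s m ^^ n) x" for n
  have ge: "X n \<ge> r" for n
    by (induction n) (use assms cheb_ge in \<open>auto simp: X_def\<close>)
  have "decseq X"
    by (rule decseq_SucI) (use ge cheb_le in \<open>simp add: X_def\<close>)
  then obtain l where l: "X \<longlonglongrightarrow> l"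
    by (rule decseq_convergent[of X r]) (use ge in auto)
  have lr: "l \<ge> r" by (rule LIMSEQ_le_const[OF l]) (use ge in auto)
  have "isCont (cheb s m) l"
    by (rule DERIV_isCont[OF DERIV_cheb]) (use quartic_signs(1)[OF lr] in simp)
  from isCont_tendsto_compose[OF this l]
  have "(\<lambda>n. X (Suc n)) \<longlonglongrightarrow> cheb s m l" by (simp add: X_def)
  then have "cheb s m l = l"
    using LIMSEQ_Suc[OF l] LIMSEQ_unique by blast
  then have "l = r" using cheb_less[of l] lr by force
  then show ?thesis using l by (simp add: X_def [abs_def])
qed

end

section \<open>Rotations near infinity\<close>

text \<open>With \<open>h\<close> the remainder, \<open>cheb s m w = y\<close> says that
  \<open>w\<close> is a fixed point of \<open>w \<mapsto> 32 / 21 * (y - h w)\<close>. Since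
  \<open>h\<close> is small, this map preserves the unit ball around \<open>32 / 21 * y\<close>, and
  Brouwer's theorem applies.\<close>

lemma cheb_surj_near_infinity:
  fixes s m :: complex
  obtains R where "\<And>y. cmod y \<ge> R \<Longrightarrow> \<exists>z. cheb s m z = y \<and> cmod z \<ge> cmod y"
proof -
  obtain K E' where K: "K > 0"
    and E: "\<And>z. cmod z \<ge> cmod s + 1 \<Longrightarrow> cmod (cheb s m z - 21 / 32 * z) \<le> K / cmod z"
    and E': "\<And>z. cmod z \<ge> cmod s + 1 \<Longrightarrow>
       ((\<lambda>z. cheb s m z - 21 / 32 * z) has_field_derivative E' z) (at z)"
    by (rule cheb_remainder[of s m]) blast
  show thesis
  \<comment> \<open>\<open>cmod y \<ge> 2\<close> ensures
    \<open>32 / 21 * cmod y - 1 \<ge> cmod y\<close>, and \<open>2 * K\<close> makes the remainder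
    at most 1/2 on the ball, below 21/32.\<close>
  proof (rule that[of "max (cmod s + 2) (2 * K)"])
    fix y :: complex assume "max (cmod s + 2) (2 * K) \<le> cmod y"
    then have y: "cmod y \<ge> cmod s + 1" "cmod y \<ge> 2" "cmod y \<ge> 2 * K" "cmod y > 0"
      using norm_ge_zero[of s] by linarith+
    define B where "B = cball (32 / 21 * y) 1"
    have big: "cmod w \<ge> cmod y" if "w \<in> B" for w
    proof -
      have "cmod (32 / 21 * y) \<le> cmod w + cmod (32 / 21 * y - w)"
        by (metis add.commute norm_triangle_sub)
      moreover have "cmod (32 / 21 * y - w) \<le> 1"
        using that by (simp add: B_def dist_norm)
      moreover have "cmod (32 / 21 * y) = 32 / 21 * cmod y" by (simp add: norm_mult)
      ultimately show ?thesis using y by linarith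
    qed
    define h where "h w = cheb s m w - 21 / 32 * w" for w
    define g where "g w = 32 / 21 * (y - h w)" for w
    have "continuous_on B h"
      unfolding h_def [abs_def]
      using E' big y(1)
      by (intro continuous_at_imp_continuous_on ballI) (metis DERIV_isCont order_trans)
    then have "continuous_on B g"
      unfolding g_def by (intro continuous_intros)
    moreover have "g \<in> B \<rightarrow> B"
    proof
      fix w assume w: "w \<in> B"
      have "cmod (h w) \<le> K / cmod w"
        unfolding h_def using E big[OF w] y(1) by (meson order_trans)
      also have "\<dots> \<le> K / (2 * K)"
        using big[OF w] y K by (intro divide_left_mono mult_pos_pos) linarith+
      also have "\<dots> \<le> 21 / 32" using K by simp
      finally have "cmod (32 / 21 * h w) \<le> 1"
        unfolding norm_mult by simp
      moreover have "32 / 21 * y - g w = 32 / 21 * h w"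
        unfolding g_def right_diff_distrib by simp
      ultimately show "g w \<in> B" by (simp only: B_def mem_cball dist_norm)
    qed
    ultimately obtain w where w: "w \<in> B" "g w = w"
      using brouwer_ball[of 1 "32 / 21 * y" g] unfolding B_def by auto
    have cancel: "21 / 32 * (32 / 21 * X) = X" for X :: complex by simp
    have "21 / 32 * w = y - h w"
      using cancel[of "y - h w"] w(2) by (simp only: g_def)
    then have "y = h w + 21 / 32 * w" by (metis add.commute diff_add_cancel)
    then have "cheb s m w = y" by (simp add: h_def)
    with big w(1) show "\<exists>z. cheb s m z = y \<and> cmod z \<ge> cmod y" by blast
  qed
qed

section \<open>Sectors around the real axis\<close>

text \<open>The remainder is real on the real axis. Comparing its values at \<open>z\<close> and
  \<open>Re z\<close> by the mean value inequality yields an error proportional to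
  \<open>Im z\<close>, which the slope estimate needs.\<close>

lemma Im_cheb_bound:
  fixes s m :: real
  defines "f \<equiv> cheb (complex_of_real s) (complex_of_real m)"
  obtains K where "K > 0"
    "\<And>z. Re z \<ge> \<bar>s\<bar> + 1 \<Longrightarrow> \<bar>Re (f z) - 21 / 32 * Re z\<bar> \<le> K / Re z"
    "\<And>z. Re z \<ge> \<bar>s\<bar> + 1 \<Longrightarrow> \<bar>Im (f z) - 21 / 32 * Im z\<bar> \<le> K / (Re z)\<^sup>2 * \<bar>Im z\<bar>"
proof -
  define E where "E z = f z - 21 / 32 * z" for z
  obtain K E' where K: "K > 0"
    and E: "\<And>z. cmod z \<ge> \<bar>s\<bar> + 1 \<Longrightarrow> cmod (E z) \<le> K / cmod z"
    and E': "\<And>z. cmod z \<ge> \<bar>s\<bar> + 1 \<Longrightarrow> (E has_field_derivative E' z) (at z)"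
    and E'_le: "\<And>z. cmod z \<ge> \<bar>s\<bar> + 1 \<Longrightarrow> cmod (E' z) \<le> K / (cmod z)\<^sup>2"
    unfolding E_def [abs_def] f_def
    by (rule cheb_remainder[of "complex_of_real s" "complex_of_real m"]) auto
  show thesis
  proof (rule that[OF K])
    fix z assume z: "Re z \<ge> \<bar>s\<bar> + 1"
    then have pos: "Re z > 0" by linarith
    have le: "Re z \<le> cmod z" by (rule complex_Re_le_cmod)
    have "\<bar>Re (f z) - 21 / 32 * Re z\<bar> = \<bar>Re (E z)\<bar>" by (simp add: E_def)
    also have "\<dots> \<le> cmod (E z)" by (rule abs_Re_le_cmod)
    also have "\<dots> \<le> K / cmod z" using E z le by simp
    also have "\<dots> \<le> K / Re z" using K pos le by (simp add: frac_le)
    finally show "\<bar>Re (f z) - 21 / 32 * Re z\<bar> \<le> K / Re z" .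
    \<comment> \<open>A convex set containing \<open>z\<close> and its projection to the real axis,
      on which the modulus is at least \<open>Re z\<close>.\<close>
    define H where "H = {w. Re w \<ge> Re z}"
    have H: "cmod w \<ge> Re z" if "w \<in> H" for w
      using that complex_Re_le_cmod[of w] by (simp add: H_def)
    have "cmod (E z - E (of_real (Re z))) \<le> K / (Re z)\<^sup>2 * cmod (z - of_real (Re z))"
    proof (rule field_differentiable_bound[where S = H and f = E and f' = E'])
      show "convex H" unfolding H_def by (rule convex_halfspace_Re_ge)
      show "(E has_field_derivative E' w) (at w within H)" if "w \<in> H" for w
        by (rule has_field_derivative_at_within, rule E') (use H[OF that] z in linarith)
      show "cmod (E' w) \<le> K / (Re z)\<^sup>2" if "w \<in> H" for w
      proof -
        have "cmod (E' w) \<le> K / (cmod w)\<^sup>2" by (rule E'_le) (use H[OF that] z in linarith)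
        also have "\<dots> \<le> K / (Re z)\<^sup>2"
          using H[OF that] pos K by (intro frac_le power_mono) auto
        finally show ?thesis .
      qed
    qed (auto simp: H_def)
    moreover have "Im (E (of_real (Re z))) = 0"
      by (simp add: E_def f_def cheb_of_real)
    then have "\<bar>Im (f z) - 21 / 32 * Im z\<bar> = \<bar>Im (E z - E (of_real (Re z)))\<bar>"
      by (simp add: E_def)
    then have "\<bar>Im (f z) - 21 / 32 * Im z\<bar> \<le> cmod (E z - E (of_real (Re z)))"
      by (simp only: abs_Im_le_cmod)
    moreover have "z - of_real (Re z) = \<i> * of_real (Im z)"
      by (simp add: complex_eq_iff)
    then have "cmod (z - of_real (Re z)) = \<bar>Im z\<bar>"
      by (simp add: norm_mult)
    ultimately show "\<bar>Im (f z) - 21 / 32 * Im z\<bar> \<le> K / (Re z)\<^sup>2 * \<bar>Im z\<bar>"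
      by simp
  qed
qed

text \<open>The region \<open>\<bar>Im z\<bar> \<le> \<kappa> * (Re z + 1)\<close> is forward invariant near infinity, because the slope
  of a point changes only by a factor \<open>1 + O(1 / (Re z)\<^sup>2)\<close> in each step.\<close>

lemma sector_subset:
  fixes s m R :: real and F :: "complex set"
  defines "f \<equiv> cheb (complex_of_real s) (complex_of_real m)"
  assumes F: "open F" "\<And>x. x > R \<Longrightarrow> complex_of_real x \<in> F"
    and inv: "\<And>z. cmod z \<ge> R \<Longrightarrow> f z \<in> F \<Longrightarrow> z \<in> F"
  obtains \<kappa> R' where "\<kappa> > 0" "\<And>z. Re z \<ge> R' \<Longrightarrow> \<bar>Im z\<bar> \<le> \<kappa> * Re z \<Longrightarrow> z \<in> F"
proof -
  obtain K where K: "K > 0"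
    and re: "\<And>z. Re z \<ge> \<bar>s\<bar> + 1 \<Longrightarrow> \<bar>Re (f z) - 21 / 32 * Re z\<bar> \<le> K / Re z"
    and im: "\<And>z. Re z \<ge> \<bar>s\<bar> + 1 \<Longrightarrow> \<bar>Im (f z) - 21 / 32 * Im z\<bar> \<le> K / (Re z)\<^sup>2 * \<bar>Im z\<bar>"
    using Im_cheb_bound[of s m] unfolding f_def by blast
  \<comment> \<open>Beyond \<open>R0\<close> the error \<open>K / x\<close> is at most 1/10.\<close>
  define R0 where "R0 = \<bar>R\<bar> + \<bar>s\<bar> + 10 * K + 2"
  have R0: "R0 > R" "R0 \<ge> \<bar>s\<bar> + 1" "R0 \<ge> 10 * K" "R0 \<ge> 2"
    using K by (auto simp: R0_def)
  have "compact (complex_of_real ` {R0..2 * R0})"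
    by (intro compact_continuous_image continuous_intros) auto
  moreover have "complex_of_real ` {R0..2 * R0} \<subseteq> F"
    using F(2) R0 by auto
  ultimately obtain \<delta> where \<delta>: "\<delta> > 0" "(\<Union>x\<in>complex_of_real ` {R0..2 * R0}. ball x \<delta>) \<subseteq> F"
    using F(1) compact_subset_open_imp_ball_epsilon_subset by blast
  have near: "z \<in> F" if "R0 \<le> Re z" "Re z \<le> 2 * R0" "\<bar>Im z\<bar> < \<delta>" for z
  proof -
    have "dist (complex_of_real (Re z)) z = \<bar>Im z\<bar>"
      by (simp add: dist_norm cmod_def)
    then have "z \<in> ball (complex_of_real (Re z)) \<delta>" using that by simp
    then show ?thesis using \<delta>(2) that by fastforce
  qed
  \<comment> \<open>Chosen so that \<open>\<kappa> * (Re z + 1) < \<delta>\<close> for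
    \<open>Re z \<le> 2 * R0\<close>: there the region lies in the tube around the compact
    segment.\<close>
  define \<kappa> where "\<kappa> = \<delta> / (2 * R0 + 2)"
  have \<kappa>: "\<kappa> > 0" using \<delta> R0 by (simp add: \<kappa>_def)
  \<comment> \<open>Induction on the number of steps that bring the real part down to at most
    \<open>2 * R0\<close>. A step from beyond \<open>2 * R0\<close> multiplies the real part by
    about 21/32, hence by at most 3/4, and leaves it above \<open>R0\<close>.\<close>
  have *: "z \<in> F" if "R0 \<le> Re z" "Re z \<le> (4 / 3)^n * (2 * R0)" "\<bar>Im z\<bar> \<le> \<kappa> * (Re z + 1)" for n z
    using that
  proof (induction n arbitrary: z)
    case 0
    have "\<kappa> * (Re z + 1) \<le> \<kappa> * (2 * R0 + 1)" using 0 \<kappa> by (intro mult_left_mono) auto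
    also have "\<dots> < \<kappa> * (2 * R0 + 2)" using \<kappa> by simp
    also have "\<dots> = \<delta>" using R0 by (simp add: \<kappa>_def)
    finally show ?case using 0 by (intro near) auto
  next
    case (Suc n)
    show ?case
    proof (cases "Re z \<le> 2 * R0")
      case True
      have "\<kappa> * (Re z + 1) \<le> \<kappa> * (2 * R0 + 1)" using True \<kappa> by (intro mult_left_mono) auto
      also have "\<dots> < \<kappa> * (2 * R0 + 2)" using \<kappa> by simp
      also have "\<dots> = \<delta>" using R0 by (simp add: \<kappa>_def)
      finally show ?thesis using Suc.prems True by (intro near) auto
    next
      case False
      define x where "x = Re z"
      have x: "x > 2 * R0" "x > 0" "x \<ge> 1" using False R0 by (auto simp: x_def)
      have k1: "K / x \<le> 1 / 10" using x R0 by (simp add: field_simps)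
      have "x \<le> x^2" using x by (simp add: self_le_power)
      then have k2: "K / x^2 \<le> K / x" using x K by (intro divide_left_mono) auto
      have re': "\<bar>Re (f z) - 21 / 32 * x\<bar> \<le> 1 / 10"
        using re[of z] x R0 k1 unfolding x_def by linarith
      have "\<bar>Im (f z)\<bar> \<le> 21 / 32 * \<bar>Im z\<bar> + K / x^2 * \<bar>Im z\<bar>"
        using im[of z] x R0 unfolding x_def[symmetric] by linarith
      also have "\<dots> = (21 / 32 + K / x^2) * \<bar>Im z\<bar>" by (simp add: algebra_simps)
      also have "\<dots> \<le> (21 / 32 + K / x^2) * (\<kappa> * (x + 1))"
        using Suc.prems K x by (intro mult_left_mono) (auto simp: x_def)
      also have "\<dots> = \<kappa> * ((21 / 32 + K / x^2) * (x + 1))" by simp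
      also have "(21 / 32 + K / x^2) * (x + 1) = 21 / 32 * x + 21 / 32 + K / x + K / x^2"
      proof -
        have "K / x^2 * x = K / x" using x by (simp add: power2_eq_square)
        moreover have "(21 / 32 + k) * (x + 1) = 21 / 32 * x + 21 / 32 + k * x + k" for k
          by (simp add: distrib_left distrib_right)
        ultimately show ?thesis by simp
      qed
      \<comment> \<open>The summand 1 in \<open>\<kappa> * (Re z + 1)\<close> contracts to 21/32 and
        so pays for the errors: 21/32 + 1/10 + 1/10 is less than 1 - 1/10.\<close>
      also have "\<kappa> * (21 / 32 * x + 21 / 32 + K / x + K / x^2) \<le> \<kappa> * (Re (f z) + 1)"
        using \<kappa> k1 k2 re' by (intro mult_left_mono) linarith+
      finally have "\<bar>Im (f z)\<bar> \<le> \<kappa> * (Re (f z) + 1)" .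
      moreover have "Re (f z) \<ge> R0" using re' x R0 by linarith
      moreover have "Re (f z) \<le> 3 / 4 * x" using re' x R0 by linarith
      then have "Re (f z) \<le> (4 / 3)^n * (2 * R0)" using Suc.prems(2) by (simp add: x_def)
      ultimately have "f z \<in> F" by (intro Suc.IH)
      moreover have "cmod z \<ge> R" using complex_Re_le_cmod[of z] x R0 by (simp add: x_def)
      ultimately show ?thesis by (metis inv)
    qed
  qed
  show thesis
  proof (rule that[OF \<kappa>])
    fix z assume z: "Re z \<ge> R0" "\<bar>Im z\<bar> \<le> \<kappa> * Re z"
    obtain n where "Re z / (2 * R0) < (4 / 3)^n"
      using real_arch_pow[of "4 / 3"] by auto
    then have "Re z \<le> (4 / 3)^n * (2 * R0)" using R0 by (simp add: field_simps)
    moreover have "\<kappa> * Re z \<le> \<kappa> * (Re z + 1)" using \<kappa> by simp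
    ultimately show "z \<in> F" using * z by (meson order_trans)
  qed
qed

section \<open>Asymptotic translations in the coordinate of squares\<close>

text \<open>Near infinity \<open>J\<close> is carried into itself by the translation by
  \<open>t\<close> in the coordinate \<open>z^2\<close>, up to an arbitrarily small error. The
  condition is one-sided: \<open>t\<close> and \<open>- t\<close> are separate statements.\<close>

definition shift_of_squares :: "complex set \<Rightarrow> complex \<Rightarrow> bool" where
  "shift_of_squares J t \<longleftrightarrow>
     (\<forall>\<epsilon>>0. \<exists>R. \<forall>y\<in>J. cmod y \<ge> R \<longrightarrow> (\<exists>y'\<in>J. cmod (y'^2 - y^2 - t) < \<epsilon>))"

lemma shift_of_squaresE:
  assumes "shift_of_squares J t" "\<epsilon> > 0"
  obtains R where "R > 0" "\<And>y. y \<in> J \<Longrightarrow> cmod y \<ge> R \<Longrightarrow> \<exists>y'\<in>J. cmod (y'^2 - y^2 - t) < \<epsilon>"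
proof -
  from assms obtain R where "\<And>y. y \<in> J \<Longrightarrow> cmod y \<ge> R \<Longrightarrow> \<exists>y'\<in>J. cmod (y'^2 - y^2 - t) < \<epsilon>"
    unfolding shift_of_squares_def by blast
  then show thesis by (intro that[of "max R 1"]) auto
qed

lemma shift_of_squares_add:
  assumes "shift_of_squares J t" "shift_of_squares J t'"
  shows "shift_of_squares J (t + t')"
  unfolding shift_of_squares_def
proof (intro allI impI)
  fix \<epsilon> :: real assume \<epsilon>: "\<epsilon> > 0"
  obtain R1 where R1: "R1 > 0" "\<And>y. y \<in> J \<Longrightarrow> cmod y \<ge> R1 \<Longrightarrow> \<exists>y'\<in>J. cmod (y'^2 - y^2 - t) < \<epsilon> / 2"
    using shift_of_squaresE[OF assms(1), of "\<epsilon> / 2"] \<epsilon> by auto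
  obtain R2 where R2: "R2 > 0" "\<And>y. y \<in> J \<Longrightarrow> cmod y \<ge> R2 \<Longrightarrow> \<exists>y'\<in>J. cmod (y'^2 - y^2 - t') < \<epsilon> / 2"
    using shift_of_squaresE[OF assms(2), of "\<epsilon> / 2"] \<epsilon> by auto
  \<comment> \<open>Large enough that the intermediate point \<open>y1\<close> still has modulus at
    least \<open>R2\<close>, so that the second shift applies.\<close>
  define R where "R = R1 + R2 + cmod t + \<epsilon> + 1"
  show "\<exists>R. \<forall>y\<in>J. R \<le> cmod y \<longrightarrow> (\<exists>y'\<in>J. cmod (y'\<^sup>2 - y\<^sup>2 - (t + t')) < \<epsilon>)"
  proof (intro exI[of _ R] ballI impI)
    fix y assume y: "y \<in> J" "R \<le> cmod y"
    then obtain y1 where y1: "y1 \<in> J" "cmod (y1^2 - y^2 - t) < \<epsilon> / 2"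
      using R1 R2 \<epsilon> by (auto simp: R_def) (smt (verit) norm_ge_zero)
    have "R2\<^sup>2 + cmod t + \<epsilon> \<le> R\<^sup>2"
    proof -
      have "(R2 + (cmod t + \<epsilon> + 1))\<^sup>2 = R2^2 + 2 * R2 * (cmod t + \<epsilon> + 1) + (cmod t + \<epsilon> + 1)\<^sup>2"
        by (simp add: power2_eq_square algebra_simps)
      moreover have "cmod t + \<epsilon> + 1 \<le> (cmod t + \<epsilon> + 1)\<^sup>2"
        using \<epsilon> by (intro self_le_power) auto
      moreover have "0 \<le> 2 * R2 * (cmod t + \<epsilon> + 1)" using R2 \<epsilon> by simp
      moreover have "(R2 + (cmod t + \<epsilon> + 1))\<^sup>2 \<le> R^2"
        using R1 R2 \<epsilon> by (intro power_mono) (auto simp: R_def)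
      ultimately show ?thesis by linarith
    qed
    also have "R^2 \<le> (cmod y)^2" using y R1 R2 \<epsilon> by (intro power_mono) (auto simp: R_def)
    also have "\<dots> = cmod (y^2)" by (simp add: norm_power)
    also have "\<dots> = cmod (y1^2 - (y1^2 - y^2 - t) - t)" by (simp add: algebra_simps)
    also have "\<dots> \<le> cmod (y1^2) + cmod (y1^2 - y^2 - t) + cmod t"
      by (meson add_mono norm_triangle_ineq4 order_refl order_trans)
    finally have "R2^2 \<le> (cmod y1)^2" using y1(2) \<epsilon> by (simp add: norm_power)
    then have "R2 \<le> cmod y1" by (rule power2_le_imp_le) simp
    then obtain y2 where y2: "y2 \<in> J" "cmod (y2^2 - y1^2 - t') < \<epsilon> / 2"
      using R2(2) y1(1) by blast
    have "y2^2 - y^2 - (t + t') = (y2^2 - y1^2 - t') + (y1^2 - y^2 - t)" by simp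
    then have "cmod (y2^2 - y^2 - (t + t')) \<le> cmod (y2^2 - y1^2 - t') + cmod (y1^2 - y^2 - t)"
      by (metis norm_triangle_ineq)
    then have "cmod (y2^2 - y^2 - (t + t')) < \<epsilon>" using y1(2) y2(2) by linarith
    then show "\<exists>y'\<in>J. cmod (y'\<^sup>2 - y\<^sup>2 - (t + t')) < \<epsilon>" using y2(1) by blast
  qed
qed

text \<open>Shift at \<open>\<alpha> * y\<close> and rotate back; squares are thereby divided by
  \<open>\<alpha>^2\<close>.\<close>

lemma shift_of_squares_rotate:
  assumes "shift_of_squares J t" "cmod \<alpha> = 1" "\<And>z. \<alpha> * z \<in> J \<longleftrightarrow> z \<in> J"
  shows "shift_of_squares J (t / \<alpha>^2)"
  unfolding shift_of_squares_def
proof (intro allI impI)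
  fix \<epsilon> :: real assume "\<epsilon> > 0"
  then obtain R where R: "\<And>y. y \<in> J \<Longrightarrow> cmod y \<ge> R \<Longrightarrow> \<exists>y'\<in>J. cmod (y'^2 - y^2 - t) < \<epsilon>"
    using shift_of_squaresE[OF assms(1)] by metis
  have \<alpha>: "\<alpha> \<noteq> 0" using assms(2) by auto
  show "\<exists>R. \<forall>y\<in>J. R \<le> cmod y \<longrightarrow> (\<exists>y'\<in>J. cmod (y'\<^sup>2 - y\<^sup>2 - t / \<alpha>^2) < \<epsilon>)"
  proof (intro exI[of _ R] ballI impI)
    fix y assume y: "y \<in> J" "R \<le> cmod y"
    then obtain y' where y': "y' \<in> J" "cmod (y'^2 - (\<alpha> * y)^2 - t) < \<epsilon>"
      using R[of "\<alpha> * y"] assms by (auto simp: norm_mult)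
    have "(y' / \<alpha>)^2 - y^2 - t / \<alpha>^2 = (y'^2 - (\<alpha> * y)^2 - t) / \<alpha>^2"
      using \<alpha> by (simp add: field_simps)
    then have "cmod ((y' / \<alpha>)^2 - y^2 - t / \<alpha>^2) < \<epsilon>"
      using y'(2) assms(2) by (simp add: norm_divide norm_power)
    moreover have "y' / \<alpha> \<in> J" using assms(3)[of "y' / \<alpha>"] y'(1) \<alpha> by simp
    ultimately show "\<exists>y'\<in>J. cmod (y'\<^sup>2 - y\<^sup>2 - t / \<alpha>^2) < \<epsilon>" by blast
  qed
qed

text \<open>Conjugating by the rotation changes the coefficient of \<open>1 / z\<close> in the expansion of
  \<open>cheb s m\<close> at infinity; passing from \<open>cheb s m z\<close> to \<open>cheb s m (\<alpha> * z) / \<alpha>\<close> therefore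
  shifts squares by an asymptotically constant amount.\<close>

lemma shift_of_squares_rotation:
  fixes s m \<alpha> :: complex and J :: "complex set"
  defines "f \<equiv> cheb s m"
  assumes \<alpha>: "cmod \<alpha> = 1" "\<And>z. \<alpha> * z \<in> J \<longleftrightarrow> z \<in> J"
    and inv: "\<And>z. cmod z \<ge> R \<Longrightarrow> f z \<in> J \<longleftrightarrow> z \<in> J"
  shows "shift_of_squares J (63 / 256 * s * (1 / \<alpha>^2 - 1))"
  unfolding shift_of_squares_def
proof (intro allI impI)
  fix \<epsilon> :: real assume \<epsilon>: "\<epsilon> > 0"
  have \<alpha>0: "\<alpha> \<noteq> 0" using \<alpha> by auto
  define E where "E z = f z - 21 / 32 * z" for z
  have E: "((\<lambda>z. z * E z) \<longlongrightarrow> 3 * s / 16) at_infinity"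
    unfolding E_def f_def by (rule cheb_expansion)
  have mult: "filterlim (\<lambda>z. \<alpha> * z) at_infinity at_infinity"
    by (rule tendsto_mult_filterlim_at_infinity[OF tendsto_const \<alpha>0 filterlim_ident])
  have E\<alpha>: "((\<lambda>z. z * (E (\<alpha> * z) / \<alpha>)) \<longlongrightarrow> 3 * s / 16 / \<alpha>^2) at_infinity"
  proof -
    have "((\<lambda>z. \<alpha> * z * E (\<alpha> * z) / \<alpha>^2) \<longlongrightarrow> 3 * s / 16 / \<alpha>^2) at_infinity"
      using \<alpha>0 by (intro tendsto_divide tendsto_const filterlim_compose[OF E mult]) auto
    then show ?thesis
      using \<alpha>0 by (simp add: power2_eq_square)
  qed
  have zero: "(g \<longlongrightarrow> 0) at_infinity" if "((\<lambda>z. z * g z) \<longlongrightarrow> l) at_infinity" for g :: "complex \<Rightarrow> complex" and l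
  proof -
    have "((\<lambda>z. z * g z * inverse z) \<longlongrightarrow> l * 0) at_infinity"
      by (intro tendsto_mult that tendsto_inverse_0)
    moreover have "\<forall>\<^sub>F z in at_infinity. z * g z * inverse z = g z"
      using eventually_not_equal_at_infinity[of 0] by eventually_elim simp
    ultimately show ?thesis by (simp add: filterlim_cong)
  qed
  \<comment> \<open>The difference of the squares of \<open>f (\<alpha> * z) / \<alpha>\<close> and
    \<open>f z\<close>, expanded with \<open>f z = 21 / 32 * z + E z\<close>. Only the cross terms
    survive in the limit, and 21/16 * 3/16 = 63/256.\<close>
  define D where "D z = 21 / 16 * (z * (E (\<alpha> * z) / \<alpha>) - z * E z) + ((E (\<alpha> * z) / \<alpha>)^2 - (E z)^2)" for z
  have "(D \<longlongrightarrow> 21 / 16 * (3 * s / 16 / \<alpha>^2 - 3 * s / 16) + (0^2 - 0^2)) at_infinity"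
    unfolding D_def by (intro tendsto_intros E E\<alpha> zero[OF E] zero[OF E\<alpha>])
  moreover have "21 / 16 * (3 * s / 16 / \<alpha>^2 - 3 * s / 16) + (0^2 - 0^2) = 63 / 256 * s * (1 / \<alpha>^2 - 1)"
    by (simp add: algebra_simps)
  ultimately have "(D \<longlongrightarrow> 63 / 256 * s * (1 / \<alpha>^2 - 1)) at_infinity" by (simp only:)
  then have "\<forall>\<^sub>F z in at_infinity. dist (D z) (63 / 256 * s * (1 / \<alpha>^2 - 1)) < \<epsilon>"
    using \<epsilon> by (rule tendstoD)
  then obtain R1 where R1: "\<And>z. cmod z \<ge> R1 \<Longrightarrow> cmod (D z - 63 / 256 * s * (1 / \<alpha>^2 - 1)) < \<epsilon>"
    unfolding eventually_at_infinity dist_norm by blast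
  obtain R2 where R2: "\<And>y. cmod y \<ge> R2 \<Longrightarrow> \<exists>z. f z = y \<and> cmod z \<ge> cmod y"
    unfolding f_def using cheb_surj_near_infinity by blast
  show "\<exists>R. \<forall>y\<in>J. R \<le> cmod y \<longrightarrow> (\<exists>y'\<in>J. cmod (y'\<^sup>2 - y\<^sup>2 - 63 / 256 * s * (1 / \<alpha>^2 - 1)) < \<epsilon>)"
  proof (intro exI[of _ "max R (max R1 R2)"] ballI impI)
    fix y assume y: "y \<in> J" "max R (max R1 R2) \<le> cmod y"
    \<comment> \<open>A preimage at least as far out as \<open>y\<close> lies in the range of the
      invariance and of the limit; \<open>f (\<alpha> * z) / \<alpha>\<close> is then the required
      point of \<open>J\<close>.\<close>
    then obtain z where z: "f z = y" "cmod z \<ge> cmod y" using R2 by auto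
    then have big: "cmod z \<ge> R" "cmod z \<ge> R1" using y by auto
    have "z \<in> J" using inv[of z] z big y by simp
    then have "f (\<alpha> * z) \<in> J" using inv[of "\<alpha> * z"] \<alpha> big by (simp add: norm_mult)
    then have "f (\<alpha> * z) / \<alpha> \<in> J" using \<alpha>(2)[of "f (\<alpha> * z) / \<alpha>"] \<alpha>0 by simp
    moreover have "(f (\<alpha> * z) / \<alpha>)^2 - y^2 = D z"
    proof -
      have "f (\<alpha> * z) / \<alpha> = 21 / 32 * z + E (\<alpha> * z) / \<alpha>"
        using \<alpha>0 by (simp add: E_def field_simps)
      moreover have "y = 21 / 32 * z + E z" by (simp add: E_def z(1))
      moreover have "(c * z + A)^2 - (c * z + B)^2 = 2 * c * (z * A - z * B) + (A^2 - B^2)"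
        for A B c :: complex
        by (simp add: power2_eq_square algebra_simps)
      from this[of "21 / 32"]
      have "(21 / 32 * z + A)^2 - (21 / 32 * z + B)^2 = 21 / 16 * (z * A - z * B) + (A^2 - B^2)"
        for A B :: complex
        by simp
      ultimately show ?thesis unfolding D_def by simp
    qed
    ultimately show "\<exists>y'\<in>J. cmod (y'\<^sup>2 - y\<^sup>2 - 63 / 256 * s * (1 / \<alpha>^2 - 1)) < \<epsilon>"
      using R1[OF big(2)] by metis
  qed
qed

text \<open>The rotations by \<open>\<alpha>\<close> and \<open>1 / \<alpha>\<close> give two
  conjugate shifts up to the real factor \<open>c\<close>, and rotating these gives their negatives.
  Adding conjugate pairs yields real shifts \<open>r\<close> and \<open>- r\<close>, nonzero because
  \<open>\<alpha>^2 \<noteq> 1\<close>; one of them is positive.\<close>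

lemma shift_of_squares_real:
  fixes s :: real and m \<alpha> :: complex and J :: "complex set"
  assumes \<alpha>: "cmod \<alpha> = 1" "\<alpha>^2 \<noteq> 1" "\<And>z. \<alpha> * z \<in> J \<longleftrightarrow> z \<in> J" and s: "s \<noteq> 0"
    and inv: "\<And>z. cmod z \<ge> R \<Longrightarrow> cheb (of_real s) m z \<in> J \<longleftrightarrow> z \<in> J"
  obtains d :: real where "d > 0" "shift_of_squares J (of_real d)"
proof -
  have \<alpha>0: "\<alpha> \<noteq> 0" using \<alpha> by auto
  define c where "c = 63 / 256 * complex_of_real s"
  have inv\<alpha>: "1 / \<alpha> = cnj \<alpha>"
    using \<alpha>(1) complex_norm_square[of \<alpha>] \<alpha>0 by (simp add: field_simps)
  have \<alpha>': "cmod (1 / \<alpha>) = 1" "\<And>z. 1 / \<alpha> * z \<in> J \<longleftrightarrow> z \<in> J"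
    subgoal using \<alpha> by (simp add: norm_divide)
    subgoal for z using \<alpha>(3)[of "z / \<alpha>"] \<alpha>0 by simp
    done
  have 1: "shift_of_squares J (c * (1 / \<alpha>^2 - 1))"
    unfolding c_def using \<alpha>(1,3) inv by (rule shift_of_squares_rotation)
  have 2: "shift_of_squares J (c * (\<alpha>^2 - 1))"
    using shift_of_squares_rotation[OF \<alpha>' inv] by (simp add: c_def power_divide)
  have 3: "shift_of_squares J (c * (1 - \<alpha>^2))"
  proof -
    have "c * (1 / \<alpha>^2 - 1) / (1 / \<alpha>)^2 = c * (1 - \<alpha>^2)"
      using \<alpha>0 by (simp add: field_simps)
    then show ?thesis using shift_of_squares_rotate[OF 1 \<alpha>'] by simp
  qed
  have 4: "shift_of_squares J (c * (1 - 1 / \<alpha>^2))"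
  proof -
    have "c * (\<alpha>^2 - 1) / \<alpha>^2 = c * (1 - 1 / \<alpha>^2)"
      using \<alpha>0 by (simp add: field_simps)
    then show ?thesis using shift_of_squares_rotate[OF 2 \<alpha>(1,3)] by simp
  qed
  define r where "r = 63 / 128 * s * (1 - Re (\<alpha>^2))"
  have conj: "1 / \<alpha>^2 = cnj (\<alpha>^2)" using inv\<alpha> by (metis complex_cnj_power power_one_over)
  have sum: "\<alpha>^2 + 1 / \<alpha>^2 = of_real (2 * Re (\<alpha>^2))"
    unfolding conj by (rule complex_add_cnj)
  have pos: "shift_of_squares J (of_real r)"
  proof -
    have "c * (1 - \<alpha>^2) + c * (1 - 1 / \<alpha>^2) = c * (2 - (\<alpha>^2 + 1 / \<alpha>^2))"
      by (simp add: algebra_simps)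
    also have "\<dots> = of_real r" unfolding sum by (simp add: c_def r_def field_simps)
    finally show ?thesis using shift_of_squares_add[OF 3 4] by simp
  qed
  have neg: "shift_of_squares J (of_real (- r))"
  proof -
    have "c * (\<alpha>^2 - 1) + c * (1 / \<alpha>^2 - 1) = c * ((\<alpha>^2 + 1 / \<alpha>^2) - 2)"
      by (simp add: algebra_simps)
    also have "\<dots> = of_real (- r)" unfolding sum by (simp add: c_def r_def field_simps)
    finally show ?thesis using shift_of_squares_add[OF 2 1] by simp
  qed
  have "Re (\<alpha>^2) \<noteq> 1"
  proof
    assume re: "Re (\<alpha>^2) = 1"
    have "(Re (\<alpha>^2))\<^sup>2 + (Im (\<alpha>^2))\<^sup>2 = 1"
      using \<alpha>(1) by (metis cmod_power2 norm_power power_one)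
    then have "Im (\<alpha>^2) = 0" using re by simp
    with re \<alpha>(2) show False by (simp add: complex_eq_iff)
  qed
  then have "r \<noteq> 0" using s by (simp add: r_def)
  then consider "r > 0" | "- r > 0" by linarith
  then show thesis using that pos neg by cases blast+
qed

text \<open>Starting from \<open>w\<close> in \<open>J\<close>, \<open>k\<close> shifts lead to a
  point of \<open>J\<close> whose square is near \<open>w^2 + d * k\<close>. For large
  \<open>k\<close> this point or its negative lies in the sector that misses
  \<open>J\<close>.\<close>

lemma escape_into_sector:
  fixes J :: "complex set"
  assumes d: "d > 0" "shift_of_squares J (complex_of_real d)"
    and \<kappa>: "\<kappa> > 0" "\<And>z. Re z \<ge> R1 \<Longrightarrow> \<bar>Im z\<bar> \<le> \<kappa> * Re z \<Longrightarrow> z \<notin> J"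
    and uminus: "\<And>z. - z \<in> J \<longleftrightarrow> z \<in> J"
  obtains R where "\<And>w. cmod w \<ge> R \<Longrightarrow> Re (w^2) \<ge> 0 \<Longrightarrow> w \<notin> J"
proof -
  \<comment> \<open>The first bound keeps the accumulated error below half the drift. The second
    gives \<open>\<epsilon> < \<kappa> * (d - \<epsilon>)\<close>, so the imaginary error grows more
    slowly than \<open>\<kappa>\<close> times the real part.\<close>
  define \<epsilon> where "\<epsilon> = min (d / 2) (d * \<kappa> / (2 * (1 + \<kappa>)))"
  have \<epsilon>: "\<epsilon> > 0" "\<epsilon> \<le> d / 2" "\<epsilon> \<le> d * \<kappa> / (2 * (1 + \<kappa>))"
    unfolding \<epsilon>_def using d(1) \<kappa>(1) by (intro min.cobounded1 min.cobounded2 | simp add: field_simps)+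
  have "\<epsilon> * (1 + \<kappa>) \<le> d * \<kappa> / 2" using \<epsilon>(3) \<kappa> by (simp add: field_simps)
  moreover have "d * \<kappa> / 2 < d * \<kappa>" using d(1) \<kappa>(1) by simp
  ultimately have \<epsilon>\<kappa>: "\<kappa> * (d - \<epsilon>) - \<epsilon> > 0" by (simp add: algebra_simps)
  obtain R where R: "R > 0" "\<And>y. y \<in> J \<Longrightarrow> cmod y \<ge> R \<Longrightarrow> \<exists>y'\<in>J. cmod (y'^2 - y^2 - of_real d) < \<epsilon>"
    using shift_of_squaresE[OF d(2) \<epsilon>(1)] by metis
  show thesis
  proof (rule that[of "2 * R"], rule notI)
    fix w assume w: "cmod w \<ge> 2 * R" "Re (w^2) \<ge> 0" and "w \<in> J"
    have w4: "4 * R^2 \<le> cmod (w^2)"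
      using power_mono[OF w(1), of 2] R by (simp add: norm_power power_mult_distrib)
    have ex: "\<exists>y\<in>J. cmod (y^2 - w^2 - of_real (d * real k)) \<le> \<epsilon> * real k" for k
    proof (induction k)
      case 0
      then show ?case using \<open>w \<in> J\<close> by (intro bexI[of _ w]) auto
    next
      case (Suc k)
      then obtain y where y: "y \<in> J" "cmod (y^2 - w^2 - of_real (d * real k)) \<le> \<epsilon> * real k" by blast
      define v where "v = w^2 + of_real (d * real k)"
      have dk: "d * real k \<ge> 0" using d by simp
      have Re_v: "Re v = Re (w^2) + d * real k" and Im_v: "Im v = Im (w^2)"
        unfolding v_def by simp_all
      have "cmod v \<ge> cmod (w^2)"
        unfolding cmod_def Re_v Im_v using w(2) dk
        by (intro real_sqrt_le_mono add_right_mono power_mono) auto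
      moreover have "cmod v \<ge> d * real k"
        using complex_Re_le_cmod[of v] w(2) Re_v by linarith
      moreover have "cmod v \<le> cmod (y^2) + cmod (y^2 - v)"
        using norm_triangle_sub[of v "y^2"] by (simp only: norm_minus_commute)
      moreover have "cmod (y^2 - v) \<le> \<epsilon> * real k"
        using y(2) by (simp add: v_def algebra_simps)
      moreover have "\<epsilon> * real k \<le> d / 2 * real k" using \<epsilon> by (intro mult_right_mono) auto
      \<comment> \<open>\<open>cmod v\<close> is at least \<open>d * real k\<close> and at least
        \<open>4 * R^2\<close>. An error of at most half of it leaves \<open>2 * R^2\<close>, so the
        next shift is available.\<close>
      ultimately have "cmod (y^2) \<ge> 2 * R^2"
        using w4 by linarith
      then have "R^2 \<le> (cmod y)^2" unfolding norm_power using zero_le_power2[of R] by linarith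
      then have "R \<le> cmod y" by (rule power2_le_imp_le) simp
      then obtain y' where y': "y' \<in> J" "cmod (y'^2 - y^2 - of_real d) < \<epsilon>" using R y by blast
      have "y'^2 - w^2 - of_real (d * real (Suc k)) =
          (y'^2 - y^2 - of_real d) + (y^2 - w^2 - of_real (d * real k))"
        by (simp add: algebra_simps)
      then have "cmod (y'^2 - w^2 - of_real (d * real (Suc k))) \<le>
          cmod (y'^2 - y^2 - of_real d) + cmod (y^2 - w^2 - of_real (d * real k))"
        by (metis norm_triangle_ineq)
      then have "cmod (y'^2 - w^2 - of_real (d * real (Suc k))) \<le> \<epsilon> + \<epsilon> * real k"
        using y y' by linarith
      then show ?case using y'(1) by (intro bexI[of _ y']) (auto simp: algebra_simps)
    qed
    \<comment> \<open>The first summand outgrows the initial imaginary part, the second brings the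
      real part beyond \<open>R1\<close>.\<close>
    obtain k where k: "real k > \<bar>Im (w^2)\<bar> / (\<kappa> * (d - \<epsilon>) - \<epsilon>) + (R1^2 + 1) / (d - \<epsilon>)"
      using reals_Archimedean2 by blast
    have de: "d - \<epsilon> > 0" using \<epsilon> d by linarith
    have n1: "\<bar>Im (w^2)\<bar> / (\<kappa> * (d - \<epsilon>) - \<epsilon>) \<ge> 0" "(R1^2 + 1) / (d - \<epsilon>) \<ge> 0"
      using \<epsilon>\<kappa> de by auto
    have k1: "\<bar>Im (w^2)\<bar> \<le> (\<kappa> * (d - \<epsilon>) - \<epsilon>) * real k"
      using k n1 \<epsilon>\<kappa> by (subst mult.commute, subst pos_divide_le_eq[symmetric]) linarith+
    have k2: "R1^2 + 1 \<le> (d - \<epsilon>) * real k"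
      using k n1 de by (subst mult.commute, subst pos_divide_le_eq[symmetric]) linarith+
    obtain y0 where y0: "y0 \<in> J" "cmod (y0^2 - w^2 - of_real (d * real k)) \<le> \<epsilon> * real k"
      using ex by blast
    define y where "y = (if Re y0 \<ge> 0 then y0 else - y0)"
    have y: "y \<in> J" "cmod (y^2 - w^2 - of_real (d * real k)) \<le> \<epsilon> * real k" "Re y \<ge> 0"
      using y0 uminus by (auto simp: y_def)
    have "\<bar>Re (y^2) - Re (w^2) - d * real k\<bar> \<le> \<epsilon> * real k"
      using abs_Re_le_cmod[of "y^2 - w^2 - of_real (d * real k)"] y(2) by simp
    then have re: "Re (y^2) \<ge> (d - \<epsilon>) * real k" using w(2) by (simp add: left_diff_distrib)
    have "\<bar>Im (y^2) - Im (w^2)\<bar> \<le> \<epsilon> * real k"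
      using abs_Im_le_cmod[of "y^2 - w^2 - of_real (d * real k)"] y(2) by simp
    then have "\<bar>Im (y^2)\<bar> \<le> \<kappa> * ((d - \<epsilon>) * real k)" using k1 by (simp add: left_diff_distrib mult.assoc)
    also have "\<dots> \<le> \<kappa> * Re (y^2)" using re \<kappa> by (intro mult_left_mono) auto
    finally have im: "\<bar>Im (y^2)\<bar> \<le> \<kappa> * Re (y^2)" .
    \<comment> \<open>This carries the sector condition over from \<open>y^2\<close> to
      \<open>y\<close>.\<close>
    have Re2: "Re (y^2) \<le> (Re y)^2" by (simp add: power2_eq_square)
    have "R1^2 + 1 \<le> (Re y)^2" using re k2 Re2 by linarith
    then have "R1^2 < (Re y)^2" "0 < (Re y)^2" using zero_le_power2[of R1] by linarith+
    then have R1: "R1 < Re y" "0 < Re y"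
      using y(3) by (auto intro: power2_less_imp_less)
    have "2 * Re y * \<bar>Im y\<bar> = \<bar>Im (y^2)\<bar>"
      using R1 by (simp add: power2_eq_square abs_mult)
    also have "\<dots> \<le> \<kappa> * (Re y)^2" using im Re2 \<kappa> by (meson mult_left_mono order_less_imp_le order_trans)
    finally have "Re y * (2 * \<bar>Im y\<bar>) \<le> Re y * (\<kappa> * Re y)" by (simp add: power2_eq_square algebra_simps)
    then have "2 * \<bar>Im y\<bar> \<le> \<kappa> * Re y" using R1 by simp
    then have "\<bar>Im y\<bar> \<le> \<kappa> * Re y" by linarith
    then show False using \<kappa>(2)[of y] R1 y(1) by simp
  qed
qed

section \<open>From a rotational symmetry to a full neighbourhood of infinity\<close>

lemma cheb_rotation_half:
  fixes s m R :: real and \<alpha> :: complex and F :: "complex set"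
  assumes s: "s \<noteq> 0" and F: "open F" "\<And>x. x > R \<Longrightarrow> complex_of_real x \<in> F" "\<And>z. - z \<in> F \<longleftrightarrow> z \<in> F"
    and inv: "\<And>z. cmod z \<ge> R \<Longrightarrow> cheb (of_real s) (of_real m) z \<in> F \<longleftrightarrow> z \<in> F"
    and \<alpha>: "cmod \<alpha> = 1" "\<alpha>^2 \<noteq> 1" "\<And>z. \<alpha> * z \<in> F \<longleftrightarrow> z \<in> F"
  obtains R' where "\<And>w. cmod w \<ge> R' \<Longrightarrow> Re (w^2) \<ge> 0 \<Longrightarrow> w \<in> F"
proof -
  obtain \<kappa> R1 where \<kappa>: "\<kappa> > 0" "\<And>z. Re z \<ge> R1 \<Longrightarrow> \<bar>Im z\<bar> \<le> \<kappa> * Re z \<Longrightarrow> z \<in> F"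
    using sector_subset[of F R s m] F inv by metis
  have "\<alpha> * z \<in> - F \<longleftrightarrow> z \<in> - F" for z using \<alpha>(3) by simp
  moreover have "cheb (of_real s) (of_real m) z \<in> - F \<longleftrightarrow> z \<in> - F" if "cmod z \<ge> R" for z
    using inv[OF that] by simp
  ultimately obtain d where d: "d > 0" "shift_of_squares (- F) (complex_of_real d)"
    using shift_of_squares_real[OF \<alpha>(1,2) _ s] by metis
  have "z \<notin> - F" if "Re z \<ge> R1" "\<bar>Im z\<bar> \<le> \<kappa> * Re z" for z using \<kappa>(2)[OF that] by simp
  moreover have "- z \<in> - F \<longleftrightarrow> z \<in> - F" for z using F(3) by simp
  ultimately obtain R' where "\<And>w. cmod w \<ge> R' \<Longrightarrow> Re (w^2) \<ge> 0 \<Longrightarrow> w \<notin> - F"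
    using escape_into_sector[OF d \<kappa>(1)] by metis
  then show thesis by (intro that) auto
qed

text \<open>The half \<open>Re (w^2) \<ge> 0\<close> is covered from the real axis. The other half
  becomes this one after a quarter turn, with \<open>- s\<close> for \<open>s\<close>.\<close>

lemma cheb_rotation_all:
  fixes s m R :: real and \<alpha> :: complex and F :: "complex set"
  assumes s: "s \<noteq> 0" and F: "open F" "\<And>z. - z \<in> F \<longleftrightarrow> z \<in> F"
      "\<And>x. x > R \<Longrightarrow> complex_of_real x \<in> F" "\<And>x. x > R \<Longrightarrow> \<i> * complex_of_real x \<in> F"
    and inv: "\<And>z. cmod z \<ge> R \<Longrightarrow> cheb (of_real s) (of_real m) z \<in> F \<longleftrightarrow> z \<in> F"
    and \<alpha>: "cmod \<alpha> = 1" "\<alpha>^2 \<noteq> 1" "\<And>z. \<alpha> * z \<in> F \<longleftrightarrow> z \<in> F"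
  obtains R' where "\<And>w. cmod w \<ge> R' \<Longrightarrow> w \<in> F"
proof -
  obtain R1 where R1: "\<And>w. cmod w \<ge> R1 \<Longrightarrow> Re (w^2) \<ge> 0 \<Longrightarrow> w \<in> F"
    using cheb_rotation_half[OF s F(1,3,2) inv \<alpha>] by blast
  define G where "G = (\<lambda>z. \<i> * z) -` F"
  have "open G" unfolding G_def by (intro open_vimage F continuous_intros)
  moreover have "cheb (of_real (- s)) (of_real m) z \<in> G \<longleftrightarrow> z \<in> G" if "cmod z \<ge> R" for z
    using inv[of "\<i> * z"] that by (simp add: G_def cheb_ii norm_mult)
  moreover have "- z \<in> G \<longleftrightarrow> z \<in> G" for z using F(2)[of "\<i> * z"] by (simp add: G_def)
  moreover have "\<alpha> * z \<in> G \<longleftrightarrow> z \<in> G" for z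
    using \<alpha>(3)[of "\<i> * z"] by (simp add: G_def mult.left_commute)
  moreover have "- s \<noteq> 0" using s by simp
  moreover have "complex_of_real x \<in> G" if "x > R" for x using F(4)[OF that] by (simp add: G_def)
  ultimately obtain R2 where R2: "\<And>w. cmod w \<ge> R2 \<Longrightarrow> Re (w^2) \<ge> 0 \<Longrightarrow> w \<in> G"
    using cheb_rotation_half[of "- s" G R m \<alpha>] \<alpha>(1,2) by metis
  show thesis
  proof (rule that[of "max R1 R2"])
    fix w assume w: "max R1 R2 \<le> cmod w"
    show "w \<in> F"
    proof (cases "Re (w^2) \<ge> 0")
      case True
      then show ?thesis using R1 w by simp
    next
      case False
      have "(- \<i> * w)^2 = - (w^2)" by (simp add: power_mult_distrib)
      then have "- \<i> * w \<in> G" using R2[of "- \<i> * w"] w False by (simp add: norm_mult)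
      then show ?thesis by (simp add: G_def)
    qed
  qed
qed

section \<open>Maps of the sphere and symmetry groups\<close>

lemma dist_Pt_le: "dist (Pt z) (Pt w) \<le> 2 * dist z w"
proof -
  have "1 \<le> sqrt (1 + (cmod z)\<^sup>2) * sqrt (1 + (cmod w)\<^sup>2)"
    using mult_mono[of 1 "sqrt (1 + (cmod z)\<^sup>2)" 1 "sqrt (1 + (cmod w)\<^sup>2)"] by simp
  then have "2 * cmod (z - w) / (sqrt (1 + (cmod z)\<^sup>2) * sqrt (1 + (cmod w)\<^sup>2)) \<le> 2 * cmod (z - w) / 1"
    by (intro divide_left_mono) auto
  then show ?thesis by (simp add: dist_Pt_Pt dist_norm)
qed

lemma continuous_on_Pt: "continuous_on S Pt"
proof -
  have "2-lipschitz_on S Pt"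
    by (rule lipschitz_onI) (use dist_Pt_le in auto)
  then show ?thesis by (rule lipschitz_on_continuous_on)
qed

lemma tendsto_Pt:
  assumes "(f \<longlongrightarrow> z) F"
  shows "((\<lambda>x. Pt (f x)) \<longlongrightarrow> Pt z) F"
  using continuous_on_Pt[of UNIV] assms
  by (metis UNIV_I continuous_on_eq_continuous_at isCont_tendsto_compose open_UNIV)

text \<open>Stereographic projection makes \<open>coord\<close> continuous at finite points. At
  \<open>Infty\<close> the division by zero is harmless, since the other factor is 0, in agreement
  with the dummy value.\<close>

lemma coord_eq_stereo: "coord x = complex_of_real (1 / (1 - snd (stereo x))) * fst (stereo x)"
proof (cases x)
  case (Pt z)
  have "1 + (cmod z)\<^sup>2 > 0" by (simp add: add_pos_nonneg)
  then have eq: "1 - ((cmod z)\<^sup>2 - 1) / ((cmod z)\<^sup>2 + 1) = 2 / (1 + (cmod z)\<^sup>2)"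
      and ne: "2 / (1 + (cmod z)\<^sup>2) \<noteq> 0"
    by (simp_all add: field_simps)
  have cancel: "complex_of_real (1 / t) * (complex_of_real t * z) = z" if "t \<noteq> 0" for t
    using that by simp
  show ?thesis
    unfolding Pt stereo.simps fst_conv snd_conv rsphere.sel eq cancel[OF ne] ..
qed simp

lemma tendsto_coord:
  assumes "(X \<longlongrightarrow> Pt z) F"
  shows "((\<lambda>x. coord (X x)) \<longlongrightarrow> z) F"
proof -
  have st: "((\<lambda>x. stereo (X x)) \<longlongrightarrow> stereo (Pt z)) F"
    using assms unfolding tendsto_iff dist_rsphere_def .
  have "1 + (cmod z)\<^sup>2 > 0" by (simp add: add_pos_nonneg)
  then have ne: "1 - snd (stereo (Pt z)) \<noteq> 0" by (simp add: field_simps)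
  have "((\<lambda>x. complex_of_real (1 / (1 - snd (stereo (X x)))) * fst (stereo (X x))) \<longlongrightarrow>
      complex_of_real (1 / (1 - snd (stereo (Pt z)))) * fst (stereo (Pt z))) F"
    by (intro tendsto_intros st ne)
  then show ?thesis
    unfolding coord_eq_stereo[symmetric] by simp
qed

lemma open_image_Pt:
  assumes "open V"
  shows "open (Pt ` V)"
proof (subst open_subopen, safe)
  fix z assume "z \<in> V"
  have "((\<lambda>x. coord x) \<longlongrightarrow> z) (nhds (Pt z))"
    by (rule tendsto_coord) (simp add: filterlim_def)
  then have "\<forall>\<^sub>F x in nhds (Pt z). coord x \<in> V"
    using assms \<open>z \<in> V\<close> by (rule topological_tendstoD)
  moreover have "\<forall>\<^sub>F x in nhds (Pt z). x \<noteq> Infty"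
    by (rule t1_space_nhds) simp
  ultimately have "\<forall>\<^sub>F x in nhds (Pt z). x \<in> Pt ` V"
  proof eventually_elim
    case (elim x)
    then show ?case by (cases x) auto
  qed
  then show "\<exists>T. open T \<and> Pt z \<in> T \<and> T \<subseteq> Pt ` V"
    unfolding eventually_nhds by blast
qed

lemma open_vimage_Pt: "open U \<Longrightarrow> open (Pt -` U)"
  using continuous_on_Pt[of UNIV] by (rule open_vimage[rotated])

lemma open_Fatou: "open (Fatou R)"
proof (subst open_subopen, safe)
  fix z assume "z \<in> Fatou R"
  then obtain U where U: "open U" "z \<in> U" "normal_on (range (\<lambda>n. R ^^ n)) U"
    unfolding Fatou_def by blast
  then show "\<exists>T. open T \<and> z \<in> T \<and> T \<subseteq> Fatou R"
    unfolding Fatou_def by (intro exI[of _ U]) auto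
qed

section \<open>Chebyshev's method as a rational map\<close>

text \<open>Allows evaluation without computing the reduced fraction \<open>P / Q\<close>. In
  \<open>P * D = N * Q\<close> neither side's fraction has a common zero of numerator and
  denominator, so \<open>Q\<close> and \<open>D\<close> vanish at the same points.\<close>

lemma rat_map_to_fract_divide:
  assumes "D \<noteq> 0" and no_common_zero: "\<And>z. poly D z = 0 \<Longrightarrow> poly N z \<noteq> 0"
  shows "rat_map (to_fract N / to_fract D) (Pt z) = (if poly D z = 0 then Infty else Pt (poly N z / poly D z))"
    and "degree D < degree N \<Longrightarrow> rat_map (to_fract N / to_fract D) Infty = Infty"
proof -
  define f where "f = to_fract N / to_fract D"
  obtain P Q where PQ: "quot_of_fract f = (P, Q)" by (cases "quot_of_fract f") auto
  have Q0: "Q \<noteq> 0" using snd_quot_of_fract_nonzero[of f] by (simp add: PQ)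
  have cop: "coprime P Q" using coprime_quot_of_fract[of f] by (simp add: PQ)
  have "to_fract P / to_fract Q = to_fract N / to_fract D"
    using Fract_quot_of_fract[of f] unfolding PQ by (simp add: Fract_conv_to_fract f_def)
  then have "to_fract (P * D) = to_fract (N * Q)"
    using assms(1) Q0 by (simp add: field_simps)
  then have eq: "P * D = N * Q" by (simp only: to_fract_eq_iff)
  have eqz: "poly P z * poly D z = poly N z * poly Q z" for z
    using eq by (metis poly_mult)
  have "poly P z \<noteq> 0" if "poly Q z = 0" for z
  proof
    assume "poly P z = 0"
    then have "[:- z, 1:] dvd P" "[:- z, 1:] dvd Q" using that by (simp_all add: poly_eq_0_iff_dvd)
    with cop have "is_unit [:- z, 1:]" by (rule coprime_common_divisor)
    then show False by (simp add: is_unit_poly_iff)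
  qed
  then have zero: "poly Q z = 0 \<longleftrightarrow> poly D z = 0" for z
    using eqz[of z] no_common_zero[of z] by auto
  show "rat_map (to_fract N / to_fract D) (Pt z) =
      (if poly D z = 0 then Infty else Pt (poly N z / poly D z))"
    using eqz[of z] zero[of z] by (auto simp: f_def[symmetric] PQ field_simps)
  assume deg: "degree D < degree N"
  then have "N \<noteq> 0" by auto
  then have "P \<noteq> 0" using eq Q0 by auto
  then have "degree P + degree D = degree N + degree Q"
    using eq \<open>N \<noteq> 0\<close> Q0 assms(1) by (metis degree_mult_eq)
  then show "rat_map (to_fract N / to_fract D) Infty = Infty"
    using deg by (simp add: f_def[symmetric] PQ)
qed

lemma poly_map_Pt: "poly_map p (Pt z) = Pt (poly p z)"
  by (simp add: poly_map_def)

lemma p_neg_eq: "p_neg b = [:- of_real b, 0, - of_real (1 - b), 0, 1:]"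
  by (simp add: p_neg_def)

lemma chebyshev_step_common_denominator:
  fixes x p p1 p2 :: "'a :: field"
  assumes "(2 :: 'a) \<noteq> 0" "p1 \<noteq> 0"
  shows "x - (1 + 1 / 2 * (p * p2 / p1^2)) * (p / p1) =
    (x * (2 * p1^3) - 2 * p * p1^2 - p^2 * p2) / (2 * p1^3)"
  using assms by (simp add: field_simps power2_eq_square power3_eq_cube)

lemma chebyshev_map_p_neg:
  assumes b: "0 < b" "b < 1"
  shows "chebyshev_map (p_neg b) (Pt z) =
      (if 4 * z^3 - 2 * of_real (1 - b) * z = 0 then Infty else Pt (cheb (of_real (1 - b)) (of_real b) z))"
    and "chebyshev_map (p_neg b) Infty = Infty"
proof -
  define a where "a = complex_of_real (1 - b)"
  define \<beta> where "\<beta> = complex_of_real b"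
  define P where "P = p_neg b"
  have P: "P = [:- \<beta>, 0, - a, 0, 1:]" by (simp add: P_def p_neg_eq a_def \<beta>_def)
  have dP: "pderiv P = [:0, - 2 * a, 0, 4:]" by (simp add: P pderiv_pCons)
  have ddP: "pderiv (pderiv P) = [:- 2 * a, 0, 12:]" by (simp add: dP pderiv_pCons)
  define D where "D = 2 * pderiv P ^ 3"
  define X where "X = [:0, 1 :: complex:]"
  define N where "N = X * D - 2 * P * pderiv P ^ 2 - P ^ 2 * pderiv (pderiv P)"
  have nz: "pderiv P \<noteq> 0" by (simp add: dP)
  have D0: "D \<noteq> 0" using nz by (simp add: D_def)
  have evalP: "poly P z = z^4 - a * z^2 - \<beta>" for z
    unfolding P by (simp add: power2_eq_square power4_eq_xxxx algebra_simps)
  have evalP1: "poly (pderiv P) z = 4 * z^3 - 2 * a * z" for z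
    unfolding dP by (simp add: power3_eq_cube algebra_simps)
  have evalP2: "poly (pderiv (pderiv P)) z = 12 * z^2 - 2 * a" for z
    unfolding ddP by (simp add: power2_eq_square algebra_simps)
  have evalD: "poly D z = 2 * (4 * z^3 - 2 * a * z)^3" for z
    by (simp add: D_def evalP1)
  have evalN: "poly N z = z * (2 * (4 * z^3 - 2 * a * z)^3) - 2 * (z^4 - a * z^2 - \<beta>) * (4 * z^3 - 2 * a * z)^2
      - (z^4 - a * z^2 - \<beta>)^2 * (12 * z^2 - 2 * a)" for z
    by (simp add: N_def X_def evalD evalP evalP1 evalP2)
  have two: "(2 :: complex poly fract) = to_fract 2"
    by (metis one_add_one to_fract_1 to_fract_add)
  have two0: "(2 :: complex poly fract) \<noteq> 0" unfolding two by (simp only: to_fract_eq_0_iff) simp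
  have fr: "chebyshev_fract P = to_fract N / to_fract D"
    unfolding chebyshev_fract_def chebyshev_L_def X_def[symmetric]
    using nz by (subst chebyshev_step_common_denominator[OF two0])
      (simp_all add: N_def D_def two power2_eq_square power3_eq_cube)
  \<comment> \<open>At a zero of \<open>pderiv P\<close> only the last term of \<open>N\<close>
    survives. The critical points, where \<open>z = 0\<close> or \<open>z^2 = a / 2\<close>, are
    zeros neither of \<open>P\<close> nor of its second derivative.\<close>
  have no_common_zero: "poly N z \<noteq> 0" if "poly D z = 0" for z
  proof
    assume N0: "poly N z = 0"
    have z: "4 * z^3 - 2 * a * z = 0" using that by (simp add: evalD)
    then have *: "(z^4 - a * z^2 - \<beta>)^2 * (12 * z^2 - 2 * a) = 0"
      using N0 unfolding evalN z by simp
    have a0: "a \<noteq> 0" using b by (simp add: a_def)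
    have "2 * z * (2 * z^2 - a) = 0" using z by (simp add: power2_eq_square power3_eq_cube algebra_simps)
    then consider "z = 0" | "z^2 = a / 2" by (auto simp: field_simps)
    then show False
    proof cases
      case 1
      then show False using * a0 b by (simp add: \<beta>_def)
    next
      case 2
      have "z^4 = (z^2)^2" by (simp only: power_mult[symmetric]) simp
      then have "z^4 - a * z^2 - \<beta> = (a / 2)^2 - a * (a / 2) - \<beta>" by (simp only: 2)
      also have "\<dots> = - of_real ((1 - b)^2 / 4 + b)"
        by (simp add: a_def \<beta>_def power2_eq_square field_simps)
      finally have eq: "z^4 - a * z^2 - \<beta> = - of_real ((1 - b)^2 / 4 + b)" .
      have "(1 - b)^2 / 4 + b > 0" using b by (intro add_nonneg_pos) auto
      then have "z^4 - a * z^2 - \<beta> \<noteq> 0"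
        unfolding eq neg_equal_0_iff_equal of_real_eq_0_iff by linarith
      moreover have "12 * z^2 - 2 * a \<noteq> 0" using a0 by (simp add: 2)
      ultimately show False using * by simp
    qed
  qed
  define P1 P2 where "P1 = pderiv P" and "P2 = pderiv (pderiv P)"
  have deg: "degree P = 4" "degree P1 = 3" "degree P2 = 2"
    and lead: "coeff P 4 = 1" "coeff P1 3 = 4" "coeff P2 2 = 12"
    unfolding P1_def P2_def ddP unfolding dP unfolding P by (simp_all add: eval_nat_numeral)
  have nz': "P \<noteq> 0" "P1 \<noteq> 0" "P2 \<noteq> 0" using deg by auto
  have deg2: "degree (P1^3) = 9" "degree (P * P1^2) = 10" "degree (P^2 * P2) = 10"
    using nz' by (simp_all add: degree_mult_eq degree_power_eq deg)
  have "lead_coeff (P1^3) = 64" "lead_coeff (P * P1^2) = 16" "lead_coeff (P^2 * P2) = 12"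
    by (simp_all add: lead_coeff_mult lead_coeff_power deg lead)
  then have c: "coeff (P1^3) 9 = 64" "coeff (P * P1^2) 10 = 16" "coeff (P^2 * P2) 10 = 12"
    unfolding deg2 by simp_all
  have "N = pCons 0 (smult 2 (P1^3)) - smult 2 (P * P1^2) - P^2 * P2"
    by (simp add: N_def D_def X_def P1_def P2_def numeral_poly)
  moreover have "coeff (pCons 0 (smult 2 (P1^3))) 10 = 128"
    using c(1) by (simp add: coeff_pCons)
  \<comment> \<open>The coefficient is 128 - 2 * 16 - 12.\<close>
  ultimately have "coeff N 10 = 84" using c by simp
  then have "10 \<le> degree N" by (intro le_degree) simp
  moreover have "degree D = 9" using deg2(1) by (simp add: D_def P1_def numeral_poly)
  ultimately have deg_less: "degree D < degree N" by linarith
  show "chebyshev_map (p_neg b) Infty = Infty"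
    unfolding chebyshev_map_def P_def[symmetric] fr
    by (rule rat_map_to_fract_divide(2)[OF D0 _ deg_less]) (rule no_common_zero)
  have "poly N z / poly D z = cheb a \<beta> z" if "4 * z^3 - 2 * a * z \<noteq> 0"
  proof -
    have "1 / 2 * (p * p2 / p1^2) = p * p2 / (2 * p1^2)" for p p1 p2 :: complex
      by simp
    then show ?thesis
      unfolding evalN evalD cheb_def
      using chebyshev_step_common_denominator[OF _ that] by simp
  qed
  moreover have "rat_map (to_fract N / to_fract D) (Pt z) =
      (if poly D z = 0 then Infty else Pt (poly N z / poly D z))"
    by (rule rat_map_to_fract_divide(1)[OF D0], rule no_common_zero)
  ultimately show "chebyshev_map (p_neg b) (Pt z) =
      (if 4 * z^3 - 2 * of_real (1 - b) * z = 0 then Infty else Pt (cheb (of_real (1 - b)) (of_real b) z))"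
    unfolding chebyshev_map_def P_def[symmetric] fr a_def[symmetric] \<beta>_def[symmetric]
    by (simp add: evalD del: of_real_diff)
qed

section \<open>Symmetry groups through Fatou sets\<close>

text \<open>The extended isometry is a bijection of the sphere fixing \<open>Infty\<close>, so the
  condition concerns finite points, and complements turn \<open>Julia\<close> into
  \<open>Fatou\<close>.\<close>

lemma symmetry_group_iff:
  "\<sigma> \<in> symmetry_group R \<longleftrightarrow>
     holomorphic_isometry \<sigma> \<and> (\<forall>z. Pt (\<sigma> z) \<in> Fatou R \<longleftrightarrow> Pt z \<in> Fatou R)"
proof (cases "holomorphic_isometry \<sigma>")
  case True
  then obtain \<alpha> \<beta> where \<alpha>: "cmod \<alpha> = 1" and \<sigma>: "\<sigma> = (\<lambda>z. \<alpha> * z + \<beta>)"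
    unfolding holomorphic_isometry_def by blast
  have \<alpha>0: "\<alpha> \<noteq> 0" using \<alpha> by auto
  have inj: "\<sigma> z = \<sigma> w \<Longrightarrow> z = w" for z w using \<alpha>0 by (simp add: \<sigma>)
  have surj: "\<exists>w. \<sigma> w = z" for z
    by (rule exI[of _ "(z - \<beta>) / \<alpha>"]) (use \<alpha>0 in \<open>simp add: \<sigma>\<close>)
  have "sphere_ext \<sigma> ` Julia R = Julia R \<longleftrightarrow> (\<forall>z. Pt (\<sigma> z) \<in> Julia R \<longleftrightarrow> Pt z \<in> Julia R)"
  proof
    assume im: "sphere_ext \<sigma> ` Julia R = Julia R"
    show "\<forall>z. Pt (\<sigma> z) \<in> Julia R \<longleftrightarrow> Pt z \<in> Julia R"
    proof (intro allI iffI)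
      fix z assume "Pt (\<sigma> z) \<in> Julia R"
      then have "Pt (\<sigma> z) \<in> sphere_ext \<sigma> ` Julia R" by (simp only: im)
      then obtain y where y: "y \<in> Julia R" "sphere_ext \<sigma> y = Pt (\<sigma> z)"
        by (metis imageE)
      show "Pt z \<in> Julia R"
      proof (cases y)
        case (Pt w)
        then have "\<sigma> w = \<sigma> z" using y(2) by simp
        then have "w = z" by (rule inj)
        then show ?thesis using y(1) Pt by simp
      qed (use y(2) in simp)
    next
      fix z assume "Pt z \<in> Julia R"
      then have "sphere_ext \<sigma> (Pt z) \<in> sphere_ext \<sigma> ` Julia R" by (rule imageI)
      then show "Pt (\<sigma> z) \<in> Julia R" by (simp only: im sphere_ext.simps)
    qed
  next
    assume iff: "\<forall>z. Pt (\<sigma> z) \<in> Julia R \<longleftrightarrow> Pt z \<in> Julia R"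
    show "sphere_ext \<sigma> ` Julia R = Julia R"
    proof (intro equalityI subsetI)
      fix y assume "y \<in> sphere_ext \<sigma> ` Julia R"
      then obtain x where "x \<in> Julia R" "y = sphere_ext \<sigma> x" by blast
      then show "y \<in> Julia R" using iff by (cases x) auto
    next
      fix y assume y: "y \<in> Julia R"
      show "y \<in> sphere_ext \<sigma> ` Julia R"
      proof (cases y)
        case (Pt z)
        obtain w where "\<sigma> w = z" using surj by blast
        then show ?thesis using y iff Pt by (intro image_eqI[of _ _ "Pt w"]) auto
      next
        case Infty
        then show ?thesis using y by (intro image_eqI[of _ _ Infty]) auto
      qed
    qed
  qed
  then show ?thesis using True by (simp add: symmetry_group_def Julia_def)
next
  case False
  then show ?thesis by (simp add: symmetry_group_def)
qed

lemma symmetry_group_eq_pm_id: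
  assumes uminus: "\<And>z. Pt z \<in> Fatou R \<Longrightarrow> Pt (- z) \<in> Fatou R"
    and rigid: "\<And>\<alpha> \<beta>. cmod \<alpha> = 1 \<Longrightarrow> (\<And>z. Pt (\<alpha> * z + \<beta>) \<in> Fatou R \<longleftrightarrow> Pt z \<in> Fatou R) \<Longrightarrow>
      \<alpha>^2 = 1 \<and> \<beta> = 0"
  shows "symmetry_group R = {\<lambda>z. z, \<lambda>z. - z}"
proof (intro equalityI subsetI)
  fix \<sigma> assume "\<sigma> \<in> symmetry_group R"
  then obtain \<alpha> \<beta> where \<alpha>: "cmod \<alpha> = 1" and \<sigma>: "\<sigma> = (\<lambda>z. \<alpha> * z + \<beta>)"
    and iff: "\<And>z. Pt (\<sigma> z) \<in> Fatou R \<longleftrightarrow> Pt z \<in> Fatou R"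
    unfolding symmetry_group_iff holomorphic_isometry_def by blast
  have "\<alpha>^2 = 1 \<and> \<beta> = 0" by (rule rigid[OF \<alpha>]) (use iff in \<open>simp add: \<sigma>\<close>)
  then show "\<sigma> \<in> {\<lambda>z. z, \<lambda>z. - z}" by (auto simp: \<sigma> power2_eq_1_iff)
next
  fix \<sigma> :: "complex \<Rightarrow> complex" assume "\<sigma> \<in> {\<lambda>z. z, \<lambda>z. - z}"
  moreover have "holomorphic_isometry (\<lambda>z. z)"
    unfolding holomorphic_isometry_def by (intro exI[of _ 1] exI[of _ 0]) simp
  moreover have "holomorphic_isometry (\<lambda>z. - z)"
    unfolding holomorphic_isometry_def by (intro exI[of _ "- 1"] exI[of _ 0]) simp
  moreover have "Pt (- z) \<in> Fatou R \<longleftrightarrow> Pt z \<in> Fatou R" for z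
    using uminus[of z] uminus[of "- z"] by (simp only: minus_minus) blast
  ultimately show "\<sigma> \<in> symmetry_group R"
    unfolding symmetry_group_iff by (elim insertE emptyE) simp_all
qed

lemma normal_onE:
  fixes f :: "nat \<Rightarrow> rsphere \<Rightarrow> rsphere"
  assumes "normal_on F U" "\<And>n. f n \<in> F"
  obtains r g where "strict_mono r"
    "\<And>K. compact K \<Longrightarrow> K \<subseteq> U \<Longrightarrow> uniform_limit K (\<lambda>n. f (r n)) g sequentially"
proof -
  have "range f \<subseteq> F" using assms(2) by blast
  then have "\<exists>r g. strict_mono r \<and>
      (\<forall>K. compact K \<and> K \<subseteq> U \<longrightarrow> uniform_limit K (\<lambda>n. f (r n)) g sequentially)"
    by (rule assms(1)[unfolded normal_on_def, THEN spec, THEN mp])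
  then show thesis by (elim exE conjE) (rule that, auto)
qed

section \<open>Negation and even maps\<close>

definition neg_sphere :: "rsphere \<Rightarrow> rsphere" where
  "neg_sphere = sphere_ext uminus"

lemma neg_sphere_simps [simp]:
  "neg_sphere (Pt z) = Pt (- z)" "neg_sphere Infty = Infty" "neg_sphere (neg_sphere x) = x"
proof -
  show 1: "neg_sphere (Pt z) = Pt (- z)" "neg_sphere Infty = Infty" for z
    by (simp_all add: neg_sphere_def)
  show "neg_sphere (neg_sphere x) = x" by (cases x) (simp_all add: 1)
qed

lemma dist_neg_sphere [simp]: "dist (neg_sphere x) (neg_sphere y) = dist x y"
proof -
  have PP: "dist (Pt (- z)) (Pt (- w)) = dist (Pt z) (Pt w)" for z w
    using norm_minus_commute[of w z] by (simp add: dist_Pt_Pt)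
  have PI: "dist (Pt (- z)) Infty = dist (Pt z) Infty" for z
    by (simp add: dist_Pt_Infty)
  have IP: "dist Infty (Pt (- z)) = dist Infty (Pt z)" for z
    using PI[of z] by (simp only: dist_commute)
  show ?thesis by (cases x; cases y) (simp_all add: PP PI IP)
qed

lemma continuous_on_neg_sphere: "continuous_on S neg_sphere"
proof -
  have "1-lipschitz_on S neg_sphere" by (rule lipschitz_onI) auto
  then show ?thesis by (rule lipschitz_on_continuous_on)
qed

text \<open>All iterates of positive order are even, so normality on \<open>U\<close> transfers to
  the reflected set.\<close>

lemma Fatou_even:
  assumes even: "\<And>x. R (neg_sphere x) = R x" and x: "x \<in> Fatou R"
  shows "neg_sphere x \<in> Fatou R"
proof -
  obtain U where U: "open U" "x \<in> U" "normal_on (range (\<lambda>n. R ^^ n)) U"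
    using x unfolding Fatou_def by blast
  define U' where "U' = neg_sphere -` U"
  have pow: "(R ^^ n) (neg_sphere x) = (R ^^ n) x" if "n > 0" for n x
    using that by (cases n) (simp_all add: funpow_Suc_right even del: funpow.simps)
  have "normal_on (range (\<lambda>n. R ^^ n)) U'"
    unfolding normal_on_def
  proof (intro allI impI)
    fix f :: "nat \<Rightarrow> rsphere \<Rightarrow> rsphere"
    assume f: "range f \<subseteq> range (\<lambda>n. R ^^ n)"
    show "\<exists>r g. strict_mono r \<and> (\<forall>K. compact K \<and> K \<subseteq> U' \<longrightarrow> uniform_limit K (\<lambda>n. f (r n)) g sequentially)"
    \<comment> \<open>The zeroth iterate \<open>id\<close> is the one that need not be even. If it
      occurs infinitely often there is a constant subsequence; otherwise some tail consists of even
      maps.\<close>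
    proof (cases "infinite {n. f n = id}")
      case True
      define r where "r = enumerate {n. f n = id}"
      have "strict_mono r" unfolding r_def using True by (rule strict_mono_enumerate)
      moreover have "f (r n) = id" for n
        using enumerate_in_set[OF True, of n] by (simp add: r_def)
      ultimately show ?thesis
        by (intro exI[of _ r] exI[of _ id]) (simp add: uniform_limit_const)
    next
      case False
      then obtain N where N: "\<And>n. n \<ge> N \<Longrightarrow> f n \<noteq> id"
        by (metis (mono_tags, lifting) finite_nat_set_iff_bounded mem_Collect_eq not_le)
      have fneg: "f n (neg_sphere y) = f n y" if "n \<ge> N" for n y
      proof -
        obtain k where k: "f n = R ^^ k" using f by blast
        then have "k > 0" using N[OF that] by (cases k) auto
        then show ?thesis by (simp add: k pow)
      qed
      have "f (n + N) \<in> range (\<lambda>n. R ^^ n)" for n using f by blast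
      with U(3) obtain r g where r: "strict_mono r"
        and g: "\<And>K. compact K \<Longrightarrow> K \<subseteq> U \<Longrightarrow> uniform_limit K (\<lambda>n. f (r n + N)) g sequentially"
        by (rule normal_onE[where f = "\<lambda>n. f (n + N)"]) (rule that)
      show ?thesis
      proof (intro exI[of _ "\<lambda>n. r n + N"] exI[of _ "g \<circ> neg_sphere"] conjI allI impI)
        show "strict_mono (\<lambda>n. r n + N)" using r by (simp add: strict_mono_def)
        fix K assume K: "compact K \<and> K \<subseteq> U'"
        have "compact (neg_sphere ` K)" "neg_sphere ` K \<subseteq> U"
          using K by (auto simp: U'_def intro: compact_continuous_image continuous_on_neg_sphere)
        from g[OF this] show "uniform_limit K (\<lambda>n. f (r n + N)) (g \<circ> neg_sphere) sequentially"
          unfolding uniform_limit_iff by (simp add: fneg)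
      qed
    qed
  qed
  moreover have "open U'" unfolding U'_def
    using continuous_on_neg_sphere[of UNIV] U(1) by (rule open_vimage[rotated])
  moreover have "neg_sphere x \<in> U'" using U(2) by (simp add: U'_def)
  ultimately show ?thesis
    unfolding Fatou_def mem_Collect_eq by (intro exI[of _ U'] conjI)
qed

lemma poly_map_funpow: "(poly_map p ^^ n) (Pt z) = Pt ((poly p ^^ n) z)"
  by (induction n) (simp_all add: poly_map_Pt)

section \<open>The symmetry group of the polynomial\<close>

text \<open>This is the filled Julia set only for polynomials with escape radius 2.\<close>

definition filled_julia :: "complex poly \<Rightarrow> complex set" where
  "filled_julia p = {z. \<forall>n. cmod ((poly p ^^ n) z) \<le> 2}"

lemma continuous_on_funpow_poly:
  fixes p :: "complex poly"
  shows "continuous_on S (poly p ^^ n)"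
proof (induction n)
  case (Suc n)
  have "continuous_on S (\<lambda>z. poly p ((poly p ^^ n) z))"
    by (rule continuous_on_poly[OF Suc])
  then show ?case by (simp add: comp_def)
qed (simp add: continuous_on_id id_def)

section \<open>Escape to infinity and the filled Julia set\<close>

context
  fixes p :: "complex poly"
  assumes escape: "\<And>z. cmod z \<ge> 2 \<Longrightarrow> cmod (poly p z) \<ge> 2 * cmod z"
begin

lemma escape_funpow:
  assumes "cmod z \<ge> 2"
  shows "cmod ((poly p ^^ n) z) \<ge> 2^n * 2"
proof (induction n)
  case (Suc n)
  have "(1 :: real) \<le> 2^n" by (rule one_le_power) simp
  then have "cmod ((poly p ^^ n) z) \<ge> 2" using Suc by linarith
  from escape[OF this] Suc show ?case by simp
qed (use assms in simp)

lemma poly_in_filled_julia: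
  assumes "z \<in> filled_julia p"
  shows "poly p z \<in> filled_julia p"
proof -
  have "cmod ((poly p ^^ Suc n) z) \<le> 2" for n
    using assms unfolding filled_julia_def by blast
  then show ?thesis
    unfolding filled_julia_def funpow_Suc_right comp_apply by blast
qed

lemma filled_juliaI:
  assumes "poly p z \<in> filled_julia p"
  shows "z \<in> filled_julia p"
proof -
  have "cmod z \<le> 2"
  proof (rule ccontr)
    assume z: "\<not> cmod z \<le> 2"
    moreover have "cmod (poly p z) \<le> 2"
      using assms unfolding filled_julia_def by (auto dest: spec[of _ 0])
    ultimately show False using escape[of z] by linarith
  qed
  moreover have "cmod ((poly p ^^ Suc n) z) \<le> 2" for n
    using assms unfolding filled_julia_def funpow_Suc_right comp_apply by blast
  ultimately show ?thesis
    unfolding filled_julia_def mem_Collect_eq by (metis funpow_0 not0_implies_Suc)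
qed

lemma compact_filled_julia: "compact (filled_julia p)"
proof -
  have "closed {z. cmod ((poly p ^^ n) z) \<le> 2}" for n
    by (intro closed_Collect_le continuous_intros continuous_on_funpow_poly)
  then have "closed (\<Inter>n. {z. cmod ((poly p ^^ n) z) \<le> 2})" by blast
  moreover have "(\<Inter>n. {z. cmod ((poly p ^^ n) z) \<le> 2}) = filled_julia p"
    by (auto simp: filled_julia_def)
  moreover have "filled_julia p \<subseteq> cball 0 2"
    by (auto simp: filled_julia_def dest: spec[of _ 0])
  ultimately show ?thesis
    by (metis bounded_cball bounded_subset compact_eq_bounded_closed)
qed

text \<open>Once an orbit exceeds modulus 2 its modulus doubles at least at every step, so on the
  open set of points escaping by time \<open>N\<close> the iterates tend to \<open>Infty\<close>
  uniformly.\<close>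

lemma escaping_in_Fatou:
  assumes "z \<notin> filled_julia p"
  shows "Pt z \<in> Fatou (poly_map p)"
proof -
  obtain N where N: "cmod ((poly p ^^ N) z) > 2"
    using assms unfolding filled_julia_def by (auto simp: not_le)
  define V where "V = {w. cmod ((poly p ^^ N) w) > 2}"
  have "open V" unfolding V_def
    by (intro open_Collect_less continuous_intros continuous_on_funpow_poly)
  have far: "dist ((poly_map p ^^ k) x) Infty \<le> (1 / 2)^(k - N)" if "x \<in> Pt ` V" "k \<ge> N" for k x
  proof -
    obtain w where w: "x = Pt w" "cmod ((poly p ^^ N) w) > 2" using \<open>x \<in> Pt ` V\<close> by (auto simp: V_def)
    have "(poly p ^^ k) w = (poly p ^^ (k - N)) ((poly p ^^ N) w)"
      using \<open>k \<ge> N\<close> by (metis funpow_add comp_apply le_add_diff_inverse2)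
    then have big: "cmod ((poly p ^^ k) w) \<ge> 2^(k - N) * 2"
      using escape_funpow[of "(poly p ^^ N) w" "k - N"] w(2) by simp
    define c where "c = cmod ((poly p ^^ k) w)"
    have "2^(k - N) * 2 \<le> sqrt (1 + c^2)"
      by (rule order_trans[OF big]) (auto simp: c_def real_le_rsqrt)
    then have "2 / sqrt (1 + c^2) \<le> 2 / (2^(k - N) * 2)"
      by (intro divide_left_mono mult_pos_pos) (auto simp: add_pos_nonneg)
    then show ?thesis
      by (simp add: w(1) poly_map_funpow dist_Pt_Infty c_def power_one_over)
  qed
  have "normal_on (range (\<lambda>n. poly_map p ^^ n)) (Pt ` V)"
    unfolding normal_on_def
  proof (intro allI impI)
    fix f :: "nat \<Rightarrow> rsphere \<Rightarrow> rsphere"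
    assume f: "range f \<subseteq> range (\<lambda>n. poly_map p ^^ n)"
    then have "\<forall>n. \<exists>k. f n = poly_map p ^^ k" by blast
    then obtain m where m: "\<And>n. f n = poly_map p ^^ m n" by metis
    show "\<exists>r g. strict_mono r \<and> (\<forall>K. compact K \<and> K \<subseteq> Pt ` V \<longrightarrow> uniform_limit K (\<lambda>n. f (r n)) g sequentially)"
    \<comment> \<open>Either one exponent recurs infinitely often, giving a constant subsequence, or
      the exponents tend to infinity.\<close>
    proof (cases "\<exists>k. infinite {n. m n = k}")
      case True
      then obtain k where k: "infinite {n. m n = k}" by blast
      define r where "r = enumerate {n. m n = k}"
      have "strict_mono r" unfolding r_def using k by (rule strict_mono_enumerate)
      moreover have "f (r n) = poly_map p ^^ k" for n
        using enumerate_in_set[OF k, of n] by (simp add: r_def m)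
      ultimately show ?thesis
        by (intro exI[of _ r] exI[of _ "poly_map p ^^ k"]) (simp add: uniform_limit_const)
    next
      case False
      have ev: "\<forall>\<^sub>F n in sequentially. m n \<ge> M" for M
      proof -
        have "finite (\<Union>k<M. {n. m n = k})" using False by auto
        moreover have "\<forall>\<^sub>F n in sequentially. n \<notin> A" if "finite A" for A :: "nat set"
          using that by (simp add: cofinite_eq_sequentially[symmetric] eventually_cofinite)
        ultimately have "\<forall>\<^sub>F n in sequentially. n \<notin> (\<Union>k<M. {n. m n = k})" by blast
        then show ?thesis by eventually_elim (auto simp: not_le)
      qed
      have "uniform_limit (Pt ` V) f (\<lambda>_. Infty) sequentially"
        unfolding uniform_limit_iff
      proof (intro allI impI)
        fix e :: real assume "e > 0"
        then obtain k where k: "(1 / 2)^k < e" using real_arch_pow_inv[of e "1 / 2"] by auto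
        show "\<forall>\<^sub>F n in sequentially. \<forall>x\<in>Pt ` V. dist (f n x) Infty < e"
          using ev[of "N + k"]
        proof eventually_elim
          case (elim n)
          have "(1 / 2 :: real)^(m n - N) \<le> (1 / 2)^k" using elim by (intro power_decreasing) auto
          then show ?case
            using far[of _ "m n"] elim k unfolding m by (meson add_leD1 le_less_trans order_trans)
        qed
      qed
      then show ?thesis
        by (intro exI[of _ "\<lambda>n. n"] exI[of _ "\<lambda>_. Infty"])
           (auto simp: strict_mono_def intro: uniform_limit_on_subset)
    qed
  qed
  moreover have "Pt z \<in> Pt ` V" using N by (auto simp: V_def)
  ultimately show ?thesis
    unfolding Fatou_def using open_image_Pt[OF \<open>open V\<close>] by blast
qed

text \<open>Orbits in the filled Julia set stay at chordal distance at least
  \<open>2 / sqrt 5\<close> from \<open>Infty\<close>, while arbitrarily close points escape to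
  \<open>Infty\<close>. Locally uniform convergence of a subsequence would contradict this.\<close>

lemma frontier_filled_julia_not_in_Fatou:
  assumes z: "z \<in> frontier (filled_julia p)"
  shows "Pt z \<notin> Fatou (poly_map p)"
proof
  assume "Pt z \<in> Fatou (poly_map p)"
  then obtain U where U: "open U" "Pt z \<in> U" "normal_on (range (\<lambda>n. poly_map p ^^ n)) U"
    unfolding Fatou_def by blast
  have zK: "z \<in> filled_julia p"
    using z compact_imp_closed[OF compact_filled_julia] frontier_subset_closed by blast
  obtain \<delta> where \<delta>: "\<delta> > 0" "cball z \<delta> \<subseteq> Pt -` U"
    using open_vimage_Pt[OF U(1)] U(2) unfolding open_contains_cball by (metis vimage_eq)
  define L where "L = Pt ` cball z \<delta>"
  have "compact L" "L \<subseteq> U"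
    using \<delta> by (auto simp: L_def intro!: compact_continuous_image continuous_on_Pt)
  moreover from U(3) rangeI obtain r g where r: "strict_mono r"
    and g: "\<And>K. compact K \<Longrightarrow> K \<subseteq> U \<Longrightarrow> uniform_limit K (\<lambda>n. (poly_map p ^^ r n)) g sequentially"
    by (rule normal_onE[where f = "\<lambda>n. poly_map p ^^ n"]) (rule that)
  ultimately have ul: "uniform_limit L (\<lambda>n. (poly_map p ^^ r n)) g sequentially" by blast
  have low: "dist (Pt w) Infty \<ge> 2 / sqrt 5" if "cmod w \<le> 2" for w
  proof -
    have "(cmod w)^2 \<le> 2^2" using that by (intro power_mono) auto
    then show ?thesis unfolding dist_Pt_Infty
      by (intro divide_left_mono mult_pos_pos) (auto simp: add_pos_nonneg)
  qed
  define e :: real where "e = 2 / sqrt 5"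
  have e: "e > 0" by (simp add: e_def)
  then obtain M where M: "\<And>n x. n \<ge> M \<Longrightarrow> x \<in> L \<Longrightarrow> dist ((poly_map p ^^ r n) x) (g x) < e / 4"
    using uniform_limitD[OF ul, of "e / 4"] unfolding eventually_sequentially by auto
  have "continuous_on UNIV (\<lambda>w. Pt ((poly p ^^ r M) w))"
    using continuous_on_compose2[OF continuous_on_Pt[of UNIV] continuous_on_funpow_poly[of UNIV "r M" p]] by simp
  then have "isCont (\<lambda>w. Pt ((poly p ^^ r M) w)) z" by (simp add: continuous_on_eq_continuous_at)
  \<comment> \<open>The iterate \<open>r M\<close> is fixed first, uniformly close to the limit on
    \<open>L\<close>. Its continuity then dictates how near the escaping point \<open>y\<close> must
    be to \<open>z\<close>.\<close>
  then obtain \<eta> where \<eta>: "\<eta> > 0"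
    "\<And>w. dist w z < \<eta> \<Longrightarrow> dist (Pt ((poly p ^^ r M) w)) (Pt ((poly p ^^ r M) z)) < e / 4"
    unfolding continuous_at_eps_delta using e by (metis divide_pos_pos zero_less_numeral)
  obtain y where y: "y \<notin> filled_julia p" "dist z y < min \<eta> \<delta>"
    using z \<eta>(1) \<delta>(1) unfolding frontier_straddle by (metis min_less_iff_conj)
  have yL: "Pt y \<in> L" using y by (simp add: L_def)
  have "(\<lambda>n. (poly_map p ^^ r n) (Pt y)) \<longlonglongrightarrow> g (Pt y)"
    using ul yL by (rule tendsto_uniform_limitI)
  moreover have "(\<lambda>n. (poly_map p ^^ r n) (Pt y)) \<longlonglongrightarrow> Infty"
  proof -
    obtain N where N: "cmod ((poly p ^^ N) y) > 2"
      using y(1) unfolding filled_julia_def by (auto simp: not_le)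
    show ?thesis
    proof (rule LIMSEQ_subseq_LIMSEQ[OF _ r, unfolded comp_def], rule LIMSEQ_offset[of _ N])
      have "dist ((poly_map p ^^ (n + N)) (Pt y)) Infty \<le> (1 / 2)^n" for n
      proof -
        define c where "c = cmod ((poly p ^^ (n + N)) y)"
        have "2^n * 2 \<le> c" unfolding c_def funpow_add comp_apply
          using escape_funpow[of "(poly p ^^ N) y" n] N by simp
        also have "c \<le> sqrt (1 + c^2)" by (simp add: real_le_rsqrt)
        finally have "2 / sqrt (1 + c^2) \<le> 2 / (2^n * 2)"
          by (intro divide_left_mono mult_pos_pos) (auto simp: add_pos_nonneg)
        then show ?thesis
          by (simp add: poly_map_funpow dist_Pt_Infty c_def power_one_over)
      qed
      then show "(\<lambda>n. (poly_map p ^^ (n + N)) (Pt y)) \<longlonglongrightarrow> Infty"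
        unfolding tendsto_dist_iff[of _ Infty]
        by (intro tendsto_sandwich[OF _ _ tendsto_const LIMSEQ_realpow_zero[of "1 / 2"]]) auto
    qed
  qed
  ultimately have "g (Pt y) = Infty" by (rule LIMSEQ_unique)
  then have 1: "dist (Pt ((poly p ^^ r M) y)) Infty < e / 4"
    using M[OF order_refl yL] by (simp add: poly_map_funpow)
  have 2: "dist (Pt ((poly p ^^ r M) y)) (Pt ((poly p ^^ r M) z)) < e / 4"
    using \<eta>(2)[of y] y(2) by (simp add: dist_commute)
  have 3: "dist (Pt ((poly p ^^ r M) z)) Infty \<ge> e"
    using zK unfolding e_def filled_julia_def by (intro low) auto
  show False
    using 1 2 3 e dist_triangle3[of "Pt ((poly p ^^ r M) z)" Infty "Pt ((poly p ^^ r M) y)"] by linarith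
qed

end

section \<open>Extremal values on the fibres of a biquadratic polynomial\<close>

text \<open>A boundary point of a disc is extreme. Here inner products with \<open>w\<close> are at
  most \<open>inner w w\<close>, and the mean forces equality, which in turn forces
  \<open>x1 = w\<close>.\<close>

lemma mean_extremal:
  fixes w x1 x2 x3 x4 :: complex
  assumes le: "cmod x1 \<le> cmod w" "cmod x2 \<le> cmod w" "cmod x3 \<le> cmod w" "cmod x4 \<le> cmod w"
    and sum: "x1 + x2 + x3 + x4 = 4 * w"
  shows "x1 = w"
proof -
  have ip: "inner x w \<le> inner w w" if "cmod x \<le> cmod w" for x
  proof -
    have "inner x w \<le> cmod x * cmod w" by (rule norm_cauchy_schwarz)
    also have "\<dots> \<le> cmod w * cmod w" using that by (intro mult_right_mono) auto
    also have "\<dots> = inner w w" by (simp add: power2_norm_eq_inner[symmetric] power2_eq_square)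
    finally show ?thesis .
  qed
  have "inner (x1 + x2 + x3 + x4) w = 4 * inner w w"
    unfolding sum by (simp add: inner_complex_def)
  then have "inner x1 w + inner x2 w + inner x3 w + inner x4 w = 4 * inner w w"
    by (simp only: inner_add_left)
  then have 1: "inner x1 w \<ge> inner w w"
    using ip[OF le(2)] ip[OF le(3)] ip[OF le(4)] by linarith
  have "(cmod x1)^2 \<le> (cmod w)^2" using le(1) by (intro power_mono) auto
  then have 2: "inner x1 x1 \<le> inner w w" by (simp only: power2_norm_eq_inner)
  have "inner (x1 - w) (x1 - w) = inner x1 x1 - 2 * inner x1 w + inner w w"
    by (simp add: inner_diff_left inner_diff_right inner_commute)
  also have "\<dots> \<le> 0" using 1 2 by linarith
  finally have "x1 - w = 0" by (metis inner_eq_zero_iff inner_ge_zero order_antisym)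
  then show ?thesis by simp
qed

text \<open>By the parallelogram law.\<close>

lemma symmetric_translates_in_disc:
  fixes w \<kappa> :: complex
  assumes "cmod (w + \<kappa>) \<le> cmod w" "cmod (- w + \<kappa>) \<le> cmod w"
  shows "\<kappa> = 0"
proof -
  have "(cmod (w + \<kappa>))^2 \<le> (cmod w)^2" "(cmod (- w + \<kappa>))^2 \<le> (cmod w)^2"
    using assms by (auto intro: power_mono)
  moreover have "(cmod (w + \<kappa>))^2 + (cmod (- w + \<kappa>))^2 = 2 * (cmod w)^2 + 2 * (cmod \<kappa>)^2"
    unfolding power2_norm_eq_inner
    by (simp add: inner_add_left inner_add_right inner_diff_left inner_diff_right inner_commute)
  ultimately have "(cmod \<kappa>)^2 \<le> 0" by linarith
  then show ?thesis by simp
qed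

text \<open>Solve the quadratic in \<open>z^2\<close>. The sum of its roots does not depend on
  \<open>w\<close>, which is what makes the mean over the fibre a translate of
  \<open>w\<close>.\<close>

lemma biquadratic_fibre:
  fixes a c w :: complex
  obtains s t where "s^2 + t^2 = a" "\<And>z. z^4 - a * z^2 - c - w = (z^2 - s^2) * (z^2 - t^2)"
proof -
  define d where "d = csqrt (a^2 + 4 * (c + w))"
  define s t where "s = csqrt ((a + d) / 2)" and "t = csqrt ((a - d) / 2)"
  have st: "s^2 = (a + d) / 2" "t^2 = (a - d) / 2" by (simp_all add: s_def t_def)
  have d: "d^2 = a^2 + 4 * (c + w)" by (simp add: d_def)
  have sum: "s^2 + t^2 = a" by (simp add: st field_simps)
  have "s^2 * t^2 = (a + d) / 2 * ((a - d) / 2)" by (simp only: st)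
  also have "\<dots> = (a^2 - d^2) / 4" by (simp add: power2_eq_square field_simps)
  finally have "s^2 * t^2 = (a^2 - d^2) / 4" .
  then have prod: "s^2 * t^2 = - (c + w)" by (simp add: d)
  show thesis
  proof (rule that[OF sum])
    fix z
    have "(z^2 - s^2) * (z^2 - t^2) = z^4 - (s^2 + t^2) * z^2 + s^2 * t^2"
      by (simp add: power2_eq_square power4_eq_xxxx algebra_simps)
    then show "z^4 - a * z^2 - c - w = (z^2 - s^2) * (z^2 - t^2)"
      by (simp only: sum prod) simp
  qed
qed

text \<open>Since \<open>q(z) = p(\<alpha> z + \<beta>) / \<alpha>\<^sup>4\<close> and \<open>p\<close> are both monic of degree 4, the mean of \<open>q\<close> over the
  fibre of \<open>p\<close> over \<open>w\<close> is \<open>w + \<kappa>\<close> with \<open>\<kappa>\<close> independent of \<open>w\<close>.\<close>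

lemma biquadratic_extremal:
  fixes a c \<alpha> \<beta> w0 :: complex
  defines "p \<equiv> \<lambda>z. z^4 - a * z^2 - c"
  assumes a: "a \<noteq> 0" and \<alpha>: "cmod \<alpha> = 1" and w0: "w0 \<noteq> 0"
    and bound: "\<And>z. p z = w0 \<or> p z = - w0 \<Longrightarrow> cmod (p (\<alpha> * z + \<beta>)) \<le> cmod w0"
  shows "\<alpha>^2 = 1 \<and> \<beta> = 0"
proof -
  have \<alpha>0: "\<alpha> \<noteq> 0" using \<alpha> by auto
  define \<gamma> where "\<gamma> = \<beta> / \<alpha>"
  define q where "q z = p (\<alpha> * z + \<beta>) / \<alpha>^4" for z
  define d0 where "d0 = \<gamma>^4 - a / \<alpha>^2 * \<gamma>^2 - c / \<alpha>^4 + c"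
  define d1 where "d1 = 4 * \<gamma>^3 - 2 * (a / \<alpha>^2) * \<gamma>"
  define d2 where "d2 = 6 * \<gamma>^2 - a / \<alpha>^2 + a"
  have q: "q z = p z + 4 * \<gamma> * z^3 + d2 * z^2 + d1 * z + d0" for z
  proof -
    have "\<alpha> * z + \<beta> = \<alpha> * (z + \<gamma>)" using \<alpha>0 by (simp add: \<gamma>_def algebra_simps)
    then have "q z = (\<alpha>^4 * (z + \<gamma>)^4 - a * (\<alpha>^2 * (z + \<gamma>)^2) - c) / \<alpha>^4"
      by (simp add: q_def p_def power_mult_distrib)
    also have "\<dots> = (z + \<gamma>)^4 - a / \<alpha>^2 * (z + \<gamma>)^2 - c / \<alpha>^4"
      using \<alpha>0 by (simp add: diff_divide_distrib eval_nat_numeral)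
    also have "\<dots> = p z + 4 * \<gamma> * z^3 + d2 * z^2 + d1 * z + d0"
      unfolding p_def d0_def d1_def d2_def
      by (simp add: power2_eq_square power3_eq_cube power4_eq_xxxx algebra_simps)
    finally show ?thesis .
  qed
  have qb: "cmod (q z) \<le> cmod w0" if "p z = w0 \<or> p z = - w0" for z
    using bound[OF that] by (simp add: q_def norm_divide norm_power \<alpha>)
  \<comment> \<open>Over \<open>{s, - s, t, - t}\<close> the odd terms of \<open>q\<close> cancel
    and \<open>s^2 + t^2 = a\<close>, so the values of \<open>q\<close> sum to
    \<open>4 * w + 2 * d2 * a + 4 * d0\<close>.\<close>
  define \<kappa> where "\<kappa> = d2 * a / 2 + d0"
  have fibre: "\<exists>s t. s^2 + t^2 = a \<and> (\<forall>z\<in>{s, - s, t, - t}. p z = w) \<and>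
      q s + q (- s) + q t + q (- t) = 4 * (w + \<kappa>)" for w
  proof -
    obtain s t where st: "s^2 + t^2 = a" "\<And>z. z^4 - a * z^2 - c - w = (z^2 - s^2) * (z^2 - t^2)"
      using biquadratic_fibre[of a c w] by blast
    have "p z - w = (z^2 - s^2) * (z^2 - t^2)" for z using st(2)[of z] by (simp add: p_def)
    then have p: "\<forall>z\<in>{s, - s, t, - t}. p z = w"
      by (metis (no_types) diff_self eq_iff_diff_eq_0 insertE mult_zero_left mult_zero_right power2_minus singletonD)
    have "q z + q (- z) = 2 * w + 2 * d2 * z^2 + 2 * d0" if "z \<in> {s, t}" for z
      using that p by (auto simp: q power3_eq_cube)
    then have "q s + q (- s) + (q t + q (- t)) = 4 * w + 2 * d2 * (s^2 + t^2) + 4 * d0"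
      by (simp add: algebra_simps)
    then have "q s + q (- s) + q t + q (- t) = 4 * (w + \<kappa>)"
      by (simp add: st(1) \<kappa>_def algebra_simps)
    with st(1) p show ?thesis by blast
  qed
  have le: "cmod (w + \<kappa>) \<le> cmod w0" if "w = w0 \<or> w = - w0" for w
  proof -
    obtain s t where st: "\<forall>z\<in>{s, - s, t, - t}. p z = w" "q s + q (- s) + q t + q (- t) = 4 * (w + \<kappa>)"
      using fibre by blast
    have b: "cmod (q z) \<le> cmod w0" if "z \<in> {s, - s, t, - t}" for z
      using st(1) that \<open>w = w0 \<or> w = - w0\<close> qb by blast
    have "4 * cmod (w + \<kappa>) = cmod (q s + q (- s) + q t + q (- t))"
      unfolding st(2) norm_mult by simp
    also have "\<dots> \<le> cmod (q s) + cmod (q (- s)) + cmod (q t) + cmod (q (- t))"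
      by (intro order_trans[OF norm_triangle_ineq] add_mono norm_triangle_ineq order_refl)
    also have "\<dots> \<le> 4 * cmod w0"
      using b[of s] b[of "- s"] b[of t] b[of "- t"] by simp
    finally show ?thesis by simp
  qed
  have \<kappa>: "\<kappa> = 0"
    using le[of w0] le[of "- w0"] by (intro symmetric_translates_in_disc[of w0]) auto
  \<comment> \<open>With \<open>\<kappa> = 0\<close> the four values lie in the disc of radius
    \<open>cmod w\<close> and have mean \<open>w\<close>, so all equal \<open>w\<close>. Since
    \<open>a \<noteq> 0\<close>, the fibre has a nonzero point.\<close>
  have zero: "\<exists>z. z \<noteq> 0 \<and> p z = w \<and> q z = w \<and> q (- z) = w" if w: "w = w0 \<or> w = - w0" for w
  proof -
    obtain s t where st: "s^2 + t^2 = a" "\<forall>z\<in>{s, - s, t, - t}. p z = w"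
        "q s + q (- s) + q t + q (- t) = 4 * w"
      using fibre[of w] \<kappa> by auto
    have "cmod w = cmod w0" using w by auto
    then have b: "cmod (q z) \<le> cmod w" if "z \<in> {s, - s, t, - t}" for z
      using st(2) that w qb by metis
    then have b4: "cmod (q s) \<le> cmod w" "cmod (q (- s)) \<le> cmod w" "cmod (q t) \<le> cmod w" "cmod (q (- t)) \<le> cmod w"
      by auto
    have "q s = w" by (rule mean_extremal[OF b4]) (use st(3) in simp)
    moreover have "q (- s) = w"
      by (rule mean_extremal[OF b4(2,1,3,4)]) (use st(3) in \<open>simp add: algebra_simps\<close>)
    moreover have "q t = w"
      by (rule mean_extremal[OF b4(3,1,2,4)]) (use st(3) in \<open>simp add: algebra_simps\<close>)
    moreover have "q (- t) = w"
      by (rule mean_extremal[OF b4(4,1,2,3)]) (use st(3) in \<open>simp add: algebra_simps\<close>)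
    moreover have "s \<noteq> 0 \<or> t \<noteq> 0" using st(1) a by auto
    ultimately show ?thesis using st(2) by blast
  qed
  obtain z1 where z1: "z1 \<noteq> 0" "p z1 = w0" "q z1 = w0" "q (- z1) = w0" using zero by blast
  obtain z2 where z2: "z2 \<noteq> 0" "p z2 = - w0" "q z2 = - w0" "q (- z2) = - w0" using zero by blast
  have u: "z1^2 \<noteq> z2^2"
  proof
    assume e: "z1^2 = z2^2"
    have "z^4 = (z^2)^2" for z :: complex by (simp add: power2_eq_square power4_eq_xxxx)
    then have "p z1 = p z2" by (simp only: p_def e)
    then show False using z1 z2 w0 by simp
  qed
  have pm: "p (- z) = p z" for z by (simp add: p_def)
  \<comment> \<open>At \<open>z\<close> and \<open>- z\<close> the even and odd parts of
    \<open>q - p\<close> vanish separately. After division by \<open>z\<close> in the odd case both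
    are affine in \<open>z^2\<close>; vanishing at \<open>z1^2\<close> and \<open>z2^2\<close>, they
    have zero coefficients.\<close>
  have rel: "4 * \<gamma> * z^2 + d1 = 0 \<and> d2 * z^2 + d0 = 0" if "z \<noteq> 0" "q z = p z" "q (- z) = p z" for z
  proof -
    have "4 * \<gamma> * z^3 + d2 * z^2 + d1 * z + d0 = q z - p z" unfolding q[of z] by simp
    then have 1: "4 * \<gamma> * z^3 + d2 * z^2 + d1 * z + d0 = 0" using that(2) by simp
    have "- (4 * \<gamma> * z^3) + d2 * z^2 - d1 * z + d0 = q (- z) - p z"
      unfolding q[of "- z"] pm by (simp add: power3_eq_cube)
    then have 2: "- (4 * \<gamma> * z^3) + d2 * z^2 - d1 * z + d0 = 0" using that(3) by simp
    have "2 * (d2 * z^2 + d0) = (4 * \<gamma> * z^3 + d2 * z^2 + d1 * z + d0) + (- (4 * \<gamma> * z^3) + d2 * z^2 - d1 * z + d0)"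
      by simp
    then have "2 * (d2 * z^2 + d0) = 0" by (simp only: 1 2) simp
    then have e: "d2 * z^2 + d0 = 0" by (metis mult_eq_0_iff zero_neq_numeral)
    have "2 * (z * (4 * \<gamma> * z^2 + d1)) = (4 * \<gamma> * z^3 + d2 * z^2 + d1 * z + d0) - (- (4 * \<gamma> * z^3) + d2 * z^2 - d1 * z + d0)"
      by (simp add: power2_eq_square power3_eq_cube algebra_simps)
    then have "2 * (z * (4 * \<gamma> * z^2 + d1)) = 0" by (simp only: 1 2) simp
    then have "z * (4 * \<gamma> * z^2 + d1) = 0" by (metis mult_eq_0_iff zero_neq_numeral)
    with e that(1) show ?thesis by simp
  qed
  have r1: "4 * \<gamma> * z1^2 + d1 = 0 \<and> d2 * z1^2 + d0 = 0" by (rule rel) (use z1 in simp_all)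
  have r2: "4 * \<gamma> * z2^2 + d1 = 0 \<and> d2 * z2^2 + d0 = 0" by (rule rel) (use z2 in simp_all)
  have "4 * \<gamma> * (z1^2 - z2^2) = (4 * \<gamma> * z1^2 + d1) - (4 * \<gamma> * z2^2 + d1)"
    by (simp add: algebra_simps)
  then have "4 * \<gamma> * (z1^2 - z2^2) = 0" using r1 r2 by simp
  then have \<gamma>: "\<gamma> = 0" using u by simp
  have "d2 * (z1^2 - z2^2) = (d2 * z1^2 + d0) - (d2 * z2^2 + d0)"
    by (simp add: algebra_simps)
  then have "d2 * (z1^2 - z2^2) = 0" using r1 r2 by simp
  then have "d2 = 0" using u by simp
  then have "a / \<alpha>^2 = a" by (simp add: d2_def \<gamma>)
  then have "\<alpha>^2 = 1" using a \<alpha>0 by (simp add: field_simps)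
  moreover have "\<beta> = 0" using \<gamma> \<alpha>0 by (simp add: \<gamma>_def)
  ultimately show ?thesis ..
qed

section \<open>Rigidity for the quartic\<close>

lemma p_neg_escape:
  assumes "0 < b" "b < 1" "cmod z \<ge> 2"
  shows "cmod (poly (p_neg b) z) \<ge> 2 * cmod z"
proof -
  define r where "r = cmod z"
  have r: "r \<ge> 2" using assms by (simp add: r_def)
  have r2: "r^2 \<ge> 2 * r" using r by (simp add: power2_eq_square)
  have "cmod (z^2) \<le> cmod (z^2 - 1) + 1"
    using norm_triangle_ineq[of "z^2 - 1" 1] by simp
  then have 1: "r^2 - 1 \<le> cmod (z^2 - 1)" by (simp add: r_def norm_power)
  have "cmod (z^2) \<le> cmod (z^2 + of_real b) + b"
    using norm_triangle_ineq4[of "z^2 + of_real b" "of_real b"] assms by simp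
  then have 2: "r^2 - 1 \<le> cmod (z^2 + of_real b)" using assms by (simp add: r_def norm_power)
  define t where "t = r^2 - 1"
  have t: "2 * r - 1 \<le> t" "3 \<le> t" using r r2 by (simp_all add: t_def)
  have "2 * r \<le> 3 * t" using r t by linarith
  also have "\<dots> \<le> t * t" using t by (intro mult_right_mono) auto
  also have "\<dots> \<le> cmod (z^2 - 1) * cmod (z^2 + of_real b)"
    using 1 2 t by (intro mult_mono) (auto simp: t_def)
  finally show ?thesis by (simp add: poly_p_neg norm_mult r_def)
qed

lemma poly_p_neg': "poly (p_neg b) z = z^4 - of_real (1 - b) * z^2 - of_real b"
  unfolding poly_p_neg by (simp add: power2_eq_square power4_eq_xxxx algebra_simps)

text \<open>A fixed point of the polynomial works: the escape estimate bounds it, and 0 is not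
  fixed. Hence the maximal modulus on the filled Julia set is positive.\<close>

lemma ex_nonzero_filled_julia:
  assumes b: "0 < b" "b < 1"
  shows "\<exists>z\<in>filled_julia (p_neg b). z \<noteq> 0"
proof -
  define p where "p = p_neg b"
  have "degree (p - [:0, 1:]) \<noteq> 0" by (simp add: p_def p_neg_eq)
  then have "\<not> constant (poly (p - [:0, 1:]))" by (simp add: constant_degree)
  from Fundamental_Theorem_Algebra.fundamental_theorem_of_algebra[OF this] obtain z where "poly (p - [:0, 1:]) z = 0" ..
  then have z: "poly p z = z" by simp
  have "(poly p ^^ n) z = z" for n by (induction n) (simp_all only: funpow_0 funpow.simps comp_apply id_apply z)
  moreover have "cmod z \<le> 2"
  proof (rule ccontr)
    assume "\<not> cmod z \<le> 2"
    then have "2 * cmod z \<le> cmod (poly p z)"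
      unfolding p_def by (intro p_neg_escape b) simp
    then show False using \<open>\<not> cmod z \<le> 2\<close> unfolding z by linarith
  qed
  ultimately have "z \<in> filled_julia p" by (simp add: filled_julia_def)
  moreover have "z \<noteq> 0" using z b by (auto simp: p_def poly_p_neg)
  ultimately show ?thesis unfolding p_def by blast
qed

lemma poly_map_p_neg_rigid:
  assumes b: "0 < b" "b < 1" and \<alpha>: "cmod \<alpha> = 1"
    and iff: "\<And>z. Pt (\<alpha> * z + \<beta>) \<in> Fatou (poly_map (p_neg b)) \<longleftrightarrow> Pt z \<in> Fatou (poly_map (p_neg b))"
  shows "\<alpha>^2 = 1 \<and> \<beta> = 0"
proof -
  define p where "p = p_neg b"
  define K where "K = filled_julia p"
  note escape = p_neg_escape[OF b, folded p_def]
  have comp: "compact K" unfolding K_def by (rule compact_filled_julia) (rule escape)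
  obtain z0 where z0: "z0 \<in> K" "z0 \<noteq> 0"
    using ex_nonzero_filled_julia[OF b] by (auto simp: K_def p_def)
  obtain w0 where w0: "w0 \<in> K" "\<And>w. w \<in> K \<Longrightarrow> cmod w \<le> cmod w0"
    using continuous_attains_sup[OF comp, of cmod] z0(1) continuous_on_norm_id by blast
  have w0_nz: "w0 \<noteq> 0" using w0(2)[OF z0(1)] z0(2) by auto
  have pK: "poly p z \<in> K \<longleftrightarrow> z \<in> K" for z
    unfolding K_def using poly_in_filled_julia[OF escape] filled_juliaI[OF escape] by blast
  have mw0: "- w0 \<in> K"
    using pK[of "- w0"] pK[of w0] w0(1) by (simp add: p_def poly_p_neg)
  \<comment> \<open>The symmetry maps the frontier of \<open>K\<close> outside the Fatou set, hence
    into \<open>K\<close>, where the modulus is at most \<open>cmod w0\<close>. The maximum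
    principle extends the bound to all of \<open>K\<close>.\<close>
  have "cmod (poly p (\<alpha> * z + \<beta>)) \<le> cmod w0" if "z \<in> K" for z
  proof (rule maximum_modulus_frontier[OF _ _ _ _ that])
    show "(\<lambda>z. poly p (\<alpha> * z + \<beta>)) holomorphic_on interior K"
      by (intro holomorphic_intros)
    show "continuous_on (closure K) (\<lambda>z. poly p (\<alpha> * z + \<beta>))"
      by (intro continuous_intros)
    show "bounded K" using comp by (rule compact_imp_bounded)
    fix x assume "x \<in> frontier K"
    then have "Pt x \<notin> Fatou (poly_map p)"
      unfolding K_def by (intro frontier_filled_julia_not_in_Fatou escape)
    then have "Pt (\<alpha> * x + \<beta>) \<notin> Fatou (poly_map p)" using iff by (simp add: p_def)
    then have "\<alpha> * x + \<beta> \<in> K" unfolding K_def using escaping_in_Fatou[OF escape] by blast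
    then have "poly p (\<alpha> * x + \<beta>) \<in> K" by (simp only: pK)
    then show "cmod (poly p (\<alpha> * x + \<beta>)) \<le> cmod w0" by (rule w0(2))
  qed
  \<comment> \<open>Both fibres lie in \<open>K\<close>, because preimages of points of
    \<open>K\<close> do.\<close>
  then have bound: "cmod (poly p (\<alpha> * z + \<beta>)) \<le> cmod w0" if "poly p z = w0 \<or> poly p z = - w0" for z
    using that pK[of z] w0(1) mw0 by auto
  have "complex_of_real (1 - b) \<noteq> 0" using b by (simp del: of_real_diff)
  from biquadratic_extremal[OF this \<alpha> w0_nz, of "of_real b" \<beta>] show ?thesis
    using bound unfolding p_def poly_p_neg' by blast
qed

lemma symmetry_group_poly_map_p_neg:
  assumes b: "0 < b" "b < 1"
  shows "symmetry_group (poly_map (p_neg b)) = {\<lambda>z. z, \<lambda>z. - z}"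
proof (rule symmetry_group_eq_pm_id)
  fix z assume "Pt z \<in> Fatou (poly_map (p_neg b))"
  moreover have "poly_map (p_neg b) (neg_sphere x) = poly_map (p_neg b) x" for x
    by (cases x) (simp_all add: poly_map_Pt poly_p_neg)
  ultimately have "neg_sphere (Pt z) \<in> Fatou (poly_map (p_neg b))" by (rule Fatou_even[rotated])
  then show "Pt (- z) \<in> Fatou (poly_map (p_neg b))" by simp
qed (rule poly_map_p_neg_rigid[OF b])

section \<open>The symmetry group of Chebyshev's method\<close>

lemma basin_step: "R x \<in> basin R \<zeta> \<longleftrightarrow> x \<in> basin R \<zeta>"
proof -
  have "(R ^^ n) (R x) = (R ^^ Suc n) x" for n by (simp only: funpow_Suc_right comp_apply)
  then show ?thesis
    unfolding basin_def mem_Collect_eq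
    by (simp only: filterlim_sequentially_Suc[of "\<lambda>n. (R ^^ n) x"])
qed

lemma basin_disjoint: "x \<in> basin R \<zeta> \<Longrightarrow> x \<in> basin R \<xi> \<Longrightarrow> \<zeta> = \<xi>"
  unfolding basin_def mem_Collect_eq by (rule LIMSEQ_unique)

lemma basin_fixpoint:
  assumes "R x = x" "x \<in> basin R \<zeta>"
  shows "\<zeta> = x"
proof -
  have "(R ^^ n) x = x" for n by (induction n) (simp_all add: assms(1))
  then have "x \<in> basin R x" unfolding basin_def by simp
  with assms(2) show ?thesis by (rule basin_disjoint)
qed

lemma basin_equivariant:
  assumes k: "\<And>x. R (k x) = k (R x)" and cont: "continuous_on UNIV k" and x: "x \<in> basin R \<zeta>"
  shows "k x \<in> basin R (k \<zeta>)"
proof -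
  have "(R ^^ n) (k x) = k ((R ^^ n) x)" for n by (induction n) (simp_all add: k)
  moreover have "isCont k \<zeta>" using cont by (simp add: continuous_on_eq_continuous_at)
  then have "(\<lambda>n. k ((R ^^ n) x)) \<longlonglongrightarrow> k \<zeta>"
    using x unfolding basin_def mem_Collect_eq by (rule isCont_tendsto_compose)
  ultimately show ?thesis
    unfolding basin_def mem_Collect_eq by (simp only:)
qed

definition cnj_sphere :: "rsphere \<Rightarrow> rsphere" where
  "cnj_sphere = sphere_ext cnj"

lemma cnj_sphere_simps [simp]: "cnj_sphere (Pt z) = Pt (cnj z)" "cnj_sphere Infty = Infty"
  by (simp_all add: cnj_sphere_def)

lemma dist_cnj_sphere [simp]: "dist (cnj_sphere x) (cnj_sphere y) = dist x y"
proof -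
  have PP: "dist (Pt (cnj z)) (Pt (cnj w)) = dist (Pt z) (Pt w)" for z w
    by (simp only: dist_Pt_Pt complex_mod_cnj complex_cnj_diff[symmetric])
  have PI: "dist (Pt (cnj z)) Infty = dist (Pt z) Infty" for z
    by (simp add: dist_Pt_Infty)
  have IP: "dist Infty (Pt (cnj z)) = dist Infty (Pt z)" for z
    using PI[of z] by (simp only: dist_commute)
  show ?thesis by (cases x; cases y) (simp_all add: PP PI IP)
qed

lemma continuous_on_cnj_sphere: "continuous_on S cnj_sphere"
proof -
  have "1-lipschitz_on S cnj_sphere" by (rule lipschitz_onI) auto
  then show ?thesis by (rule lipschitz_on_continuous_on)
qed

section \<open>Chebyshev's method of the quartic on the sphere\<close>

context
  fixes b :: real and S :: "rsphere \<Rightarrow> rsphere" and a :: real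
    and f den :: "complex \<Rightarrow> complex"
  assumes b: "0 < b" "b < 1"
  defines "S \<equiv> chebyshev_map (p_neg b)" and "a \<equiv> 1 - b"
    and "f \<equiv> cheb (complex_of_real a) (complex_of_real b)"
    and "den \<equiv> \<lambda>z. 4 * z^3 - 2 * complex_of_real a * z"
begin

lemma S_Pt: "S (Pt z) = (if den z = 0 then Infty else Pt (f z))"
  unfolding S_def den_def f_def a_def by (rule chebyshev_map_p_neg(1)[OF b])

lemma S_Infty: "S Infty = Infty"
  unfolding S_def by (rule chebyshev_map_p_neg(2)[OF b])

lemma S_pow_Infty: "(S ^^ n) Infty = Infty"
  by (induction n) (simp_all add: S_Infty)

text \<open>Zeros of \<open>den\<close> satisfy \<open>z = 0\<close> or \<open>2 * z^2 = a\<close>,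
  where \<open>0 < a < 1\<close>.\<close>

lemma den_nonzero: "cmod z \<ge> 1 \<Longrightarrow> den z \<noteq> 0"
proof
  assume z: "cmod z \<ge> 1" and "den z = 0"
  then have "2 * z * (2 * z^2 - of_real a) = 0"
    by (simp add: den_def power2_eq_square power3_eq_cube algebra_simps)
  then have "2 * z^2 = of_real a" using z by auto
  then have "cmod (2 * z^2) = \<bar>a\<bar>" by simp
  then have "2 * (cmod z)^2 = \<bar>a\<bar>" by (simp add: norm_mult norm_power)
  moreover have "(cmod z)^2 \<ge> 1" using z by simp
  ultimately show False using b by (simp add: a_def)
qed

lemma den_minus: "den (- z) = - den z"
  by (simp add: den_def power3_eq_cube)

lemma den_cnj: "den (cnj z) = cnj (den z)"
  by (simp add: den_def)

lemma f_minus: "f (- z) = - f z"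
  unfolding f_def by (rule cheb_minus)

lemma f_cnj: "f (cnj z) = cnj (f z)"
  unfolding f_def by (rule cheb_cnj)

lemma S_neg_sphere: "S (neg_sphere x) = neg_sphere (S x)"
  by (cases x) (simp_all add: S_Pt S_Infty den_minus f_minus)

lemma S_cnj_sphere: "S (cnj_sphere x) = cnj_sphere (S x)"
  by (cases x) (simp_all add: S_Pt S_Infty den_cnj f_cnj)

lemma isCont_f: "den z \<noteq> 0 \<Longrightarrow> isCont f z"
  unfolding f_def den_def by (rule DERIV_isCont[OF DERIV_cheb])

lemma open_den: "open {z. den z \<noteq> 0}"
  unfolding den_def by (intro open_Collect_neq continuous_intros)

lemma superattracting_root:
  assumes "\<zeta>^4 - of_real a * \<zeta>^2 - of_real b = 0" "den \<zeta> \<noteq> 0"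
  shows "superattracting_fixpoint S (Pt \<zeta>)"
proof -
  have "f \<zeta> = \<zeta>" unfolding f_def using assms(1) by (rule cheb_root)
  then have "S (Pt \<zeta>) = Pt \<zeta>" using assms(2) by (simp add: S_Pt)
  moreover have "((\<lambda>w. coord (S (Pt w))) has_field_derivative 0) (at \<zeta>)"
  proof -
    have "(f has_field_derivative 0) (at \<zeta>)"
      using DERIV_cheb[of \<zeta> "of_real a" "of_real b"] assms unfolding f_def den_def by simp
    moreover have "\<forall>\<^sub>F w in nhds \<zeta>. coord (S (Pt w)) = f w"
    proof -
      have "\<forall>\<^sub>F w in nhds \<zeta>. w \<in> {z. den z \<noteq> 0}"
        using open_den assms(2) by (intro eventually_nhds_in_open) auto
      then show ?thesis by eventually_elim (simp add: S_Pt)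
    qed
    ultimately show ?thesis by (subst DERIV_cong_ev[OF refl _ refl])
  qed
  ultimately show ?thesis by (simp add: superattracting_fixpoint_def)
qed

lemma superattracting_neg:
  assumes "superattracting_fixpoint S (Pt \<zeta>)"
  shows "superattracting_fixpoint S (Pt (- \<zeta>))"
proof -
  define h where "h w = coord (S (Pt w))" for w
  have fp: "S (Pt \<zeta>) = Pt \<zeta>" and d: "(h has_field_derivative 0) (at \<zeta>)"
    using assms by (auto simp: superattracting_fixpoint_def h_def [abs_def])
  \<comment> \<open>At poles both sides are 0, the dummy coordinate of \<open>Infty\<close>.\<close>
  have "h (- w) = - h w" for w
    by (simp add: h_def S_Pt den_minus f_minus)
  then have h: "h = (\<lambda>w. - h (- w))" by auto
  have "(h has_field_derivative 0) (at (- (- \<zeta>)))" using d by simp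
  from DERIV_minus[OF DERIV_chain2[OF this DERIV_minus[OF DERIV_ident]]]
  have "((\<lambda>w. - h (- w)) has_field_derivative 0) (at (- \<zeta>))" by simp
  then have "(h has_field_derivative 0) (at (- \<zeta>))" using h by simp
  moreover have "S (Pt (- \<zeta>)) = Pt (- \<zeta>)"
    using S_neg_sphere[of "Pt \<zeta>"] fp by simp
  ultimately show ?thesis by (simp add: superattracting_fixpoint_def h_def [abs_def])
qed

lemma superattracting_cnj:
  assumes "superattracting_fixpoint S (Pt \<zeta>)"
  shows "superattracting_fixpoint S (Pt (cnj \<zeta>))"
proof -
  define h where "h w = coord (S (Pt w))" for w
  have fp: "S (Pt \<zeta>) = Pt \<zeta>" and d: "(h has_field_derivative 0) (at \<zeta>)"
    using assms by (auto simp: superattracting_fixpoint_def h_def [abs_def])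
  have "h (cnj w) = cnj (h w)" for w
    by (simp add: h_def S_Pt den_cnj f_cnj)
  then have h: "h = cnj \<circ> h \<circ> cnj" by (auto simp: comp_def)
  have "(cnj \<circ> h \<circ> cnj has_field_derivative cnj 0) (at (cnj \<zeta>))"
    by (rule has_field_derivative_cnj_cnj) (use d in simp)
  then have "(h has_field_derivative 0) (at (cnj \<zeta>))" unfolding h[symmetric] by simp
  moreover have "S (Pt (cnj \<zeta>)) = Pt (cnj \<zeta>)"
    using S_cnj_sphere[of "Pt \<zeta>"] fp by simp
  ultimately show ?thesis by (simp add: superattracting_fixpoint_def h_def [abs_def])
qed

text \<open>In the chart \<open>w = 1 / z\<close> the map is \<open>w / \<Phi> (w^2)\<close> near 0.
  A zero derivative would make \<open>h w / w * \<Phi> (w^2)\<close> tend to 0, but this product is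
  constantly 1 near 0.\<close>

lemma not_superattracting_Infty: "\<not> superattracting_fixpoint S Infty"
proof
  define h where "h w = coord (sphere_inv (S (sphere_inv (Pt w))))" for w
  define \<Phi> where "\<Phi> w = cheb_inf (complex_of_real a) (complex_of_real b) w" for w
  assume "superattracting_fixpoint S Infty"
  then have "(h has_field_derivative 0) (at 0)"
    by (simp add: superattracting_fixpoint_def h_def [abs_def])
  then have "((\<lambda>w. (h w - h 0) / (w - 0)) \<longlongrightarrow> 0) (at 0)"
    by (simp only: has_field_derivative_iff)
  moreover have "h 0 = 0" by (simp add: h_def S_Infty)
  ultimately have lim: "((\<lambda>w. h w / w) \<longlongrightarrow> 0) (at 0)" by simp
  have "isCont \<Phi> 0"
    unfolding \<Phi>_def [abs_def] using DERIV_cheb_inf_0 by (rule DERIV_isCont)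
  then have "(\<Phi> \<longlongrightarrow> 21 / 32) (at 0)" unfolding isCont_def by (simp add: \<Phi>_def cheb_inf_0)
  moreover have "filterlim (\<lambda>w :: complex. w^2) (at 0) (at 0)"
    unfolding filterlim_at by (auto intro!: tendsto_eq_intros simp: eventually_at_filter)
  ultimately have \<Phi>: "((\<lambda>w. \<Phi> (w^2)) \<longlongrightarrow> 21 / 32) (at 0)" by (rule filterlim_compose)
  have "((\<lambda>w. h w / w * \<Phi> (w^2)) \<longlongrightarrow> 0 * (21 / 32)) (at 0)"
    by (intro tendsto_mult lim \<Phi>)
  moreover have "\<forall>\<^sub>F w in at 0. h w / w * \<Phi> (w^2) = 1"
  proof -
    have "\<forall>\<^sub>F w in at 0. \<Phi> (w^2) \<noteq> 0"
      using \<Phi> by (rule tendsto_imp_eventually_ne) simp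
    moreover have "\<forall>\<^sub>F w in at (0 :: complex). w \<in> ball 0 1 - {0}"
      by (intro eventually_at_in_open) auto
    ultimately show ?thesis
    proof eventually_elim
      case (elim w)
      then have w: "w \<noteq> 0" "cmod w < 1" by auto
      then have "cmod (1 / w) \<ge> 1" by (simp add: norm_divide)
      then have "S (Pt (1 / w)) = Pt (f (1 / w))" using den_nonzero by (simp add: S_Pt)
      moreover have fw: "f (1 / w) = 1 / w * \<Phi> (w^2)"
        unfolding f_def \<Phi>_def using cheb_eq_cheb_inf[of "1 / w"] w by (simp add: power_one_over)
      moreover have "f (1 / w) \<noteq> 0" using fw w elim by simp
      ultimately have "h w = w / \<Phi> (w^2)" using w by (simp add: h_def)
      then show ?case using w elim by simp
    qed
  qed
  then have "((\<lambda>w. h w / w * \<Phi> (w^2)) \<longlongrightarrow> 1) (at 0)" by (rule tendsto_eventually)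
  ultimately show False using tendsto_unique[of "at (0 :: complex)"] by fastforce
qed

section \<open>The coordinate axes\<close>

lemma real_in_basin:
  assumes "x \<ge> 1"
  shows "Pt (of_real x) \<in> basin S (Pt 1)"
proof -
  define X where "X n = (cheb a b ^^ n) x" for n
  have ge: "X n \<ge> 1" for n
  proof (induction n)
    case (Suc n)
    have "1 \<le> cheb a b (X n)" by (rule cheb_ge[of 1 b]) (use b Suc in \<open>simp_all add: a_def\<close>)
    then show ?case by (simp add: X_def)
  qed (use assms in \<open>simp add: X_def\<close>)
  have "(S ^^ n) (Pt (of_real x)) = Pt (of_real (X n))" for n
  proof (induction n)
    case (Suc n)
    have "den (of_real (X n)) \<noteq> 0" using ge[of n] by (intro den_nonzero) simp
    with Suc show ?case by (simp add: S_Pt f_def cheb_of_real X_def)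
  qed (simp add: X_def)
  moreover have "X \<longlonglongrightarrow> 1"
    unfolding X_def [abs_def]
    by (rule cheb_funpow_tendsto[of 1 b]) (use assms b in \<open>simp_all add: a_def\<close>)
  then have "(\<lambda>n. Pt (of_real (X n))) \<longlonglongrightarrow> Pt (of_real 1)"
    by (intro tendsto_Pt tendsto_of_real)
  ultimately show ?thesis by (simp add: basin_def)
qed

text \<open>Along \<open>\<i> * x\<close> the method is the real iteration with \<open>- a\<close>
  for \<open>a\<close>, that is with \<open>r = sqrt b\<close> and \<open>t = 1\<close>.\<close>

lemma imaginary_in_basin:
  assumes "x \<ge> 1"
  shows "Pt (\<i> * of_real x) \<in> basin S (Pt (\<i> * of_real (sqrt b)))"
proof -
  define r where "r = sqrt b"
  have r: "r > 0" "r^2 = b" "r < 1" using b by (simp_all add: r_def)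
  define X where "X n = (cheb (- a) b ^^ n) x" for n
  have ge: "X n \<ge> r" for n
  proof (induction n)
    case (Suc n)
    have "r \<le> cheb (- a) b (X n)" by (rule cheb_ge[of r 1]) (use r Suc in \<open>simp_all add: a_def\<close>)
    then show ?case by (simp add: X_def)
  qed (use assms r in \<open>simp add: X_def\<close>)
  have "(S ^^ n) (Pt (\<i> * of_real x)) = Pt (\<i> * of_real (X n))" for n
  proof (induction n)
    case (Suc n)
    have "den (\<i> * of_real (X n)) = - \<i> * of_real (4 * X n ^ 3 + 2 * a * X n)"
      by (simp add: den_def power3_eq_cube algebra_simps)
    moreover have "4 * X n ^ 3 + 2 * a * X n > 0"
      using ge[of n] r b by (intro add_pos_pos mult_pos_pos zero_less_power) (auto simp: a_def)
    ultimately have "den (\<i> * of_real (X n)) \<noteq> 0"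
      by (metis mult_eq_0_iff neg_equal_0_iff_equal complex_i_not_zero of_real_eq_0_iff less_irrefl)
    moreover have "f (\<i> * of_real (X n)) = \<i> * of_real (X (Suc n))"
      using cheb_of_real[of "- a" b "X n", where 'a = complex] by (simp add: f_def cheb_ii X_def)
    ultimately show ?case using Suc by (simp add: S_Pt)
  qed (simp add: X_def)
  moreover have "X \<longlonglongrightarrow> r"
    unfolding X_def [abs_def]
    by (rule cheb_funpow_tendsto[of r 1]) (use assms r in \<open>simp_all add: a_def\<close>)
  then have "(\<lambda>n. Pt (\<i> * of_real (X n))) \<longlonglongrightarrow> Pt (\<i> * of_real r)"
    by (intro tendsto_Pt tendsto_mult tendsto_const tendsto_of_real)
  ultimately show ?thesis by (simp add: basin_def r_def)
qed

lemma superattracting_1: "superattracting_fixpoint S (Pt 1)"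
  by (rule superattracting_root) (use den_nonzero[of 1] in \<open>simp_all add: a_def\<close>)

lemma superattracting_ii: "superattracting_fixpoint S (Pt (\<i> * of_real (sqrt b)))"
proof (rule superattracting_root)
  have s: "complex_of_real (sqrt b) ^ 2 = of_real b"
    using b by (simp flip: of_real_power)
  have sq: "(\<i> * complex_of_real (sqrt b))^2 = - of_real b"
    by (simp add: power_mult_distrib s)
  have "(\<i> * complex_of_real (sqrt b))^4 = ((\<i> * complex_of_real (sqrt b))^2)^2"
    by (simp only: power_mult[symmetric]) simp
  then show "(\<i> * complex_of_real (sqrt b))^4 - of_real a * (\<i> * complex_of_real (sqrt b))^2 - of_real b = 0"
    by (simp only: sq) (simp add: a_def power2_eq_square algebra_simps)
  have "den (\<i> * of_real (sqrt b)) = 2 * (\<i> * of_real (sqrt b)) * (2 * (\<i> * of_real (sqrt b))^2 - of_real a)"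
    by (simp add: den_def power2_eq_square power3_eq_cube algebra_simps)
  also have "\<dots> = - (2 * \<i> * of_real (sqrt b) * of_real (1 + b))"
    unfolding sq by (simp add: a_def algebra_simps)
  also have "\<dots> \<noteq> 0"
    using b by (simp del: of_real_add)
  finally show "den (\<i> * of_real (sqrt b)) \<noteq> 0" .
qed

section \<open>Openness of basins\<close>

text \<open>The zero derivative gives a ball on which the distance to the fixed point at least
  halves at each step. The finite part of the basin is the union of the iterated preimages of this
  ball.\<close>

lemma open_basin:
  assumes "superattracting_fixpoint S (Pt \<zeta>)"
  shows "open {z. Pt z \<in> basin S (Pt \<zeta>)}"
proof -
  have fp: "S (Pt \<zeta>) = Pt \<zeta>" and d: "((\<lambda>w. coord (S (Pt w))) has_field_derivative 0) (at \<zeta>)"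
    using assms by (auto simp: superattracting_fixpoint_def)
  have den: "den \<zeta> \<noteq> 0" and f\<zeta>: "f \<zeta> = \<zeta>" using fp by (auto simp: S_Pt split: if_splits)
  have "((\<lambda>w. (coord (S (Pt w)) - \<zeta>) / (w - \<zeta>)) \<longlongrightarrow> 0) (at \<zeta>)"
    using d by (simp add: has_field_derivative_iff fp)
  then have "\<forall>\<^sub>F w in at \<zeta>. dist ((coord (S (Pt w)) - \<zeta>) / (w - \<zeta>)) 0 < 1 / 2"
    by (rule tendstoD) simp
  moreover have "\<forall>\<^sub>F w in at \<zeta>. den w \<noteq> 0"
  proof -
    have "\<forall>\<^sub>F w in nhds \<zeta>. w \<in> {z. den z \<noteq> 0}"
      using open_den den by (intro eventually_nhds_in_open) auto
    then show ?thesis by (simp add: eventually_nhds_conv_at)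
  qed
  ultimately have "\<forall>\<^sub>F w in at \<zeta>. den w \<noteq> 0 \<and> cmod (f w - \<zeta>) \<le> 1 / 2 * cmod (w - \<zeta>)"
    using eventually_neq_at_within[of \<zeta> \<zeta> UNIV]
  proof eventually_elim
    case (elim w)
    then have "cmod (w - \<zeta>) > 0" by simp
    with elim show ?case by (simp add: S_Pt norm_divide field_simps)
  qed
  then obtain \<delta> where \<delta>: "\<delta> > 0"
      "\<And>w. w \<noteq> \<zeta> \<Longrightarrow> dist w \<zeta> < \<delta> \<Longrightarrow> den w \<noteq> 0 \<and> cmod (f w - \<zeta>) \<le> 1 / 2 * cmod (w - \<zeta>)"
    unfolding eventually_at by auto
  have step: "den w \<noteq> 0 \<and> cmod (f w - \<zeta>) \<le> 1 / 2 * cmod (w - \<zeta>)" if "w \<in> ball \<zeta> \<delta>" for w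
    using \<delta>(2)[of w] that den f\<zeta> by (cases "w = \<zeta>") (auto simp: dist_commute)
  have ball: "Pt w \<in> basin S (Pt \<zeta>)" if w: "w \<in> ball \<zeta> \<delta>" for w
  proof -
    define c where "c = cmod (w - \<zeta>)"
    have "\<exists>v. (S ^^ n) (Pt w) = Pt v \<and> cmod (v - \<zeta>) \<le> (1 / 2)^n * c" for n
    proof (induction n)
      case 0
      then show ?case by (auto simp: c_def)
    next
      case (Suc n)
      then obtain v where v: "(S ^^ n) (Pt w) = Pt v" "cmod (v - \<zeta>) \<le> (1 / 2)^n * c" by blast
      have "(1 / 2)^n * c \<le> 1 * c"
        by (intro mult_right_mono power_le_one) (auto simp: c_def)
      then have v_ball: "v \<in> ball \<zeta> \<delta>"
        using v(2) w by (simp add: dist_norm norm_minus_commute c_def)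
      have "(S ^^ Suc n) (Pt w) = Pt (f v)" using v(1) step[OF v_ball] by (simp add: S_Pt)
      moreover have "cmod (f v - \<zeta>) \<le> (1 / 2)^Suc n * c" using step[OF v_ball] v(2) by simp
      ultimately show ?case by blast
    qed
    then obtain v where v: "\<And>n. (S ^^ n) (Pt w) = Pt (v n)" "\<And>n. cmod (v n - \<zeta>) \<le> (1 / 2)^n * c"
      by metis
    have "(\<lambda>n. (1 / 2)^n * c) \<longlonglongrightarrow> 0"
      by (rule tendsto_mult_left_zero[OF LIMSEQ_realpow_zero]) auto
    moreover have "\<forall>\<^sub>F n in sequentially. cmod (v n - \<zeta>) \<le> (1 / 2)^n * c"
      using v(2) by (intro always_eventually allI)
    ultimately have "(\<lambda>n. v n - \<zeta>) \<longlonglongrightarrow> 0" by (rule Lim_null_comparison[rotated])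
    then have "v \<longlonglongrightarrow> \<zeta>" by (simp add: LIM_zero_iff)
    then show ?thesis unfolding basin_def mem_Collect_eq v(1) by (rule tendsto_Pt)
  qed
  \<comment> \<open>The points whose orbit stays finite for \<open>n\<close> steps and then lies in
    the ball. An orbit that hits \<open>Infty\<close> remains there, so no point of the basin is
    lost.\<close>
  define W where "W n = ((\<lambda>V. {z. den z \<noteq> 0} \<inter> f -` V) ^^ n) (ball \<zeta> \<delta>)" for n
  have W_Suc: "W (Suc n) = {z. den z \<noteq> 0} \<inter> f -` W n" for n by (simp add: W_def)
  have W_open: "open (W n)" for n
  proof (induction n)
    case (Suc n)
    have "continuous_on {z. den z \<noteq> 0} f"
      by (intro continuous_at_imp_continuous_on ballI isCont_f) simp
    then show ?case unfolding W_Suc using open_den Suc by (rule continuous_open_preimage)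
  qed (simp add: W_def)
  have W_basin: "Pt z \<in> basin S (Pt \<zeta>)" if "z \<in> W n" for n z
    using that
  proof (induction n arbitrary: z)
    case 0
    then show ?case by (intro ball) (simp add: W_def)
  next
    case (Suc n)
    then have "S (Pt z) \<in> basin S (Pt \<zeta>)" by (auto simp: W_Suc S_Pt)
    then show ?case by (simp only: basin_step)
  qed
  have in_W: "z \<in> W n" if "(S ^^ n) (Pt z) \<in> Pt ` ball \<zeta> \<delta>" for n z
    using that
  proof (induction n arbitrary: z)
    case 0
    then show ?case by (auto simp: W_def)
  next
    case (Suc n)
    have e: "(S ^^ n) (S (Pt z)) \<in> Pt ` ball \<zeta> \<delta>"
      using Suc.prems by (simp only: funpow_Suc_right comp_apply)
    have "den z \<noteq> 0"
    proof
      assume "den z = 0"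
      then show False using e by (auto simp: S_Pt S_pow_Infty)
    qed
    then show ?case using Suc.IH[of "f z"] e by (simp add: W_Suc S_Pt)
  qed
  have "\<exists>n. z \<in> W n" if "Pt z \<in> basin S (Pt \<zeta>)" for z
  proof -
    have "open (Pt ` ball \<zeta> \<delta>)" by (intro open_image_Pt open_ball)
    moreover have "Pt \<zeta> \<in> Pt ` ball \<zeta> \<delta>" using \<delta>(1) by simp
    ultimately have "\<forall>\<^sub>F n in sequentially. (S ^^ n) (Pt z) \<in> Pt ` ball \<zeta> \<delta>"
      using that unfolding basin_def mem_Collect_eq by (rule topological_tendstoD[rotated])
    then obtain n where "(S ^^ n) (Pt z) \<in> Pt ` ball \<zeta> \<delta>"
      unfolding eventually_sequentially by blast
    then show ?thesis using in_W by blast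
  qed
  then have "{z. Pt z \<in> basin S (Pt \<zeta>)} = (\<Union>n. W n)" using W_basin by blast
  then show ?thesis using W_open by auto
qed

section \<open>Rigidity for Chebyshev's method\<close>

context
  assumes Fatou_S: "Fatou S = (\<Union>\<zeta>\<in>{\<zeta>. superattracting_fixpoint S \<zeta>}. basin S \<zeta>)"
begin

lemma Fatou_S_step: "S x \<in> Fatou S \<longleftrightarrow> x \<in> Fatou S"
  unfolding Fatou_S by (simp add: basin_step)

lemma in_Fatou_S_iff:
  "Pt z \<in> Fatou S \<longleftrightarrow> (\<exists>\<zeta>. superattracting_fixpoint S (Pt \<zeta>) \<and> Pt z \<in> basin S (Pt \<zeta>))"
proof
  assume "Pt z \<in> Fatou S"
  then obtain \<zeta> where \<zeta>: "superattracting_fixpoint S \<zeta>" "Pt z \<in> basin S \<zeta>"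
    unfolding Fatou_S by blast
  then show "\<exists>\<zeta>. superattracting_fixpoint S (Pt \<zeta>) \<and> Pt z \<in> basin S (Pt \<zeta>)"
    using not_superattracting_Infty by (cases \<zeta>) auto
next
  assume "\<exists>\<zeta>. superattracting_fixpoint S (Pt \<zeta>) \<and> Pt z \<in> basin S (Pt \<zeta>)"
  then show "Pt z \<in> Fatou S" unfolding Fatou_S by blast
qed

lemma Infty_not_in_Fatou_S: "Infty \<notin> Fatou S"
proof
  assume "Infty \<in> Fatou S"
  then obtain \<zeta> where \<zeta>: "superattracting_fixpoint S \<zeta>" "Infty \<in> basin S \<zeta>"
    unfolding Fatou_S by blast
  then have "\<zeta> = Infty" using basin_fixpoint[of S Infty \<zeta>] S_Infty by simp
  then show False using \<zeta>(1) not_superattracting_Infty by simp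
qed

lemma f_in_Fatou_S: "den z \<noteq> 0 \<Longrightarrow> Pt (f z) \<in> Fatou S \<longleftrightarrow> Pt z \<in> Fatou S"
  using Fatou_S_step[of "Pt z"] by (simp add: S_Pt)

text \<open>The origin is a pole, so it is mapped to the Julia point \<open>Infty\<close>.\<close>

lemma zero_not_in_Fatou_S: "Pt 0 \<notin> Fatou S"
  using Fatou_S_step[of "Pt 0"] Infty_not_in_Fatou_S by (simp add: S_Pt den_def)

lemma uminus_in_Fatou_S: "Pt (- z) \<in> Fatou S \<longleftrightarrow> Pt z \<in> Fatou S"
proof -
  have imp: "Pt (- z) \<in> Fatou S" if z: "Pt z \<in> Fatou S" for z
  proof -
    obtain \<zeta> where \<zeta>: "superattracting_fixpoint S (Pt \<zeta>)" "Pt z \<in> basin S (Pt \<zeta>)"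
      using z in_Fatou_S_iff by blast
    have "neg_sphere (Pt z) \<in> basin S (neg_sphere (Pt \<zeta>))"
      using S_neg_sphere continuous_on_neg_sphere \<zeta>(2) by (rule basin_equivariant)
    then show ?thesis
      unfolding in_Fatou_S_iff using superattracting_neg[OF \<zeta>(1)] by (intro exI[of _ "- \<zeta>"]) simp
  qed
  show ?thesis using imp[of z] imp[of "- z"] by (simp only: minus_minus) blast
qed

lemma cnj_in_Fatou_S: "Pt (cnj z) \<in> Fatou S \<longleftrightarrow> Pt z \<in> Fatou S"
proof -
  have imp: "Pt (cnj z) \<in> Fatou S" if z: "Pt z \<in> Fatou S" for z
  proof -
    obtain \<zeta> where \<zeta>: "superattracting_fixpoint S (Pt \<zeta>)" "Pt z \<in> basin S (Pt \<zeta>)"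
      using z in_Fatou_S_iff by blast
    have "cnj_sphere (Pt z) \<in> basin S (cnj_sphere (Pt \<zeta>))"
      using S_cnj_sphere continuous_on_cnj_sphere \<zeta>(2) by (rule basin_equivariant)
    then show ?thesis
      unfolding in_Fatou_S_iff using superattracting_cnj[OF \<zeta>(1)] by (intro exI[of _ "cnj \<zeta>"]) simp
  qed
  show ?thesis using imp[of z] imp[of "cnj z"] by (simp only: complex_cnj_cnj) blast
qed

lemma real_in_Fatou_S: "x \<ge> 1 \<Longrightarrow> Pt (of_real x) \<in> Fatou S"
  unfolding in_Fatou_S_iff using superattracting_1 real_in_basin by blast

lemma imaginary_in_Fatou_S: "x \<ge> 1 \<Longrightarrow> Pt (\<i> * of_real x) \<in> Fatou S"
  unfolding in_Fatou_S_iff using superattracting_ii imaginary_in_basin by blast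

text \<open>Otherwise the basin of 1 and the union of the other basins would split the connected
  circle into disjoint relatively open parts, containing \<open>\<rho>\<close> and
  \<open>- \<rho>\<close> respectively.\<close>

lemma circle_not_subset_Fatou_S:
  assumes "\<rho> \<ge> 1"
  shows "\<exists>z. cmod z = \<rho> \<and> Pt z \<notin> Fatou S"
proof (rule ccontr)
  assume "\<not> ?thesis"
  then have all: "Pt z \<in> Fatou S" if "cmod z = \<rho>" for z using that by blast
  define A where "A = {z. Pt z \<in> basin S (Pt 1)}"
  define B where "B = (\<Union>\<zeta>\<in>{\<zeta>. superattracting_fixpoint S (Pt \<zeta>) \<and> \<zeta> \<noteq> 1}. {z. Pt z \<in> basin S (Pt \<zeta>)})"
  have "open A" unfolding A_def by (rule open_basin[OF superattracting_1])
  moreover have "open B" unfolding B_def by (intro open_UN ballI open_basin) simp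
  moreover have "A \<inter> B = {}"
  proof -
    have False if "z \<in> A" "z \<in> B" for z
    proof -
      obtain \<zeta> where "\<zeta> \<noteq> 1" "Pt z \<in> basin S (Pt \<zeta>)" using \<open>z \<in> B\<close> unfolding B_def by blast
      moreover have "Pt z \<in> basin S (Pt 1)" using \<open>z \<in> A\<close> by (simp add: A_def)
      ultimately show False using basin_disjoint[of "Pt z" S "Pt \<zeta>" "Pt 1"] by simp
    qed
    then show ?thesis by blast
  qed
  moreover have "sphere 0 \<rho> \<subseteq> A \<union> B"
  proof
    fix z :: complex assume "z \<in> sphere 0 \<rho>"
    then have "Pt z \<in> Fatou S" by (intro all) simp
    then obtain \<zeta> where "superattracting_fixpoint S (Pt \<zeta>)" "Pt z \<in> basin S (Pt \<zeta>)"
      unfolding in_Fatou_S_iff by blast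
    then show "z \<in> A \<union> B" unfolding A_def B_def by (cases "\<zeta> = 1") auto
  qed
  moreover have "connected (sphere (0 :: complex) \<rho>)"
    by (rule connected_sphere) simp
  ultimately have "A \<inter> sphere 0 \<rho> = {} \<or> B \<inter> sphere 0 \<rho> = {}"
    by (intro connectedD) auto
  moreover have "of_real \<rho> \<in> A \<inter> sphere 0 \<rho>"
    using real_in_basin[OF assms] assms by (simp add: A_def)
  moreover have "- of_real \<rho> \<in> B \<inter> sphere 0 \<rho>"
  proof -
    have "neg_sphere (Pt (of_real \<rho>)) \<in> basin S (neg_sphere (Pt 1))"
      using S_neg_sphere continuous_on_neg_sphere real_in_basin[OF assms] by (rule basin_equivariant)
    then have "- of_real \<rho> \<in> B"
      unfolding B_def using superattracting_neg[OF superattracting_1]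
      by (intro UN_I[of "- 1"]) simp_all
    then show ?thesis using assms by simp
  qed
  ultimately show False by blast
qed

lemma chebyshev_rigid:
  assumes \<alpha>: "cmod \<alpha> = 1"
    and iff: "\<And>z. Pt (\<alpha> * z + \<beta>) \<in> Fatou S \<longleftrightarrow> Pt z \<in> Fatou S"
  shows "\<alpha>^2 = 1 \<and> \<beta> = 0"
proof -
  define F where "F = {z. Pt z \<in> Fatou S}"
  have \<alpha>0: "\<alpha> \<noteq> 0" using \<alpha> by auto
  have F_iff: "\<alpha> * z + \<beta> \<in> F \<longleftrightarrow> z \<in> F" and F_minus: "- z \<in> F \<longleftrightarrow> z \<in> F" and F_cnj: "cnj z \<in> F \<longleftrightarrow> z \<in> F" for z
    using iff[of z] uminus_in_Fatou_S[of z] cnj_in_Fatou_S[of z] by (simp_all add: F_def)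
  \<comment> \<open>Conjugating negation by the symmetry and composing with negation gives the
    translation by \<open>2 * \<beta>\<close>; \<open>u\<close> is the preimage of
    \<open>- z\<close> under the symmetry.\<close>
  have shift: "z + 2 * \<beta> \<in> F \<longleftrightarrow> z \<in> F" for z
  proof -
    define u where "u = - (z + \<beta>) / \<alpha>"
    have u: "\<alpha> * u + \<beta> = - z" "\<alpha> * (- u) + \<beta> = z + 2 * \<beta>" using \<alpha>0 by (simp_all add: u_def)
    have "- z \<in> F \<longleftrightarrow> u \<in> F" "z + 2 * \<beta> \<in> F \<longleftrightarrow> - u \<in> F"
      using F_iff[of u] F_iff[of "- u"] unfolding u by blast+
    then show ?thesis by (simp only: F_minus)
  qed
  have shift_cnj: "z + 2 * cnj \<beta> \<in> F \<longleftrightarrow> z \<in> F" for z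
    using shift[of "cnj z"] F_cnj[of "z + 2 * cnj \<beta>"] F_cnj[of z] by simp
  \<comment> \<open>A translation preserving \<open>F\<close> keeps every multiple of
    \<open>t\<close> outside \<open>F\<close>, as 0 is outside.\<close>
  have no_shift: False if t: "\<And>z. z + t \<in> F \<longleftrightarrow> z \<in> F" and ev: "of_nat n * t \<in> F" for t n
  proof -
    have "of_nat k * t \<notin> F" for k
    proof (induction k)
      case 0
      then show ?case using zero_not_in_Fatou_S by (simp add: F_def)
    next
      case (Suc k)
      then show ?case using t[of "of_nat k * t"] by (simp add: algebra_simps)
    qed
    then show False using ev by blast
  qed
  have real_F: "of_real x \<in> F" if "\<bar>x\<bar> \<ge> 1" for x
  proof (cases "x \<ge> 0")
    case True
    then show ?thesis using real_in_Fatou_S[of x] that by (simp add: F_def)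
  next
    case False
    then show ?thesis using real_in_Fatou_S[of "- x"] F_minus[of "of_real x"] that by (simp add: F_def)
  qed
  have imaginary_F: "\<i> * of_real x \<in> F" if "\<bar>x\<bar> \<ge> 1" for x
  proof (cases "x \<ge> 0")
    case True
    then show ?thesis using imaginary_in_Fatou_S[of x] that by (simp add: F_def)
  next
    case False
    then show ?thesis
      using imaginary_in_Fatou_S[of "- x"] F_minus[of "\<i> * of_real x"] that by (simp add: F_def)
  qed
  have "Re \<beta> = 0"
  proof (rule ccontr)
    assume ne: "Re \<beta> \<noteq> 0"
    \<comment> \<open>Adding the conjugate cancels the imaginary part, so multiples of
      \<open>t\<close> run along the real axis into \<open>F\<close>.\<close>
    define t where "t = 2 * \<beta> + 2 * cnj \<beta>"
    have t: "t = of_real (4 * Re \<beta>)" by (simp add: t_def complex_eq_iff)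
    obtain n where n: "1 < real n * \<bar>4 * Re \<beta>\<bar>" using ex_less_of_nat_mult[of "\<bar>4 * Re \<beta>\<bar>" 1] ne by auto
    have "of_real (real n * (4 * Re \<beta>)) \<in> F" using n by (intro real_F) (simp add: abs_mult)
    then have "of_nat n * t \<in> F" by (simp add: t)
    moreover have "z + t \<in> F \<longleftrightarrow> z \<in> F" for z
      using shift[of z] shift_cnj[of "z + 2 * \<beta>"] by (simp add: t_def add.assoc)
    ultimately show False using no_shift by blast
  qed
  moreover have "Im \<beta> = 0"
  proof (rule ccontr)
    assume ne: "Im \<beta> \<noteq> 0"
    \<comment> \<open>Subtracting the conjugate leaves a purely imaginary translation.\<close>
    define t where "t = 2 * \<beta> - 2 * cnj \<beta>"
    have t: "t = \<i> * of_real (4 * Im \<beta>)" by (simp add: t_def complex_eq_iff)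
    obtain n where n: "1 < real n * \<bar>4 * Im \<beta>\<bar>" using ex_less_of_nat_mult[of "\<bar>4 * Im \<beta>\<bar>" 1] ne by auto
    have "\<i> * of_real (real n * (4 * Im \<beta>)) \<in> F" using n by (intro imaginary_F) (simp add: abs_mult)
    then have "of_nat n * t \<in> F" by (simp add: t mult.left_commute)
    moreover have "z + t \<in> F \<longleftrightarrow> z \<in> F" for z
      using shift[of "z - 2 * cnj \<beta>"] shift_cnj[of "z - 2 * cnj \<beta>"] by (simp add: t_def algebra_simps)
    ultimately show False using no_shift by blast
  qed
  ultimately have \<beta>: "\<beta> = 0" by (simp add: complex_eq_iff)
  have "\<alpha>^2 = 1"
  proof (rule ccontr)
    assume \<alpha>2: "\<alpha>^2 \<noteq> 1"
    have "F = Pt -` Fatou S" by (auto simp: F_def)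
    then have openF: "open F" using open_vimage_Pt[OF open_Fatou] by simp
    have a0: "a \<noteq> 0" using b by (simp add: a_def)
    have reals: "complex_of_real x \<in> F" "\<i> * complex_of_real x \<in> F" if "x > 1" for x
      using real_F[of x] imaginary_F[of x] that by auto
    have inv: "cheb (of_real a) (of_real b) z \<in> F \<longleftrightarrow> z \<in> F" if "cmod z \<ge> 1" for z
      using f_in_Fatou_S[OF den_nonzero[OF that]] by (simp add: F_def f_def)
    have rot: "\<alpha> * z \<in> F \<longleftrightarrow> z \<in> F" for z using F_iff[of z] \<beta> by simp
    obtain R' where R': "\<And>w. cmod w \<ge> R' \<Longrightarrow> w \<in> F"
      using cheb_rotation_all[OF a0 openF F_minus reals inv \<alpha> \<alpha>2 rot] by blast
    obtain z where "cmod z = max 1 R'" "Pt z \<notin> Fatou S"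
      using circle_not_subset_Fatou_S[of "max 1 R'"] by auto
    then show False using R'[of z] by (simp add: F_def)
  qed
  then show ?thesis using \<beta> by simp
qed

lemma symmetry_group_S: "symmetry_group S = {\<lambda>z. z, \<lambda>z. - z}"
proof (rule symmetry_group_eq_pm_id)
  show "Pt (- z) \<in> Fatou S" if "Pt z \<in> Fatou S" for z
    using that by (simp only: uminus_in_Fatou_S)
qed (rule chebyshev_rigid)

end

end

theorem theorem3p14:
  fixes b b1 b3 :: real
  assumes "0 < b" and "b < 1"
    and "0 < b1" and "extraneous_fixpoint (p_neg b) (of_real b1)"
    and "\<And>x :: real. 0 < x \<Longrightarrow> extraneous_fixpoint (p_neg b) (of_real x) \<Longrightarrow> x \<le> b1"
    and "0 < b3" and "extraneous_fixpoint (p_neg b) (\<i> * of_real b3)"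
    and "Fatou (chebyshev_map (p_neg b)) =
           (\<Union>\<zeta> \<in> {\<zeta>. superattracting_fixpoint (chebyshev_map (p_neg b)) \<zeta>}.
              basin (chebyshev_map (p_neg b)) \<zeta>)"
    and "b1 \<noteq> b3"
  shows "symmetry_group (poly_map (p_neg b)) = symmetry_group (chebyshev_map (p_neg b))"
  unfolding symmetry_group_poly_map_p_neg[OF assms(1,2)]
  by (rule symmetry_group_S[OF assms(1,2,8), symmetric])

end
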